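(* Let $F$ be a smooth, time-independent (divergence-free) force, let $\nu>0$, let $a_1=1,a_2,a_3>0$ be fixed, let $\beta>5/2$, $\gamma>\beta+4$, and let $f^*$, $B_{\gamma I}\subset H^\gamma$ and the absorbing set $B_\beta\subset H^\beta$ be as described in the context. Then for every $f>f^*$ and every $\alpha\ge 0$ the three-dimensional rotating Navier–Stokes-$\alpha$ equations $$\frac{\partial V}{\partial t}+fP_LJP_L\mathcal{R}_{\alpha}V+\nu AV+B_{\alpha}(V,V)=F,\qquad V|_{t=0}=V(0),$$ with solution semiflow $S_\alpha(t)$, possess a global compact attractor $\mathcal{A}_\beta$ in the topology of $H^\beta$, as well as exponential attractors $\mathcal{M}_\beta$ (for the topology of $H^\beta$) in the absorbing set $B_\beta$. Both the fractal dimensions and the rates of exponential attraction are uniform in $\alpha$ (i.e. the fractal dimensions admit a finite bound independent of $\alpha$, and the constants $c_0,c_1>0$ in the exponential attraction estimate can be chosen independent of $\alpha$).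
   Context: Setting. $Q=[0,2\pi a_1]\times[0,2\pi a_2]\times[0,2\pi a_3]$, with periodic boundary conditions (and stress-free boundary conditions in the vertical direction). For $s\ge 0$, $H^s$ is the Fourier–Sobolev space of $Q$-periodic, divergence-free, zero-mean vector fields $u$ on $\mathbb{R}^3$ with Fourier coefficients $u_n$, $n\in\mathbb{Z}^3$, and norm $\|u\|_s^2=\sum_{n\in\mathbb{Z}^3}|\check n|^{2s}|u_n|^2$, where $\check n=(n_1/a_1,n_2/a_2,n_3/a_3)$; $a_1=1$ without loss of generality. Operators. $P_L$ is the Leray projector onto divergence-free fields, $A=-P_L\Delta$ the Stokes operator, $\mathcal{R}_\alpha=(1-\alpha^2\Delta)^{-1}$, $J=\begin{pmatrix}0&-1&0\\1&0&0\\0&0&0\end{pmatrix}$, $f=2\Omega$ is the Coriolis parameter, $\nu>0$ the viscosity, and $B_\alpha(u,v)=P_L\big[(\mathcal{R}_\alpha u\cdot\nabla)v+\sum_j v_j\nabla(\mathcal{R}_\alpha u)_j\big]$ on divergence-free vector fields. The threshold $f^*$ and the sets $B_{\gamma I}$, $B_\beta$ (known result, taken as given). Let $\beta>5/2$, $\gamma>\beta+4$, $\|F\|_{\beta-1}^2\le M_{\beta F}^2$, $\|F\|_{\gamma-1}^2\le M_{\gamma F}^2$, and let $B_{\gamma I}$ be a ball in $H^\gamma$ of initial data with diameter $<2\rho_{\gamma I}$ in the $H^\gamma$ norm and $<2\rho_{\beta I}$ in the $H^\beta$ norm. There is $f^*=f^*(M_{\beta F},M_{\gamma F},\rho_{\gamma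 I},\rho_{\beta I},\nu,a_1,a_2,a_3)$, independent of $\alpha\ge 0$, such that for $f\ge f^*$ unique regular solutions exist for initial data in $B_{\gamma I}$, and the equations possess an absorbing set $B_\beta$ in $H^\beta$: there is $t_\beta=t_\beta(\rho_{\beta I})$ such that $V(0)\in B_{\gamma I}$ implies $\|V(t)\|_\beta\le\rho_\beta$ and $\nu\int_t^{t+1}\|V(\tau)\|_{\beta+1}^2\,d\tau\le M_{\beta+1}^2$ for all $t\ge t_\beta$. The absorbing set is uniform in $\alpha$, and $\rho_\beta,M_{\beta+1}$ depend only on $M_{\beta F},\nu,a_1,a_2,a_3$. The semiflow $S_\alpha(t):V(0)\mapsto V(t)$ is compact on $H^\beta$, and $B_\beta$ is taken compact in $H^\beta$ (modulo a small translate in time). Attractors. The global attractor is the maximal compact invariant set $\mathcal{A}$ ($S(t)\mathcal{A}=\mathcal{A}$ for all $t\ge0$), which is the minimal set attracting all bounded sets of the phase space. Here it is understood in the "$H^\beta$–$H^\gamma$" sense: the phase space is the compact set $B_\beta$, which absorbs $B_{\gamma I}\subset H^\gamma$ in the $H^\beta$ topology, and attraction is measured in the $H^\beta$ norm. For a complete metric space $(E,d)$, a compact $X\subset E$ and a semigroup $S(t)$ on $X$ with global attractor $\mathcal{A}$, an exponential attractor for $(S(t),X)$ is a compact set $\mathcal{M}$ such that (i) $\mathcal{A}\subseteq\mathcal{M}\subseteq X$; (ii) $S(t)\mathcal{M}\subseteq\mathcal{M}$ for $t\ge0$; (iii) the fractal (box-counting) dimension of $\mathcal{M}$ is finite; (iv)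 there are constants $c_0,c_1>0$ with $d_h(S(t)X,\mathcal{M})\le c_0e^{-c_1t}$ for all $t\ge0$, where $d_h(X,Y)=\sup_{x\in X}\inf_{y\in Y}d(x,y)$. Here $E=H^\beta$ with the norm metric and $X=B_\beta$. *)

theory Defs
  imports "HOL-Analysis.Analysis"
begin

section \<open>Periodic vector fields and their Fourier coefficients\<close>

text \<open>
  A field that is periodic with respect to
  \<open>Q = [0, 2 \<pi> a\<^sub>1] \<times> [0, 2 \<pi> a\<^sub>2] \<times> [0, 2 \<pi> a\<^sub>3]\<close> is represented by its Fourier
  coefficients: \<open>u x = (\<Sum>n. u\<^sub>n exp (\<i> (wave a n \<bullet> x)))\<close>, \<open>n\<close> ranging over \<open>\<int>\<^sup>3\<close>.
  By Riesz-Fischer this is the space of square integrable fields modulo null sets, so that the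
  Sobolev norms below are genuine norms.
\<close>

type_synonym scalar_modes = "int ^ 3 \<Rightarrow> complex"
type_synonym modes = "int ^ 3 \<Rightarrow> complex ^ 3"

definition wave :: "real ^ 3 \<Rightarrow> int ^ 3 \<Rightarrow> real ^ 3" where
  "wave a n = (\<chi> j. of_int (n $ j) / a $ j)"

definition wave_dot :: "real ^ 3 \<Rightarrow> int ^ 3 \<Rightarrow> complex ^ 3 \<Rightarrow> complex" where
  "wave_dot a n z = (\<Sum>j\<in>UNIV. of_real (wave a n $ j) * z $ j)"

text \<open>
  In the stress-free case the conditions \<open>u\<^sub>3 = 0\<close>, \<open>\<partial>\<^sub>3 u\<^sub>1 = \<partial>\<^sub>3 u\<^sub>2 = 0\<close> on horizontal
  boundary planes are encoded, as usual, by symmetry of the periodic extension: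
  \<open>u\<^sub>1, u\<^sub>2\<close> are even and \<open>u\<^sub>3\<close> is odd in \<open>x\<^sub>3\<close>.
\<close>

datatype vertical_bc = Periodic | Stress_Free

definition vertical_even_odd :: "modes \<Rightarrow> bool" where
  "vertical_even_odd u \<longleftrightarrow>
     (\<forall>n. u (vector [n $ 1, n $ 2, - (n $ 3)]) = vector [u n $ 1, u n $ 2, - (u n $ 3)])"

definition hnorm :: "real ^ 3 \<Rightarrow> real \<Rightarrow> modes \<Rightarrow> real" where
  "hnorm a s u = sqrt (\<Sum>\<^sub>\<infinity>n. norm (wave a n) powr (2 * s) * (norm (u n))\<^sup>2)"

text \<open>The clauses: zero mean, real valued, divergence free,
  finite norm (\<open>hnorm\<close> alone is meaningless when the series diverges), boundary condition.\<close>

definition sobolev :: "vertical_bc \<Rightarrow> real ^ 3 \<Rightarrow> real \<Rightarrow> modes set" where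
  "sobolev bc a s =
     {u. u 0 = 0
       \<and> (\<forall>n. u (- n) = (\<chi> j. cnj (u n $ j)))
       \<and> (\<forall>n. wave_dot a n (u n) = 0)
       \<and> (\<lambda>n. norm (wave a n) powr (2 * s) * (norm (u n))\<^sup>2) summable_on UNIV
       \<and> (bc = Stress_Free \<longrightarrow> vertical_even_odd u)}"

definition hdist :: "real ^ 3 \<Rightarrow> real \<Rightarrow> modes \<Rightarrow> modes \<Rightarrow> real" where
  "hdist a s u v = hnorm a s (\<lambda>n. u n - v n)"

lemma wave_nonzero:
  assumes "\<And>j. a $ j > 0" "n \<noteq> 0"
  shows "wave a n \<noteq> 0"
proof
  assume w: "wave a n = 0"
  have "n $ j = 0" for j
  proof -
    have "wave a n $ j = 0" using w by simp
    then show ?thesis using assms(1)[of j] by (simp add: wave_def)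
  qed
  then show False using assms(2) by (simp add: vec_eq_iff)
qed

lemma summable_hdist:
  assumes "u \<in> sobolev bc a s" "v \<in> sobolev bc a s"
  shows "(\<lambda>n. norm (wave a n) powr (2 * s) * (norm (u n - v n))\<^sup>2) summable_on UNIV"
proof -
  let ?w = "\<lambda>n. norm (wave a n) powr (2 * s)"
  have "(\<lambda>n. 2 * (?w n * (norm (u n))\<^sup>2) + 2 * (?w n * (norm (v n))\<^sup>2)) summable_on UNIV"
    using assms unfolding sobolev_def
    by (intro summable_on_add summable_on_cmult_right) auto
  then show ?thesis
  proof (rule summable_on_comparison_test)
    fix n :: "int ^ 3"
    show "0 \<le> ?w n * (norm (u n - v n))\<^sup>2" by simp
    have "(norm (u n - v n))\<^sup>2 \<le> (norm (u n) + norm (v n))\<^sup>2"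
      by (intro power_mono norm_triangle_ineq4) auto
    also have "\<dots> \<le> 2 * (norm (u n))\<^sup>2 + 2 * (norm (v n))\<^sup>2"
      using sum_squares_bound[of "norm (u n)" "norm (v n)"] by (simp add: power2_sum)
    finally show "?w n * (norm (u n - v n))\<^sup>2
        \<le> 2 * (?w n * (norm (u n))\<^sup>2) + 2 * (?w n * (norm (v n))\<^sup>2)"
      using mult_left_mono[of _ _ "?w n"] by (fastforce simp: distrib_left)
  qed
qed

lemma hdist_eq_0_iff:
  assumes "\<And>j. a $ j > 0" "u \<in> sobolev bc a s" "v \<in> sobolev bc a s"
  shows "hdist a s u v = 0 \<longleftrightarrow> u = v"
proof
  let ?t = "\<lambda>n. norm (wave a n) powr (2 * s) * (norm (u n - v n))\<^sup>2"
  assume "hdist a s u v = 0"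
  then have "infsum ?t UNIV = 0" by (simp add: hdist_def hnorm_def)
  then have "?t n = 0" for n
    using nonneg_infsum_le_0D[of ?t UNIV n] summable_hdist[OF assms(2,3)] by simp
  then have *: "u n = v n" if "n \<noteq> 0" for n
    using wave_nonzero[OF assms(1) that] by (metis eq_iff_diff_eq_0 mult_eq_0_iff norm_eq_zero
        powr_eq_0_iff zero_eq_power2)
  moreover have "u 0 = v 0" using assms(2,3) by (simp add: sobolev_def)
  ultimately show "u = v" by (metis ext)
qed (simp add: hdist_def hnorm_def)

lemma hdist_triangle:
  assumes "u \<in> sobolev bc a s" "v \<in> sobolev bc a s" "w \<in> sobolev bc a s"
  shows "hdist a s u w \<le> hdist a s u v + hdist a s v w"
proof -
  let ?t = "\<lambda>u v n. norm (wave a n) powr (2 * s) * (norm (u n - v n))\<^sup>2"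
  let ?r = "\<lambda>u v n. norm (wave a n) powr s * norm (u n - v n)"
  have sq: "?t u v n = (?r u v n)\<^sup>2" for u v :: modes and n
    by (simp add: power_mult_distrib power2_eq_square powr_add[symmetric])
  have le: "L2_set (?r u v) A \<le> hdist a s u v"
    if "finite A" "u \<in> sobolev bc a s" "v \<in> sobolev bc a s" for A u v
    unfolding L2_set_def hdist_def hnorm_def sq[symmetric]
    by (intro real_sqrt_le_mono finite_sum_le_infsum summable_hdist[where bc = bc] that) auto
  have nn: "0 \<le> hdist a s u v" for u v
    by (simp add: hdist_def hnorm_def infsum_nonneg)
  have "sum (?t u w) A \<le> (hdist a s u v + hdist a s v w)\<^sup>2" if "finite A" for A
  proof -
    have "L2_set (?r u w) A \<le> L2_set (\<lambda>n. ?r u v n + ?r v w n) A"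
    proof (intro L2_set_mono)
      fix n
      have "norm (u n - w n) \<le> norm (u n - v n) + norm (v n - w n)"
        using norm_triangle_ineq[of "u n - v n" "v n - w n"] by simp
      then show "?r u w n \<le> ?r u v n + ?r v w n"
        using mult_left_mono[of _ _ "norm (wave a n) powr s"] by (fastforce simp: distrib_left)
    qed auto
    also have "\<dots> \<le> L2_set (?r u v) A + L2_set (?r v w) A" by (rule L2_set_triangle_ineq)
    also have "\<dots> \<le> hdist a s u v + hdist a s v w"
      using le[OF that] assms by (intro add_mono) auto
    finally have "(L2_set (?r u w) A)\<^sup>2 \<le> (hdist a s u v + hdist a s v w)\<^sup>2"
      by (intro power_mono) auto
    then show ?thesis by (simp add: L2_set_def sq sum_nonneg)
  qed
  then have "infsum (?t u w) UNIV \<le> (hdist a s u v + hdist a s v w)\<^sup>2"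
    by (intro infsum_le_finite_sums summable_hdist[where bc = bc] assms) auto
  then show ?thesis
    unfolding hdist_def[of a s u w] hnorm_def
    using nn by (intro real_le_lsqrt) (auto simp: infsum_nonneg)
qed

lemma Metric_space_sobolev:
  assumes "\<And>j. a $ j > 0"
  shows "Metric_space (sobolev bc a s) (hdist a s)"
proof
  show "0 \<le> hdist a s u v" for u v
    by (simp add: hdist_def hnorm_def infsum_nonneg)
  show "hdist a s u v = hdist a s v u" for u v
    by (simp add: hdist_def hnorm_def norm_minus_commute)
qed (use hdist_eq_0_iff[OF assms] hdist_triangle in auto)

abbreviation sobolev_topology :: "vertical_bc \<Rightarrow> real ^ 3 \<Rightarrow> real \<Rightarrow> modes topology" where
  "sobolev_topology bc a s \<equiv> Metric_space.mtopology (sobolev bc a s) (hdist a s)"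


section \<open>The rotating Navier-Stokes-alpha equations\<close>

text \<open>
  Products of functions become convolutions of coefficients, \<open>\<partial>\<^sub>j\<close> becomes multiplication by
  \<open>\<i> (wave a n)\<^sub>j\<close>. The mean is discarded by \<open>leray\<close>, the target being the space of zero-mean
  divergence-free fields.
\<close>

definition comp_modes :: "3 \<Rightarrow> modes \<Rightarrow> scalar_modes" where
  "comp_modes j u n = u n $ j"

definition mult_modes :: "scalar_modes \<Rightarrow> scalar_modes \<Rightarrow> scalar_modes" where
  "mult_modes p q n = (\<Sum>\<^sub>\<infinity>k. p k * q (n - k))"

definition partial_modes :: "real ^ 3 \<Rightarrow> 3 \<Rightarrow> scalar_modes \<Rightarrow> scalar_modes" where
  "partial_modes a j p n = \<i> * of_real (wave a n $ j) * p n"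

definition laplacian :: "real ^ 3 \<Rightarrow> modes \<Rightarrow> modes" where
  "laplacian a u n = (\<chi> i. \<Sum>j\<in>UNIV. partial_modes a j (partial_modes a j (comp_modes i u)) n)"

definition leray :: "real ^ 3 \<Rightarrow> modes \<Rightarrow> modes" where
  "leray a u n =
     (if n = 0 then 0
      else u n - (\<chi> i. wave_dot a n (u n) / of_real ((norm (wave a n))\<^sup>2) * of_real (wave a n $ i)))"

definition stokes :: "real ^ 3 \<Rightarrow> modes \<Rightarrow> modes" where
  "stokes a u n = - leray a (laplacian a u) n"

text \<open>Fourier multiplier of \<open>(1 - \<alpha>\<^sup>2 \<Delta>)\<^sup>-\<^sup>1\<close>.\<close>

definition helmholtz_inv :: "real ^ 3 \<Rightarrow> real \<Rightarrow> modes \<Rightarrow> modes" where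
  "helmholtz_inv a \<alpha> u n = (1 / (1 + \<alpha>\<^sup>2 * (norm (wave a n))\<^sup>2)) *\<^sub>R u n"

definition rot_matrix :: "complex ^ 3 ^ 3" where
  "rot_matrix = vector [vector [0, -1, 0], vector [1, 0, 0], vector [0, 0, 0]]"

definition rot :: "modes \<Rightarrow> modes" where
  "rot u n = rot_matrix *v u n"

definition advect :: "real ^ 3 \<Rightarrow> modes \<Rightarrow> modes \<Rightarrow> modes" where
  "advect a w v n =
     (\<chi> i. \<Sum>j\<in>UNIV. mult_modes (comp_modes j w) (partial_modes a j (comp_modes i v)) n)"

text \<open>\<open>\<Sum>\<^sub>j v\<^sub>j \<nabla> w\<^sub>j\<close>\<close>

definition stretch :: "real ^ 3 \<Rightarrow> modes \<Rightarrow> modes \<Rightarrow> modes" where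
  "stretch a w v n =
     (\<chi> i. \<Sum>j\<in>UNIV. mult_modes (comp_modes j v) (partial_modes a i (comp_modes j w)) n)"

definition B_alpha :: "real ^ 3 \<Rightarrow> real \<Rightarrow> modes \<Rightarrow> modes \<Rightarrow> modes" where
  "B_alpha a \<alpha> u v =
     leray a (\<lambda>n. advect a (helmholtz_inv a \<alpha> u) v n + stretch a (helmholtz_inv a \<alpha> u) v n)"

text \<open>
  A regular solution of class \<open>s\<close> on \<open>[0, \<infinity>)\<close> lies in
  \<open>C([0, \<infinity>); H\<^sup>s) \<inter> L\<^sup>2\<^sub>l\<^sub>o\<^sub>c([0, \<infinity>); H\<^sup>s\<^sup>+\<^sup>1)\<close>. The equation is required for every Fourier mode,
  that is, tested against every trigonometric polynomial.
  For \<open>s > 5/2\<close> all the convolutions converge absolutely and the time derivatives exist classically.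
\<close>

definition regular_solution ::
  "vertical_bc \<Rightarrow> real ^ 3 \<Rightarrow> real \<Rightarrow> modes \<Rightarrow> real \<Rightarrow> real \<Rightarrow> real \<Rightarrow> modes \<Rightarrow> (real \<Rightarrow> modes) \<Rightarrow> bool" where
  "regular_solution bc a \<nu> F f \<alpha> s V0 V \<longleftrightarrow>
     V 0 = V0
     \<and> continuous_map (top_of_set {0..}) (sobolev_topology bc a s) V
     \<and> (AE t in lborel. t \<ge> 0 \<longrightarrow> V t \<in> sobolev bc a (s + 1))
     \<and> (\<forall>T\<ge>0. set_integrable lborel {0..T} (\<lambda>t. (hnorm a (s + 1) (V t))\<^sup>2))
     \<and> (\<forall>n. \<forall>t\<ge>0. ((\<lambda>t. V t n) has_vector_derivative
            F n - f *\<^sub>R leray a (rot (leray a (helmholtz_inv a \<alpha> (V t)))) n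
                - \<nu> *\<^sub>R stokes a (V t) n
                - B_alpha a \<alpha> (V t) (V t) n) (at t within {0..}))"

definition uniquely_solvable ::
  "vertical_bc \<Rightarrow> real ^ 3 \<Rightarrow> real \<Rightarrow> modes \<Rightarrow> real \<Rightarrow> real \<Rightarrow> real \<Rightarrow> modes \<Rightarrow> bool" where
  "uniquely_solvable bc a \<nu> F f \<alpha> s V0 \<longleftrightarrow>
     (\<exists>V. regular_solution bc a \<nu> F f \<alpha> s V0 V)
     \<and> (\<forall>V W. regular_solution bc a \<nu> F f \<alpha> s V0 V \<and> regular_solution bc a \<nu> F f \<alpha> s V0 W
              \<longrightarrow> (\<forall>t\<ge>0. V t = W t))"

definition semiflow ::
  "vertical_bc \<Rightarrow> real ^ 3 \<Rightarrow> real \<Rightarrow> modes \<Rightarrow> real \<Rightarrow> real \<Rightarrow> real \<Rightarrow> real \<Rightarrow> modes \<Rightarrow> modes" where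
  "semiflow bc a \<nu> F f \<alpha> s t V0 = (THE v. \<exists>V. regular_solution bc a \<nu> F f \<alpha> s V0 V \<and> V t = v)"


section \<open>Threshold and absorbing set\<close>

definition is_ball :: "'a set \<Rightarrow> ('a \<Rightarrow> 'a \<Rightarrow> real) \<Rightarrow> 'a set \<Rightarrow> bool" where
  "is_ball E d B \<longleftrightarrow>
     (\<exists>c\<in>E. \<exists>r>0. B = Metric_space.mball E d c r \<or> B = Metric_space.mcball E d c r)"

definition diam :: "('a \<Rightarrow> 'a \<Rightarrow> real) \<Rightarrow> 'a set \<Rightarrow> real" where
  "diam d B = (SUP p\<in>B \<times> B. d (fst p) (snd p))"

text \<open>
  \<open>fstar\<close> is a threshold, uniform in \<open>\<alpha> \<ge> 0\<close>, above which initial data in \<open>BI \<subseteq> H\<^sup>\<gamma>\<close> have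
  unique regular solutions that enter the \<open>H\<^sup>\<beta>\<close> ball of radius \<open>\<rho>\<close> by time \<open>T\<close>.
\<close>

definition regularity_threshold ::
  "vertical_bc \<Rightarrow> real ^ 3 \<Rightarrow> real \<Rightarrow> modes \<Rightarrow> real \<Rightarrow> real \<Rightarrow> modes set \<Rightarrow> real \<Rightarrow> real \<Rightarrow> real \<Rightarrow> real \<Rightarrow> bool"
  where
  "regularity_threshold bc a \<nu> F \<beta> \<gamma> BI T \<rho> K fstar \<longleftrightarrow>
     (\<forall>f\<ge>fstar. \<forall>\<alpha>\<ge>0. \<forall>V0\<in>BI.
        uniquely_solvable bc a \<nu> F f \<alpha> \<gamma> V0
        \<and> (\<forall>V. regular_solution bc a \<nu> F f \<alpha> \<gamma> V0 V \<longrightarrow>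
             (\<forall>t\<ge>T. hnorm a \<beta> (V t) \<le> \<rho>
                   \<and> \<nu> * (LINT \<tau>:{t..t + 1}|lborel. (hnorm a (\<beta> + 1) (V \<tau>))\<^sup>2) \<le> K\<^sup>2)))"

text \<open>
  \<open>X\<close> is a compact phase space for the semiflow: it lies in the \<open>H\<^sup>\<beta>\<close> ball of radius \<open>\<rho>\<close>,
  the semiflow is defined on it and maps it to itself, and it absorbs \<open>BI\<close> by time \<open>T\<close>.
\<close>

definition compact_absorbing_set ::
  "vertical_bc \<Rightarrow> real ^ 3 \<Rightarrow> real \<Rightarrow> modes \<Rightarrow> real \<Rightarrow> real \<Rightarrow> real \<Rightarrow> modes set \<Rightarrow> real \<Rightarrow> real \<Rightarrow> modes set \<Rightarrow> bool"
  where
  "compact_absorbing_set bc a \<nu> F f \<alpha> \<beta> BI T \<rho> X \<longleftrightarrow>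
     compactin (sobolev_topology bc a \<beta>) X
     \<and> (\<forall>V0\<in>X. hnorm a \<beta> V0 \<le> \<rho>)
     \<and> (\<forall>V0\<in>X. uniquely_solvable bc a \<nu> F f \<alpha> \<beta> V0)
     \<and> (\<forall>t\<ge>0. semiflow bc a \<nu> F f \<alpha> \<beta> t ` X \<subseteq> X)
     \<and> (\<forall>t\<ge>T. semiflow bc a \<nu> F f \<alpha> \<beta> t ` BI \<subseteq> X)"


section \<open>Global and exponential attractors\<close>

text \<open>With values in \<open>[0, \<infinity>]\<close>, so that the distance of a nonempty set to \<open>{}\<close> is \<open>\<infinity>\<close>.\<close>

definition semidist :: "('a \<Rightarrow> 'a \<Rightarrow> real) \<Rightarrow> 'a set \<Rightarrow> 'a set \<Rightarrow> ennreal" where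
  "semidist d X Y = (SUP x\<in>X. INF y\<in>Y. ennreal (d x y))"

definition attracts_bounded ::
  "'a set \<Rightarrow> ('a \<Rightarrow> 'a \<Rightarrow> real) \<Rightarrow> 'a set \<Rightarrow> (real \<Rightarrow> 'a \<Rightarrow> 'a) \<Rightarrow> 'a set \<Rightarrow> bool" where
  "attracts_bounded E d X S A \<longleftrightarrow>
     (\<forall>B. B \<subseteq> X \<and> Metric_space.mbounded E d B
        \<longrightarrow> ((\<lambda>t. semidist d (S t ` B) A) \<longlongrightarrow> 0) at_top)"

definition global_attractor ::
  "'a set \<Rightarrow> ('a \<Rightarrow> 'a \<Rightarrow> real) \<Rightarrow> 'a set \<Rightarrow> (real \<Rightarrow> 'a \<Rightarrow> 'a) \<Rightarrow> 'a set \<Rightarrow> bool" where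
  "global_attractor E d X S A \<longleftrightarrow>
     A \<subseteq> X
     \<and> compactin (Metric_space.mtopology E d) A
     \<and> (\<forall>t\<ge>0. S t ` A = A)
     \<and> (\<forall>K. K \<subseteq> X \<and> compactin (Metric_space.mtopology E d) K \<and> (\<forall>t\<ge>0. S t ` K = K) \<longrightarrow> K \<subseteq> A)
     \<and> attracts_bounded E d X S A
     \<and> (\<forall>K. K \<subseteq> X \<and> closedin (Metric_space.mtopology E d) K \<and> attracts_bounded E d X S K \<longrightarrow> A \<subseteq> K)"

text \<open>The two notions below are only meaningful for totally bounded \<open>K\<close>.\<close>

definition covering_number :: "'a set \<Rightarrow> ('a \<Rightarrow> 'a \<Rightarrow> real) \<Rightarrow> 'a set \<Rightarrow> real \<Rightarrow> nat" where
  "covering_number E d K \<epsilon> =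
     (LEAST N. \<exists>C\<subseteq>E. finite C \<and> card C = N \<and> K \<subseteq> (\<Union>c\<in>C. Metric_space.mball E d c \<epsilon>))"

definition fractal_dim :: "'a set \<Rightarrow> ('a \<Rightarrow> 'a \<Rightarrow> real) \<Rightarrow> 'a set \<Rightarrow> ereal" where
  "fractal_dim E d K =
     Limsup (at_right 0) (\<lambda>\<epsilon>. ereal (ln (real (covering_number E d K \<epsilon>)) / ln (1 / \<epsilon>)))"

definition exponentially_attracts ::
  "('a \<Rightarrow> 'a \<Rightarrow> real) \<Rightarrow> 'a set \<Rightarrow> (real \<Rightarrow> 'a \<Rightarrow> 'a) \<Rightarrow> 'a set \<Rightarrow> real \<Rightarrow> real \<Rightarrow> bool" where
  "exponentially_attracts d X S M c0 c1 \<longleftrightarrow>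
     (\<forall>t\<ge>0. semidist d (S t ` X) M \<le> ennreal (c0 * exp (- c1 * t)))"

definition exponential_attractor ::
  "'a set \<Rightarrow> ('a \<Rightarrow> 'a \<Rightarrow> real) \<Rightarrow> 'a set \<Rightarrow> (real \<Rightarrow> 'a \<Rightarrow> 'a) \<Rightarrow> 'a set \<Rightarrow> bool" where
  "exponential_attractor E d X S M \<longleftrightarrow>
     compactin (Metric_space.mtopology E d) M
     \<and> (\<exists>A. global_attractor E d X S A \<and> A \<subseteq> M) \<and> M \<subseteq> X
     \<and> (\<forall>t\<ge>0. S t ` M \<subseteq> M)
     \<and> fractal_dim E d M < \<infinity>
     \<and> (\<exists>c0>0. \<exists>c1>0. exponentially_attracts d X S M c0 c1)"

end

theory Submission
  imports Defs
begin

text \<open>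
  The difference of two solutions in \<open>B\<^sub>\<beta>\<close> solves a linear heat equation whose right-hand side is
  bounded in \<open>H\<^sup>\<beta>\<^sup>-\<^sup>1\<close> by a multiple of the \<open>H\<^sup>\<beta>\<close> norm of the difference: since \<open>\<beta> - 1 > 3/2\<close>,
  products are controlled by a Cauchy-Schwarz argument on Fourier coefficients, and since the
  Helmholtz multiplier is at most \<open>1\<close> the constants do not depend on \<open>\<alpha>\<close>. The energy inequality on
  finite sets of modes then gives Lipschitz dependence on the data, a squeezing property (after unit
  time the modes of the difference with \<open>(freq n)\<^sup>2 \<ge> \<Lambda>\<close> contribute \<open>O(1 / \<Lambda>)\<close> to the squared norm, the
  finitely many others take finitely many values up to a small error), and Hoelder continuity in
  time after unit time.

  For any semigroup with these three properties there are nets \<open>F\<^sub>k\<close> of at most \<open>N\<^sup>k\<close> points of \<open>S(k)X\<close>,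
  dense in \<open>S(k)X\<close> up to \<open>R / 2\<^sup>k\<close>. The global attractor is \<open>\<A> = \<Inter>\<^sub>k S(k)X\<close>, and \<open>\<A>\<close> together with all
  forward orbits of the net points from time \<open>1\<close> on is an exponential attractor; its dimension and
  its rate depend only on the constants in the three properties.
\<close>

section \<open>Exponential attractors from squeezing\<close>

text \<open>Two obstacles shape the argument. The equation is available only mode by mode, and the
  energy of finitely many modes is driven by the full H^\<beta> distance, so a differential
  inequality never closes on a finite set. Hence each bound is proved for all finite sets with a
  right-hand side in the full norm, and the supremum over the sets is taken at the end. The
  derivative lost in the nonlinearity is paid for by viscosity: Young's inequality spends half of
  the dissipation and divides the weight of the source by \<open>(freq n)^2\<close>.

  Squeezing is discrete in time, whereas the exponential attractor has to be invariant for all real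
  times. Adding whole orbits makes invariance immediate, but they must then be covered along time
  too. The modulus of continuity for this is proved only from time 1 on, when smoothing controls the
  high modes; this is why the orbits start there, at the price of one more Lipschitz factor in the
  rate estimate. With nets of N^k points and time grids growing like 16^k, covering numbers at scale
  R / 2^k remain exponential in k, which is what finite box dimension asks for.\<close>

text \<open>\<open>squeeze\<close> speaks of pieces of small diameter rather than of balls, so that
  representatives can later be picked anywhere inside them. The pair 16^k, 2^k in
  \<open>time_modulus\<close> encodes Hoelder exponent 1/4.\<close>

locale squeezing_semigroup = Metric_space E d
  for E :: "'a set" and d :: "'a \<Rightarrow> 'a \<Rightarrow> real" +
  fixes X :: "'a set" and S :: "real \<Rightarrow> 'a \<Rightarrow> 'a" and L R :: real and N q :: nat
  assumes compact_X: "compactin mtopology X"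
    and nonempty_X: "X \<noteq> {}"
    and S_in: "\<And>t x. 0 \<le> t \<Longrightarrow> x \<in> X \<Longrightarrow> S t x \<in> X"
    and S_0: "\<And>x. x \<in> X \<Longrightarrow> S 0 x = x"
    and S_add: "\<And>s t x. 0 \<le> s \<Longrightarrow> 0 \<le> t \<Longrightarrow> x \<in> X \<Longrightarrow> S (s + t) x = S s (S t x)"
    and S_continuous: "\<And>x. x \<in> X \<Longrightarrow> continuous_map (top_of_set {0..}) mtopology (\<lambda>t. S t x)"
    and L_pos: "0 < L"
    and S_lipschitz: "\<And>t x y. 0 \<le> t \<Longrightarrow> t \<le> 1 \<Longrightarrow> x \<in> X \<Longrightarrow> y \<in> X \<Longrightarrow> d (S t x) (S t y) \<le> L * d x y"
    and R_pos: "0 < R"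
    and dist_le_R: "\<And>x y. x \<in> X \<Longrightarrow> y \<in> X \<Longrightarrow> d x y \<le> R"
    and squeeze: "\<And>x r. x \<in> X \<Longrightarrow> 0 < r \<Longrightarrow>
      \<exists>\<P>. finite \<P> \<and> card \<P> \<le> N \<and> S 1 ` {y \<in> X. d x y \<le> r} \<subseteq> \<Union>\<P>
          \<and> (\<forall>P\<in>\<P>. \<forall>y\<in>P. \<forall>z\<in>P. d y z \<le> r / 2)"
    and q_pos: "0 < q"
    and time_modulus: "\<And>x s t k. x \<in> X \<Longrightarrow> 1 \<le> s \<Longrightarrow> 1 \<le> t \<Longrightarrow>
      \<bar>s - t\<bar> \<le> 1 / (real q * 16 ^ k) \<Longrightarrow> d (S s x) (S t x) \<le> R / 2 ^ k"
begin

lemma X_subset: "X \<subseteq> E"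
  using compactin_subset_topspace[OF compact_X] by simp

lemma N_pos: "0 < N"
proof -
  obtain x where x: "x \<in> X" using nonempty_X by blast
  obtain \<P> where "finite \<P>" "card \<P> \<le> N" "S 1 ` {y \<in> X. d x y \<le> 1} \<subseteq> \<Union>\<P>"
    using squeeze[OF x, of 1] by auto
  moreover have "x \<in> {y \<in> X. d x y \<le> 1}" using x X_subset by auto
  ultimately have "\<P> \<noteq> {}" by blast
  then show ?thesis using \<open>finite \<P>\<close> \<open>card \<P> \<le> N\<close> by (meson card_gt_0_iff less_le_trans)
qed

text \<open>Serves the continuity of a single \<open>S t\<close>, so the constant may grow with t;
  each induction step splits off one unit of time.\<close>

lemma lipschitz_all_times:
  assumes "0 \<le> t"
  shows "\<exists>C>0. \<forall>x\<in>X. \<forall>y\<in>X. d (S t x) (S t y) \<le> C * d x y"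
proof -
  have "\<forall>t. 0 \<le> t \<and> t \<le> real n \<longrightarrow> (\<exists>C>0. \<forall>x\<in>X. \<forall>y\<in>X. d (S t x) (S t y) \<le> C * d x y)" for n
  proof (induction n)
    case 0
    then show ?case using S_0 by (intro allI impI exI[of _ 1]) auto
  next
    case (Suc n)
    show ?case
    proof (intro allI impI)
      fix t assume t: "0 \<le> t \<and> t \<le> real (Suc n)"
      show "\<exists>C>0. \<forall>x\<in>X. \<forall>y\<in>X. d (S t x) (S t y) \<le> C * d x y"
      proof (cases "t \<le> 1")
        case True
        then show ?thesis using t S_lipschitz L_pos by blast
      next
        case False
        then obtain C where C: "C > 0" "\<forall>x\<in>X. \<forall>y\<in>X. d (S (t - 1) x) (S (t - 1) y) \<le> C * d x y"
          using Suc.IH[rule_format, of "t - 1"] t by auto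
        have "d (S t x) (S t y) \<le> L * C * d x y" if "x \<in> X" "y \<in> X" for x y
        proof -
          have "d (S t x) (S t y) = d (S 1 (S (t - 1) x)) (S 1 (S (t - 1) y))"
            using S_add[of 1 "t - 1"] False that by simp
          also have "\<dots> \<le> L * d (S (t - 1) x) (S (t - 1) y)"
            using S_lipschitz[of 1] S_in that False by simp
          also have "\<dots> \<le> L * (C * d x y)" using C(2) that L_pos by (intro mult_left_mono) auto
          finally show ?thesis by simp
        qed
        then show ?thesis using C(1) L_pos by (intro exI[of _ "L * C"]) auto
      qed
    qed
  qed
  from this[of "nat \<lceil>t\<rceil>"] show ?thesis using assms by auto
qed

lemma continuous_S:
  assumes "0 \<le> t"
  shows "continuous_map (subtopology mtopology X) mtopology (S t)"
proof -
  interpret Submetric E d X by unfold_locales (rule X_subset)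
  obtain C where C: "C > 0" "\<forall>x\<in>X. \<forall>y\<in>X. d (S t x) (S t y) \<le> C * d x y"
    using lipschitz_all_times[OF assms] by blast
  have "\<exists>\<delta>>0. \<forall>y. y \<in> X \<and> d x y < \<delta> \<longrightarrow> d (S t x) (S t y) < \<epsilon>" if "x \<in> X" "\<epsilon> > 0" for x \<epsilon>
  proof (intro exI[of _ "\<epsilon> / C"] conjI allI impI)
    fix y assume y: "y \<in> X \<and> d x y < \<epsilon> / C"
    then have "d (S t x) (S t y) \<le> C * d x y" using C that by blast
    also have "\<dots> < \<epsilon>" using y C(1) by (simp add: field_simps)
    finally show "d (S t x) (S t y) < \<epsilon>" .
  qed (use that C in auto)
  then have "continuous_map sub.mtopology mtopology (S t)"
    unfolding sub.metric_continuous_map[OF Metric_space_axioms]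
    using S_in[OF assms] X_subset by blast
  then show ?thesis by (simp add: mtopology_submetric)
qed

lemma compact_image:
  assumes "0 \<le> t"
  shows "compactin mtopology (S t ` X)"
  by (rule image_compactin[OF _ continuous_S[OF assms]]) (simp add: compactin_subtopology compact_X)

lemma image_antimono:
  assumes "0 \<le> s" "s \<le> t"
  shows "S t ` X \<subseteq> S s ` X"
proof -
  have "S t x = S s (S (t - s) x)" if "x \<in> X" for x
    using S_add[of s "t - s" x] assms that by simp
  then show ?thesis using S_in assms by auto
qed

section \<open>The global attractor as a nested intersection\<close>

text \<open>Integer times suffice because the images of X decrease in real time.\<close>

definition attractor :: "'a set" where
  "attractor = (\<Inter>k. S (real k) ` X)"

lemma attractor_subset: "attractor \<subseteq> S (real k) ` X"
  by (auto simp: attractor_def)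

lemma attractor_subset_X: "attractor \<subseteq> X"
  using attractor_subset[of 0] S_0 by auto

lemma compact_attractor: "compactin mtopology attractor"
proof (rule closed_compactin[OF compact_X attractor_subset_X])
  show "closedin mtopology attractor"
    unfolding attractor_def
    by (intro closedin_INT compactin_imp_closedin Hausdorff_space_mtopology compact_image) auto
qed

text \<open>Cantor's intersection theorem; it supplies both the preimages inside the attractor and
  the attraction property.\<close>

lemma nested_Inter_nonempty:
  assumes "\<And>k. closedin mtopology (C k)" "\<And>k. C k \<noteq> {}" "decseq C" "\<And>k. C k \<subseteq> X"
  shows "(\<Inter>k::nat. C k) \<noteq> {}"
proof (rule compact_space_imp_nest)
  show "compact_space (subtopology mtopology X)" by (rule compact_space_subtopology[OF compact_X])
  show "closedin (subtopology mtopology X) (C k)" for k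
    using assms(1,4) by (simp add: closedin_subset_topspace)
qed (use assms in auto)

text \<open>Forward invariance holds because \<open>S t\<close> commutes with every
  \<open>S (real k)\<close>. For the converse, the preimages of a point that lie in S(k)X form a
  nested family of nonempty compact sets, and a common point belongs to the attractor.\<close>

lemma attractor_invariant:
  assumes t: "0 \<le> t"
  shows "S t ` attractor = attractor"
proof
  show "S t ` attractor \<subseteq> attractor"
  proof
    fix y assume "y \<in> S t ` attractor"
    then obtain x where x: "x \<in> attractor" "y = S t x" by blast
    have "y \<in> S (real k) ` X" for k
    proof -
      obtain z where z: "z \<in> X" "x = S (real k) z" using x(1) by (auto simp: attractor_def)
      have "y = S (real k) (S t z)"
        using S_add[of t "real k" z] S_add[of "real k" t z] z x t by (simp add: add.commute)
      then show ?thesis using S_in t z by blast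
    qed
    then show "y \<in> attractor" by (simp add: attractor_def)
  qed
  show "attractor \<subseteq> S t ` attractor"
  proof
    fix x assume x: "x \<in> attractor"
    define C where "C k = {y \<in> S (real k) ` X. S t y = x}" for k
    have xE: "x \<in> E" using x attractor_subset_X X_subset by auto
    have sub: "S (real k) ` X \<subseteq> X" for k using S_in by auto
    have "(\<Inter>k. C k) \<noteq> {}"
    proof (rule nested_Inter_nonempty)
      fix k
      show "C k \<subseteq> X" using sub by (auto simp: C_def)
      have "closedin (subtopology mtopology X) {y \<in> topspace (subtopology mtopology X). S t y \<in> {x}}"
        using xE by (intro closedin_continuous_map_preimage[OF continuous_S[OF t]]) (simp add: closedin_Hausdorff_singleton Hausdorff_space_mtopology)
      then have "closedin mtopology {y \<in> topspace (subtopology mtopology X). S t y \<in> {x}}"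
        using closedin_closed_subtopology compactin_imp_closedin[OF Hausdorff_space_mtopology compact_X]
        by blast
      moreover have "C k = S (real k) ` X \<inter> {y \<in> topspace (subtopology mtopology X). S t y \<in> {x}}"
        using sub[of k] X_subset by (auto simp: C_def)
      ultimately show "closedin mtopology (C k)"
        using compact_image[of "real k"] compactin_imp_closedin[OF Hausdorff_space_mtopology] by auto
      show "C k \<noteq> {}"
      proof -
        \<comment> \<open>Going back to level k plus at least t leaves room to split off the last t
          units of time and still be in S(k)X.\<close>
        obtain z where z: "z \<in> X" "x = S (real (k + nat \<lceil>t\<rceil>)) z"
          using x attractor_subset by blast
        define s where "s = real (k + nat \<lceil>t\<rceil>) - t"
        have s: "real k \<le> s" unfolding s_def using t by simp
        have "0 \<le> s" using s of_nat_0_le_iff by (rule order.trans[rotated])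
        then have "S t (S s z) = x" using S_add[of t s z] z t by (simp add: s_def)
        moreover have "S s z \<in> S (real k) ` X" using image_antimono[of "real k" s] s z by auto
        ultimately show ?thesis by (auto simp: C_def)
      qed
    next
      show "decseq C"
        unfolding decseq_def
      proof (intro allI impI)
        fix m n :: nat assume "m \<le> n"
        then show "C n \<subseteq> C m"
          using image_antimono[of "real m" "real n"] by (auto simp: C_def)
      qed
    qed
    then obtain y where "\<And>k. y \<in> C k" by auto
    then have "y \<in> attractor" "S t y = x" by (auto simp: C_def attractor_def)
    then show "x \<in> S t ` attractor" by blast
  qed
qed

text \<open>Otherwise the parts of the images outside the \<epsilon>-neighbourhood \<open>U\<close>
  would be nested, closed and nonempty; a common point would lie in the attractor but outside its
  neighbourhood.\<close>

lemma attractor_attracts: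
  assumes "0 < \<epsilon>"
  shows "\<exists>k. \<forall>x\<in>S (real k) ` X. \<exists>y\<in>attractor. d x y < \<epsilon>"
proof (rule ccontr)
  assume contra: "\<not> ?thesis"
  define U where "U = (\<Union>y\<in>attractor. mball y \<epsilon>)"
  have AE: "attractor \<subseteq> E" using attractor_subset_X X_subset by auto
  have "(\<Inter>k. S (real k) ` X - U) \<noteq> {}"
  proof (rule nested_Inter_nonempty)
    fix k
    show "closedin mtopology (S (real k) ` X - U)"
      unfolding U_def
      by (intro closedin_diff compactin_imp_closedin compact_image Hausdorff_space_mtopology) auto
    obtain x where x: "x \<in> S (real k) ` X" "\<forall>y\<in>attractor. \<not> d x y < \<epsilon>" using contra by meson
    then have "x \<notin> U" by (auto simp: U_def commute)
    then show "S (real k) ` X - U \<noteq> {}" using x by blast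
    show "S (real k) ` X - U \<subseteq> X" using S_in by auto
  next
    show "decseq (\<lambda>k. S (real k) ` X - U)"
      unfolding decseq_def
    proof (intro allI impI)
      fix m n :: nat assume "m \<le> n"
      then show "S (real n) ` X - U \<subseteq> S (real m) ` X - U"
        using image_antimono[of "real m" "real n"] by auto
    qed
  qed
  then obtain x where "\<And>k. x \<in> S (real k) ` X - U" by auto
  then have "x \<in> attractor" "x \<notin> U" by (auto simp: attractor_def)
  moreover have "attractor \<subseteq> U" using AE assms by (force simp: U_def)
  ultimately show False by blast
qed

lemma semidist_leI:
  assumes "\<And>x. x \<in> B \<Longrightarrow> \<exists>y\<in>Y. d x y \<le> \<epsilon>"
  shows "semidist d B Y \<le> ennreal \<epsilon>"
  unfolding semidist_def
proof (rule SUP_least)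
  fix x assume "x \<in> B"
  then obtain y where "y \<in> Y" "d x y \<le> \<epsilon>" using assms by blast
  then show "(INF y\<in>Y. ennreal (d x y)) \<le> ennreal \<epsilon>"
    by (intro INF_lower2[of y]) (auto intro: ennreal_leI)
qed

lemma bounded_in_X: "B \<subseteq> X \<Longrightarrow> mbounded B"
  unfolding mbounded_alt using X_subset dist_le_R by (intro conjI exI[of _ R] ballI) blast+

lemma attracts_bounded_attractor: "attracts_bounded E d X S attractor"
  unfolding attracts_bounded_def
proof (intro allI impI)
  fix B assume B: "B \<subseteq> X \<and> mbounded B"
  show "((\<lambda>t. semidist d (S t ` B) attractor) \<longlongrightarrow> 0) at_top"
  proof (rule order_tendstoI)
    fix u :: ennreal assume "0 < u"
    then obtain \<epsilon> where \<epsilon>: "0 < \<epsilon>" "ennreal \<epsilon> < u"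
    proof (cases u)
      case (real r)
      then show ?thesis using \<open>0 < u\<close> that[of "r / 2"] by (auto simp: ennreal_less_iff)
    next
      case top
      then show ?thesis using that[of 1] by simp
    qed
    obtain k where k: "\<forall>x\<in>S (real k) ` X. \<exists>y\<in>attractor. d x y < \<epsilon>"
      using attractor_attracts[OF \<epsilon>(1)] by blast
    show "\<forall>\<^sub>F t in at_top. semidist d (S t ` B) attractor < u"
      using eventually_ge_at_top[of "real k"]
    proof eventually_elim
      case (elim t)
      have "semidist d (S t ` B) attractor \<le> ennreal \<epsilon>"
      proof (rule semidist_leI)
        fix x assume "x \<in> S t ` B"
        then have "x \<in> S (real k) ` X" using B image_antimono[of "real k" t] elim by auto
        then show "\<exists>y\<in>attractor. d x y \<le> \<epsilon>" using k by (meson less_imp_le)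
      qed
      then show ?case using \<epsilon>(2) by (rule le_less_trans)
    qed
  qed simp
qed

text \<open>A ball around a point off \<open>K\<close> keeps its infimum positive. For empty
  \<open>K\<close> the infimum is \<infinity>, so this case is covered as well.\<close>

lemma in_closed_if_semidist_0:
  assumes K: "closedin mtopology K" and "B \<subseteq> E" and zero: "semidist d B K = 0"
  shows "B \<subseteq> K"
proof
  fix x assume x: "x \<in> B"
  show "x \<in> K"
  proof (rule ccontr)
    assume "x \<notin> K"
    then have "openin mtopology (E - K)" "x \<in> E - K" using K x assms(2) by auto
    then obtain r where r: "r > 0" "mball x r \<subseteq> E - K" unfolding openin_mtopology by blast
    have "ennreal r \<le> (INF y\<in>K. ennreal (d x y))"
    proof (rule INF_greatest)
      fix y assume "y \<in> K"
      then have "y \<notin> mball x r" "y \<in> E" using r closedin_subset[OF K] by auto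
      then have "r \<le> d x y" using x assms(2) by auto
      then show "ennreal r \<le> ennreal (d x y)" by (rule ennreal_leI)
    qed
    also have "\<dots> \<le> semidist d B K" unfolding semidist_def by (rule SUP_upper[OF x])
    finally show False using zero r(1) by (simp add: ennreal_eq_0_iff)
  qed
qed

lemma global_attractor: "global_attractor E d X S attractor"
  unfolding global_attractor_def
proof (intro conjI allI impI)
  fix K assume K: "K \<subseteq> X \<and> compactin mtopology K \<and> (\<forall>t\<ge>0. S t ` K = K)"
  then have "K \<subseteq> S (real k) ` X" for k by (metis image_mono of_nat_0_le_iff)
  then show "K \<subseteq> attractor" by (auto simp: attractor_def)
next
  fix K assume K: "K \<subseteq> X \<and> closedin mtopology K \<and> attracts_bounded E d X S K"
  \<comment> \<open>Minimality: \<open>S t\<close> maps the attractor onto itself, so the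
    semidistance to \<open>K\<close> is constant in t and equals its limit 0.\<close>
  have "((\<lambda>t. semidist d (S t ` attractor) K) \<longlongrightarrow> 0) at_top"
    using K attractor_subset_X bounded_in_X unfolding attracts_bounded_def by blast
  moreover have "\<forall>\<^sub>F t in at_top. semidist d (S t ` attractor) K = semidist d attractor K"
    using eventually_ge_at_top[of 0] by eventually_elim (simp add: attractor_invariant)
  ultimately have "((\<lambda>t::real. semidist d attractor K) \<longlongrightarrow> 0) at_top"
    by (simp add: tendsto_cong)
  then have "semidist d attractor K = 0" by (simp add: tendsto_const_iff)
  then show "attractor \<subseteq> K"
    using in_closed_if_semidist_0 K attractor_subset_X X_subset by (meson subset_trans)
qed (use attractor_subset_X compact_attractor attractor_invariant attracts_bounded_attractor in auto)

section \<open>Nets of the iterated images and the exponential attractor\<close>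

text \<open>Squeezing splits the image of the ball around each net point into at most N pieces of
  half the old mesh in diameter: the cardinality is multiplied by N while the mesh is
  halved.\<close>

lemma ex_net:
  "\<exists>F. finite F \<and> card F \<le> N ^ k \<and> F \<subseteq> S (real k) ` X
     \<and> (\<forall>x\<in>S (real k) ` X. \<exists>e\<in>F. d e x \<le> R / 2 ^ k)"
proof (induction k)
  case 0
  obtain x where "x \<in> X" using nonempty_X by blast
  then show ?case using S_0 dist_le_R by (intro exI[of _ "{x}"]) (auto simp: image_iff)
next
  case (Suc k)
  let ?Y = "S (real (Suc k)) ` X"
  obtain F where F: "finite F" "card F \<le> N ^ k" "F \<subseteq> S (real k) ` X"
    "\<forall>x\<in>S (real k) ` X. \<exists>e\<in>F. d e x \<le> R / 2 ^ k" using Suc.IH by blast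
  have FX: "F \<subseteq> X" using F(3) S_in by auto
  have "\<forall>e\<in>F. \<exists>\<P>. finite \<P> \<and> card \<P> \<le> N \<and> S 1 ` {y \<in> X. d e y \<le> R / 2 ^ k} \<subseteq> \<Union>\<P>
          \<and> (\<forall>P\<in>\<P>. \<forall>y\<in>P. \<forall>z\<in>P. d y z \<le> (R / 2 ^ k) / 2)"
    using FX R_pos by (intro ballI squeeze) auto
  from bchoice[OF this] obtain \<P> where \<P>: "\<forall>e\<in>F. finite (\<P> e) \<and> card (\<P> e) \<le> N
        \<and> S 1 ` {y \<in> X. d e y \<le> R / 2 ^ k} \<subseteq> \<Union>(\<P> e)
        \<and> (\<forall>P\<in>\<P> e. \<forall>y\<in>P. \<forall>z\<in>P. d y z \<le> (R / 2 ^ k) / 2)"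
    by blast
  \<comment> \<open>Pieces missing the image are dropped and representatives are taken in the image
    itself. As pieces are measured by diameter, moving the centre there costs no factor 2.\<close>
  define \<Q> where "\<Q> = {P \<in> (\<Union>e\<in>F. \<P> e). P \<inter> ?Y \<noteq> {}}"
  define g where "g P = (SOME y. y \<in> P \<inter> ?Y)" for P
  have g: "g P \<in> P \<inter> ?Y" if "P \<in> \<Q>" for P
    unfolding g_def some_in_eq using that by (simp add: \<Q>_def)
  have fin: "finite (\<Union>e\<in>F. \<P> e)" using F(1) \<P> by blast
  have QF: "\<Q> \<subseteq> (\<Union>e\<in>F. \<P> e)" by (auto simp: \<Q>_def)
  have "card (g ` \<Q>) \<le> card (\<Union>e\<in>F. \<P> e)"
    using fin QF by (intro order.trans[OF card_image_le card_mono]) (auto intro: finite_subset)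
  also have "\<dots> \<le> (\<Sum>e\<in>F. card (\<P> e))" by (rule card_UN_le[OF F(1)])
  also have "\<dots> \<le> card F * N" using \<P> by (intro order.trans[OF sum_bounded_above[of F _ N]]) auto
  also have "\<dots> \<le> N ^ Suc k" using F(2) by simp
  finally have card: "card (g ` \<Q>) \<le> N ^ Suc k" .
  have "\<exists>e\<in>g ` \<Q>. d e y \<le> R / 2 ^ Suc k" if y: "y \<in> ?Y" for y
  proof -
    obtain x where x: "x \<in> X" "y = S (real (Suc k)) x" using y by blast
    then have "y = S 1 (S (real k) x)" using S_add[of 1 "real k" x] by (simp add: add.commute)
    moreover obtain e where "e \<in> F" "d e (S (real k) x) \<le> R / 2 ^ k" using F(4) x by blast
    moreover have "S (real k) x \<in> X" using S_in x by simp
    ultimately have "y \<in> S 1 ` {y \<in> X. d e y \<le> R / 2 ^ k}" "e \<in> F" by blast+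
    then have "y \<in> \<Union>(\<P> e)" "e \<in> F" using \<P> by blast+
    then obtain P where P: "P \<in> \<P> e" "y \<in> P" by blast
    then have "P \<in> \<Q>" using y \<open>e \<in> F\<close> by (auto simp: \<Q>_def)
    moreover have "d (g P) y \<le> (R / 2 ^ k) / 2" using \<P> \<open>e \<in> F\<close> P g[OF \<open>P \<in> \<Q>\<close>] by blast
    ultimately show ?thesis by (intro bexI[of _ "g P"]) auto
  qed
  moreover have "g ` \<Q> \<subseteq> ?Y" using g by auto
  moreover have "finite (g ` \<Q>)" using finite_subset[OF QF fin] by (rule finite_imageI)
  ultimately show ?case using card by (intro exI[of _ "g ` \<Q>"]) blast
qed

definition net :: "nat \<Rightarrow> 'a set" where
  "net k = (SOME F. finite F \<and> card F \<le> N ^ k \<and> F \<subseteq> S (real k) ` X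
     \<and> (\<forall>x\<in>S (real k) ` X. \<exists>e\<in>F. d e x \<le> R / 2 ^ k))"

lemma
  shows finite_net: "finite (net k)"
    and card_net: "card (net k) \<le> N ^ k"
    and net_subset: "net k \<subseteq> S (real k) ` X"
    and net_covers: "x \<in> S (real k) ` X \<Longrightarrow> \<exists>e\<in>net k. d e x \<le> R / 2 ^ k"
  using someI_ex[OF ex_net[of k]] unfolding net_def[symmetric] by blast+

lemma net_subset_X: "net k \<subseteq> X"
  using net_subset[of k] S_in by auto

definition exp_attractor :: "'a set" where
  "exp_attractor = attractor \<union> (\<Union>j. \<Union>e\<in>net j. (\<lambda>t. S t e) ` {1..})"

text \<open>Finitely many compact pieces of orbits; everything else in the exponential attractor
  lies in S(k)X. The time intervals have length exactly k, which the grid used for covering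
  matches.\<close>

definition arcs :: "nat \<Rightarrow> 'a set" where
  "arcs k = (\<Union>j<k. \<Union>e\<in>net j. (\<lambda>t. S t e) ` {1..real k + 1})"

lemma attractor_subset_exp_attractor: "attractor \<subseteq> exp_attractor"
  by (auto simp: exp_attractor_def)

lemma arcs_subset: "arcs k \<subseteq> exp_attractor"
  by (fastforce simp: exp_attractor_def arcs_def)

lemma exp_attractor_subset_X: "exp_attractor \<subseteq> X"
  using attractor_subset_X net_subset_X S_in by (fastforce simp: exp_attractor_def)

text \<open>A point \<open>S t e\<close> with \<open>e\<close> in \<open>net j\<close> has a history
  of length at least j + t, so it lies in S(k)X as soon as j or t reaches k.\<close>

lemma exp_attractor_subset: "exp_attractor \<subseteq> arcs k \<union> S (real k) ` X"
proof
  fix x assume "x \<in> exp_attractor"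
  then consider "x \<in> attractor" | j t e where "e \<in> net j" "t \<ge> 1" "x = S t e"
    by (auto simp: exp_attractor_def)
  then show "x \<in> arcs k \<union> S (real k) ` X"
  proof cases
    case 1
    then show ?thesis using attractor_subset by blast
  next
    case 2
    have eX: "e \<in> X" using 2 net_subset_X by blast
    consider "j < k" "t \<le> real k + 1" | "j \<ge> k" | "t \<ge> real k" by linarith
    then show ?thesis
    proof cases
      case 1
      then have "x \<in> arcs k" using 2 by (force simp: arcs_def)
      then show ?thesis ..
    next
      case jk: 2
      obtain z where z: "z \<in> X" "e = S (real j) z" using 2 net_subset by blast
      then have "x = S (t + real j) z" using 2 S_add[of t "real j" z] by simp
      then show ?thesis using image_antimono[of "real k" "t + real j"] jk 2 z by auto
    next
      case 3
      then show ?thesis using image_antimono[of "real k" t] 2 eX by auto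
    qed
  qed
qed

lemma compact_arcs: "compactin mtopology (arcs k)"
proof -
  have "compactin mtopology ((\<lambda>t. S t e) ` {1..real k + 1})" if "e \<in> net j" for e j
  proof (rule image_compactin[OF _ S_continuous])
    show "compactin (top_of_set {0..}) {1..real k + 1}"
      by (auto simp: compactin_subtopology)
  qed (use that net_subset_X in auto)
  then show ?thesis
    unfolding arcs_def using finite_net by (intro compactin_Union) (auto intro!: compactin_Union)
qed

text \<open>An infinite union of arcs has no evident reason to be closed; as an intersection of
  compact sets it is. A point on no arc lies in all S(k)X, hence in the attractor.\<close>

lemma exp_attractor_eq: "exp_attractor = (\<Inter>k. arcs k \<union> S (real k) ` X)"
proof
  show "exp_attractor \<subseteq> (\<Inter>k. arcs k \<union> S (real k) ` X)" using exp_attractor_subset by blast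
  show "(\<Inter>k. arcs k \<union> S (real k) ` X) \<subseteq> exp_attractor"
  proof
    fix x assume x: "x \<in> (\<Inter>k. arcs k \<union> S (real k) ` X)"
    show "x \<in> exp_attractor"
    proof (cases "\<exists>k. x \<in> arcs k")
      case True
      then show ?thesis using arcs_subset by (meson subsetD)
    next
      case False
      then have "x \<in> attractor" using x unfolding attractor_def by (simp del: image_iff)
      then show ?thesis using attractor_subset_exp_attractor by (rule subsetD[rotated])
    qed
  qed
qed

lemma compact_exp_attractor: "compactin mtopology exp_attractor"
proof (rule closed_compactin[OF compact_X exp_attractor_subset_X])
  show "closedin mtopology exp_attractor"
    unfolding exp_attractor_eq
    by (intro closedin_INT closedin_Un compactin_imp_closedin Hausdorff_space_mtopology
        compact_image compact_arcs) auto
qed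

lemma exp_attractor_positively_invariant:
  assumes "0 \<le> t"
  shows "S t ` exp_attractor \<subseteq> exp_attractor"
proof
  fix y assume "y \<in> S t ` exp_attractor"
  then obtain x where x: "x \<in> exp_attractor" "y = S t x" by blast
  from x(1) consider "x \<in> attractor" | j s e where "e \<in> net j" "s \<ge> 1" "x = S s e"
    by (auto simp: exp_attractor_def)
  then show "y \<in> exp_attractor"
  proof cases
    case 1
    then show ?thesis using attractor_invariant[OF assms] x(2) by (auto simp: exp_attractor_def)
  next
    case 2
    then have "y = S (t + s) e" using S_add[of t s e] assms x(2) net_subset_X by force
    then show ?thesis using 2 assms by (force simp: exp_attractor_def)
  qed
qed

lemma exp_attractor_nonempty: "exp_attractor \<noteq> {}"
proof -
  obtain x where "x \<in> X" using nonempty_X by blast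
  then obtain e where "e \<in> net 0" using net_covers[of _ 0] S_0 by fastforce
  then show ?thesis by (force simp: exp_attractor_def)
qed

section \<open>Rate of attraction and box dimension\<close>

text \<open>The constant is 2 R + 4 R L^2: the first summand serves t < 1, where the diameter bound
  R is at most 2 R / 2^t, and the second serves t \<ge> 1.\<close>

lemma exp_attraction:
  "exponentially_attracts d X S exp_attractor (2 * R * (1 + 2 * L ^ 2)) (ln 2)"
  unfolding exponentially_attracts_def
proof (intro allI impI semidist_leI)
  fix t :: real and y assume t: "0 \<le> t" and "y \<in> S t ` X"
  then obtain x where x: "x \<in> X" "y = S t x" by blast
  have rate: "exp (- ln 2 * t) = 1 / 2 powr t" by (simp add: powr_def exp_minus field_simps)
  have "\<exists>z\<in>exp_attractor. d y z \<le> 2 * R * (1 + 2 * L ^ 2) / 2 powr t"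
  proof (cases "t < 1")
    case True
    obtain z where z: "z \<in> exp_attractor" using exp_attractor_nonempty by blast
    have "d y z \<le> R" using dist_le_R z exp_attractor_subset_X x S_in t by auto
    also have "R * 2 powr t \<le> R * 2 powr 1" using True R_pos by (intro mult_left_mono powr_mono) auto
    then have "R \<le> 2 * R / 2 powr t" by (simp add: field_simps)
    also have "\<dots> \<le> 2 * R * (1 + 2 * L ^ 2) / 2 powr t"
      using R_pos by (intro divide_right_mono) auto
    finally show ?thesis using z by blast
  next
    case False
    \<comment> \<open>With t = 1 + r + k and 0 \<le> r < 1, a net point near the state at time k is
      moved on for time 1 + r, so that it reaches the part of its orbit that was added. This costs
      two Lipschitz factors.\<close>
    define k where "k = nat (\<lfloor>t\<rfloor> - 1)"
    define r where "r = t - 1 - real k"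
    have r: "0 \<le> r" "r < 1" unfolding r_def k_def using False by (simp_all, linarith+)
    have tk: "t = 1 + (r + real k)" by (simp add: r_def)
    have SkX: "S (real k) x \<in> X" using S_in x by simp
    obtain e where e: "e \<in> net k" "d e (S (real k) x) \<le> R / 2 ^ k" using net_covers x by blast
    have eX: "e \<in> X" using e net_subset_X by blast
    have "d (S (1 + r) e) y = d (S 1 (S r e)) (S 1 (S r (S (real k) x)))"
      using S_add[of 1 r e] S_add[of 1 "r + real k" x] S_add[of r "real k" x] x r eX tk by simp
    also have "\<dots> \<le> L * d (S r e) (S r (S (real k) x))" using S_lipschitz[of 1] S_in r eX SkX by simp
    also have "\<dots> \<le> L * (L * (R / 2 ^ k))"
      using order.trans[OF S_lipschitz[of r e "S (real k) x"] mult_left_mono[OF e(2), of L]] r eX SkX L_pos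
      by (intro mult_left_mono) auto
    \<comment> \<open>The factor 4 compensates t \<le> k + 2.\<close>
    also have "\<dots> = L ^ 2 * R * 4 / 2 powr (2 + real k)"
      by (simp add: powr_add powr_realpow power2_eq_square)
    also have "\<dots> \<le> L ^ 2 * R * 4 / 2 powr t"
      using r R_pos by (intro divide_left_mono powr_mono) (auto simp: tk)
    also have "\<dots> \<le> 2 * R * (1 + 2 * L ^ 2) / 2 powr t"
      using R_pos by (intro divide_right_mono) (auto simp: algebra_simps)
    finally have "d y (S (1 + r) e) \<le> 2 * R * (1 + 2 * L ^ 2) / 2 powr t" by (simp add: commute)
    moreover have "S (1 + r) e \<in> exp_attractor" using e r by (force simp: exp_attractor_def)
    ultimately show ?thesis by blast
  qed
  then show "\<exists>z\<in>exp_attractor. d y z \<le> 2 * R * (1 + 2 * L ^ 2) * exp (- ln 2 * t)"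
    unfolding rate by simp
qed

lemma covering_number_le:
  assumes "finite C" "C \<subseteq> E" "K \<subseteq> (\<Union>c\<in>C. mball c \<epsilon>)"
  shows "covering_number E d K \<epsilon> \<le> card C"
  unfolding covering_number_def using assms by (intro Least_le) blast

text \<open>The net of level k takes care of S(k)X, and every arc is sampled with spacing
  \<open>h\<close>, the time step on which \<open>time_modulus\<close> allows an error R / 2^k.
  Stating it for subsets serves the global attractor too.\<close>

lemma covering_number_exp_attractor:
  assumes K: "K \<subseteq> exp_attractor" and \<epsilon>: "2 * R / 2 ^ k < \<epsilon>"
  shows "covering_number E d K \<epsilon> \<le> (64 * N * (2 + q)) ^ Suc k"
proof -
  define h where "h = 1 / (real q * 16 ^ k)"
  define m where "m = k * q * 16 ^ k"
  have h: "h > 0" using q_pos by (simp add: h_def)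
  have mh: "real m * h = real k" using q_pos by (simp add: m_def h_def)
  define C where "C = net k \<union> (\<Union>j<k. \<Union>e\<in>net j. (\<lambda>i. S (1 + real i * h) e) ` {..m})"
  have RR: "R / 2 ^ k < \<epsilon>" using \<epsilon> R_pos
    by (smt (verit) divide_pos_pos divide_right_mono zero_less_power)
  have fin: "finite C" unfolding C_def using finite_net by auto
  have "S (1 + real i * h) e \<in> E" if "e \<in> net j" for i e j
    using S_in[of "1 + real i * h" e] h that net_subset_X[of j] X_subset by auto
  then have CE: "C \<subseteq> E" unfolding C_def using net_subset_X X_subset by blast
  have "x \<in> (\<Union>c\<in>C. mball c \<epsilon>)" if "x \<in> K" for x
  proof -
    have "x \<in> arcs k \<union> S (real k) ` X" using that K exp_attractor_subset by blast
    then have "\<exists>c\<in>C. d c x \<le> R / 2 ^ k"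
    proof
      assume "x \<in> S (real k) ` X"
      then show ?thesis using net_covers unfolding C_def by blast
    next
      assume "x \<in> arcs k"
      then obtain j t e where j: "j < k" "e \<in> net j" "1 \<le> t" "t \<le> real k + 1" "x = S t e"
        by (auto simp: arcs_def)
      define i where "i = nat \<lfloor>(t - 1) / h\<rfloor>"
      have "0 \<le> (t - 1) / h" using j(3) h by simp
      then have i: "real i \<le> (t - 1) / h" "(t - 1) / h < real i + 1"
        unfolding i_def by linarith+
      have "(t - 1) / h \<le> real m" using mh h j(4) by (simp add: pos_divide_le_eq)
      then have "i \<le> m" using i by linarith
      have "\<bar>1 + real i * h - t\<bar> \<le> h" using i h by (auto simp: field_simps abs_le_iff)
      then have "d (S (1 + real i * h) e) (S t e) \<le> R / 2 ^ k"
        using j h net_subset_X unfolding h_def[symmetric] by (intro time_modulus) (auto simp: h_def[symmetric])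
      then show ?thesis using j \<open>i \<le> m\<close> by (auto simp: C_def)
    qed
    then obtain c where "c \<in> C" "d c x < \<epsilon>" using RR by (meson le_less_trans)
    moreover have "x \<in> E" using K that exp_attractor_subset_X X_subset by blast
    ultimately show ?thesis using CE by (intro UN_I[of c]) auto
  qed
  then have "covering_number E d K \<epsilon> \<le> card C" using fin CE by (intro covering_number_le) auto
  also have "card C \<le> card (net k) + card (\<Union>j<k. \<Union>e\<in>net j. (\<lambda>i. S (1 + real i * h) e) ` {..m})"
    unfolding C_def by (rule card_Un_le)
  also have "\<dots> \<le> N ^ k + (\<Sum>j<k. N ^ k * (m + 1))"
  proof (intro add_mono card_net order.trans[OF card_UN_le sum_mono])
    fix j assume j: "j \<in> {..<k}"
    have "card (\<Union>e\<in>net j. (\<lambda>i. S (1 + real i * h) e) ` {..m})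
        \<le> (\<Sum>e\<in>net j. card ((\<lambda>i. S (1 + real i * h) e) ` {..m}))"
      by (rule card_UN_le[OF finite_net])
    also have "\<dots> \<le> (\<Sum>e\<in>net j. m + 1)"
      by (intro sum_mono order.trans[OF card_image_le]) auto
    also have "\<dots> = card (net j) * (m + 1)" by simp
    also have "\<dots> \<le> N ^ k * (m + 1)"
      using card_net[of j] power_increasing[of j k N] j N_pos by (intro mult_right_mono) auto
    finally show "card (\<Union>e\<in>net j. (\<lambda>i. S (1 + real i * h) e) ` {..m}) \<le> N ^ k * (m + 1)" .
  qed auto
  also have "\<dots> = N ^ k * (1 + k + k * k * q * 16 ^ k)" by (simp add: m_def algebra_simps)
  also have "\<dots> \<le> N ^ k * ((2 + q) * 64 ^ Suc k)"
  proof (intro mult_left_mono)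
    \<comment> \<open>The polynomial factor k^2 is absorbed in 4^k, whence the base 64 = 4 *
      16.\<close>
    have k2: "k < 2 ^ k" by simp
    have "k * k \<le> 2 ^ k * 2 ^ k" using k2 by (intro mult_mono) auto
    then have "k * k \<le> 4 ^ k" by (simp flip: power_mult_distrib)
    then have "k * k * 16 ^ k \<le> 4 ^ k * 16 ^ k" by (rule mult_right_mono) simp
    also have "\<dots> = 64 ^ k" by (simp flip: power_mult_distrib)
    finally have a: "k * k * q * 16 ^ k \<le> q * 64 ^ k"
      by (metis mult.assoc mult.commute mult_le_mono2)
    have b: "k < 64 ^ k" using k2 power_mono[of "2::nat" 64 k] by linarith
    have "1 + k + k * k * q * 16 ^ k \<le> (2 + q) * 64 ^ k"
      using a b unfolding add_mult_distrib by linarith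
    then show "1 + k + k * k * q * 16 ^ k \<le> (2 + q) * 64 ^ Suc k" by simp
  qed auto
  also have "\<dots> \<le> N ^ Suc k * ((2 + q) ^ Suc k * 64 ^ Suc k)"
    using power_increasing[of k "Suc k" N] self_le_power[of "2 + q" "Suc k"] N_pos
    by (intro mult_mono) simp_all
  also have "\<dots> = (64 * N * (2 + q)) ^ Suc k" by (simp only: power_mult_distrib mult_ac)
  finally show ?thesis .
qed

text \<open>At scale \<epsilon> the level k is of order log(1 / \<epsilon>), so the logarithm of the
  covering number is at most a multiple of ln(1 / \<epsilon>). R affects only how small \<epsilon>
  has to be.\<close>

lemma fractal_dim_le:
  assumes K: "K \<subseteq> exp_attractor"
  shows "fractal_dim E d K \<le> ereal (4 * ln (64 * real N * (2 + real q)) / ln 2)"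
proof -
  define Q where "Q = 64 * N * (2 + q)"
  have Q: "real Q = 64 * real N * (2 + real q)" by (simp add: Q_def algebra_simps)
  have "Q \<ge> 1" using N_pos by (simp add: Q_def)
  then have lnQ: "ln (real Q) \<ge> 0" by simp
  \<comment> \<open>Below this threshold 16 (R + 1) / \<epsilon> \<le> 1 / \<epsilon>^2, which
    trades R for a doubled exponent.\<close>
  define \<epsilon>0 where "\<epsilon>0 = min 1 (1 / (64 * (R + 1) ^ 2))"
  have "\<forall>\<^sub>F \<epsilon> in at_right 0. ereal (ln (real (covering_number E d K \<epsilon>)) / ln (1 / \<epsilon>))
      \<le> ereal (4 * ln (real Q) / ln 2)"
    unfolding eventually_at_right_field
  proof (intro exI[of _ \<epsilon>0] conjI allI impI)
    show "0 < \<epsilon>0" using R_pos by (simp add: \<epsilon>0_def)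
    fix \<epsilon> :: real assume e: "0 < \<epsilon>" "\<epsilon> < \<epsilon>0"
    define k where "k = nat \<lceil>log 2 (4 * (R + 1) / \<epsilon>)\<rceil>"
    have e1: "\<epsilon> < 1" "\<epsilon> < 1 / (64 * (R + 1) ^ 2)" using e by (auto simp: \<epsilon>0_def)
    have pos: "4 * (R + 1) / \<epsilon> > 0" using R_pos e by simp
    have "\<epsilon> < 4 * (R + 1)" using e1 R_pos by simp
    then have "log 2 (4 * (R + 1) / \<epsilon>) > 0" using e by simp
    then have k: "log 2 (4 * (R + 1) / \<epsilon>) \<le> real k" "real k < log 2 (4 * (R + 1) / \<epsilon>) + 1"
      unfolding k_def by (simp_all, linarith+)
    have "4 * (R + 1) / \<epsilon> \<le> 2 powr real k" using k(1) pos by (simp add: log_le_iff)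
    then have "4 * (R + 1) \<le> \<epsilon> * 2 ^ k" using e by (simp add: powr_realpow field_simps)
    then have "2 * R / 2 ^ k < \<epsilon>" using R_pos by (simp add: field_simps)
    then have cov: "covering_number E d K \<epsilon> \<le> Q ^ Suc k"
      unfolding Q_def by (rule covering_number_exp_attractor[OF K])
    have le: "64 * (R + 1) ^ 2 \<le> 1 / \<epsilon>" using e1 e R_pos by (simp add: field_simps)
    have "(16 * (R + 1) / \<epsilon>) ^ 2 = 4 * (64 * (R + 1) ^ 2) * (1 / \<epsilon>) * (1 / \<epsilon>)"
      by (simp add: power2_eq_square field_simps)
    also have "\<dots> \<le> 4 * (1 / \<epsilon>) * (1 / \<epsilon>) * (1 / \<epsilon>)"
      using le e by (intro mult_right_mono mult_left_mono) auto
    also have "\<dots> \<le> (1 / \<epsilon>) * (1 / \<epsilon>) * (1 / \<epsilon>) * (1 / \<epsilon>)"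
    proof (intro mult_right_mono)
      have "4 * 1 \<le> 64 * (R + 1) ^ 2" using R_pos by (intro mult_mono) (auto intro: one_le_power)
      then show "4 \<le> 1 / \<epsilon>" using le by simp
    qed (use e in auto)
    also have "\<dots> = ((1 / \<epsilon>) ^ 2) ^ 2" by (simp add: power2_eq_square)
    finally have sq: "16 * (R + 1) / \<epsilon> \<le> (1 / \<epsilon>) ^ 2" by (rule power2_le_imp_le) simp
    have "real (Suc k) < log 2 (4 * (R + 1) / \<epsilon>) + 2" using k(2) by simp
    also have "\<dots> = log 2 (16 * (R + 1) / \<epsilon>)"
      using log_mult_pos[of 4 "4 * (R + 1) / \<epsilon>" 2] log_pow_cancel[of 2 2] pos by simp
    also have "\<dots> \<le> log 2 ((1 / \<epsilon>) ^ 2)" using sq pos e R_pos by simp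
    also have "\<dots> = 2 * (ln (1 / \<epsilon>) / ln 2)" using ln_realpow[of "1 / \<epsilon>" 2] e by (simp add: log_def)
    finally have Sk: "real (Suc k) \<le> 2 * (ln (1 / \<epsilon>) / ln 2)" by simp
    have lnpos: "ln (1 / \<epsilon>) > 0" using e e1 by simp
    have "ln (real (covering_number E d K \<epsilon>)) \<le> ln (real Q ^ Suc k)"
    proof (cases "covering_number E d K \<epsilon> = 0")
      \<comment> \<open>For covering number 0, as for the empty set, the convention
        \<open>ln 0 = 0\<close> applies.\<close>
      case True
      then show ?thesis using \<open>Q \<ge> 1\<close> by (simp add: one_le_power del: power_Suc)
    next
      case False
      then show ?thesis using cov \<open>Q \<ge> 1\<close>
        by (metis (mono_tags) ln_mono of_nat_0_less_iff of_nat_le_iff of_nat_power bot_nat_0.not_eq_extremum)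
    qed
    also have "\<dots> = real (Suc k) * ln (real Q)" using \<open>Q \<ge> 1\<close> by (subst ln_realpow) auto
    also have "\<dots> \<le> 2 * (ln (1 / \<epsilon>) / ln 2) * ln (real Q)" using Sk lnQ by (rule mult_right_mono)
    also have "\<dots> \<le> (4 * ln (real Q) / ln 2) * ln (1 / \<epsilon>)"
      using lnpos lnQ by (simp add: field_simps)
    finally show "ereal (ln (real (covering_number E d K \<epsilon>)) / ln (1 / \<epsilon>))
        \<le> ereal (4 * ln (real Q) / ln 2)"
      using lnpos by (simp add: pos_divide_le_eq)
  qed
  then have "fractal_dim E d K \<le> ereal (4 * ln (real Q) / ln 2)"
    unfolding fractal_dim_def by (rule Limsup_bounded)
  then show ?thesis by (simp only: Q)
qed

lemma exponential_attractor: "exponential_attractor E d X S exp_attractor"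
  unfolding exponential_attractor_def
proof (intro conjI)
  show "\<exists>A. global_attractor E d X S A \<and> A \<subseteq> exp_attractor"
    using global_attractor attractor_subset_exp_attractor by blast
  show "fractal_dim E d exp_attractor < \<infinity>"
    using fractal_dim_le[OF subset_refl] by (rule le_less_trans) simp
  have "2 * R * (1 + 2 * L ^ 2) > 0" using R_pos by (intro mult_pos_pos) (auto simp: add_pos_nonneg)
  then show "\<exists>c0>0. \<exists>c1>0. exponentially_attracts d X S exp_attractor c0 c1"
    using exp_attraction by (meson ln_gt_zero one_less_numeral_iff semiring_norm(76))
qed (use compact_exp_attractor exp_attractor_subset_X exp_attractor_positively_invariant in auto)

end

section \<open>Products in Fourier space\<close>

text \<open>The truncation at 1 matters: \<open>0 powr (- s)\<close> is 0, and a product over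
  coordinates with a vanishing factor could not dominate the lattice sum.\<close>

lemma summable_on_int_powr:
  fixes s :: real
  assumes "1 < s"
  shows "(\<lambda>m::int. max 1 \<bar>real_of_int m\<bar> powr (- s)) summable_on UNIV"
proof -
  have "summable (\<lambda>m::nat. real m powr (- s))" using assms by (simp add: summable_real_powr_iff)
  then have "summable (\<lambda>m::nat. max 1 (real m) powr (- s))"
    by (rule summable_cong[THEN iffD1, rotated])
      (use eventually_ge_at_top[of "1::nat"] in eventually_elim, simp)
  then have *: "(\<lambda>m::nat. max 1 (real m) powr (- s)) summable_on UNIV"
    by (subst summable_on_UNIV_nonneg_real_iff) auto
  have "(\<lambda>m::int. max 1 \<bar>real_of_int m\<bar> powr (- s)) summable_on range int"
    using * by (subst summable_on_reindex) (auto simp: o_def)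
  moreover have "(\<lambda>m::int. max 1 \<bar>real_of_int m\<bar> powr (- s)) summable_on range (\<lambda>k. - int k)"
    using * by (subst summable_on_reindex) (auto simp: o_def inj_on_def)
  ultimately have "(\<lambda>m::int. max 1 \<bar>real_of_int m\<bar> powr (- s)) summable_on (range int \<union> range (\<lambda>k. - int k))"
    by (rule summable_on_union)
  moreover have "range int \<union> range (\<lambda>k. - int k) = UNIV"
    by (auto simp: image_iff) (metis int_cases2)
  ultimately show ?thesis by simp
qed

text \<open>A finite set of vectors sits in the product of its projections, over which the sum
  factorises.\<close>

lemma summable_on_vec_prod:
  fixes g :: "'b \<Rightarrow> real"
  assumes g: "g summable_on UNIV" and nonneg: "\<And>m. 0 \<le> g m"
  shows "(\<lambda>n::'b ^ 'n. \<Prod>j\<in>UNIV. g (n $ j)) summable_on UNIV"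
proof (rule nonneg_bdd_above_summable_on)
  show "bdd_above (sum (\<lambda>n::'b ^ 'n. \<Prod>j\<in>UNIV. g (n $ j)) ` {F. F \<subseteq> UNIV \<and> finite F})"
  proof (rule bdd_aboveI2)
    fix F :: "('b ^ 'n) set" assume "F \<in> {F. F \<subseteq> UNIV \<and> finite F}"
    then have F: "finite F" by simp
    have "(\<Sum>n\<in>F. \<Prod>j\<in>UNIV. g (n $ j)) = (\<Sum>h\<in>vec_nth ` F. \<Prod>j\<in>UNIV. g (h j))"
      by (subst sum.reindex) (auto simp: inj_on_def vec_nth_inject)
    also have "\<dots> \<le> (\<Sum>h\<in>PiE UNIV (\<lambda>j. (\<lambda>n. n $ j) ` F). \<Prod>j\<in>UNIV. g (h j))"
      using F nonneg by (intro sum_mono2 finite_PiE prod_nonneg) auto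
    also have "\<dots> = (\<Prod>j\<in>(UNIV::'n set). \<Sum>m\<in>(\<lambda>n. n $ j) ` F. g m)"
      using F by (subst prod_sum_PiE) auto
    also have "\<dots> \<le> (\<Prod>j\<in>(UNIV::'n set). infsum g UNIV)"
      using F nonneg g by (intro prod_mono conjI sum_nonneg finite_sum_le_infsum) auto
    finally show "(\<Sum>n\<in>F. \<Prod>j\<in>UNIV. g (n $ j)) \<le> (\<Prod>j\<in>(UNIV::'n set). infsum g UNIV)" .
  qed
qed (simp add: prod_nonneg nonneg)

lemma wave_0 [simp]: "wave a 0 = 0"
  by (simp add: wave_def vec_eq_iff)

lemma wave_add: "wave a (m + n) = wave a m + wave a n"
  by (simp add: wave_def vec_eq_iff add_divide_distrib)

locale torus =
  fixes a :: "real ^ 3"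
  assumes a_pos: "\<And>j. 0 < a $ j"
begin

abbreviation freq :: "int ^ 3 \<Rightarrow> real" where
  "freq n \<equiv> norm (wave a n)"

lemma freq_pos: "n \<noteq> 0 \<Longrightarrow> 0 < freq n"
  using wave_nonzero[of a n] a_pos by simp

lemma freq_ge:
  assumes "n \<noteq> 0"
  shows "max 1 \<bar>real_of_int (n $ j)\<bar> / (\<Sum>i\<in>UNIV. a $ i) \<le> freq n"
proof -
  let ?c = "\<Sum>i\<in>UNIV. a $ i"
  have *: "\<bar>real_of_int (n $ i)\<bar> / ?c \<le> freq n" for i
  proof -
    have "a $ i \<le> ?c" using a_pos by (intro member_le_sum) (auto intro: less_imp_le)
    then have "\<bar>real_of_int (n $ i)\<bar> / ?c \<le> \<bar>real_of_int (n $ i)\<bar> / a $ i"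
      using a_pos[of i] by (intro divide_left_mono) auto
    also have "\<dots> = \<bar>wave a n $ i\<bar>" using a_pos[of i] by (simp add: wave_def)
    also have "\<dots> \<le> freq n" by (rule component_le_norm_cart)
    finally show ?thesis .
  qed
  obtain i where "n $ i \<noteq> 0" using assms by (auto simp: vec_eq_iff)
  then have "1 \<le> \<bar>real_of_int (n $ i)\<bar>" by linarith
  then have "1 / ?c \<le> \<bar>real_of_int (n $ i)\<bar> / ?c"
    using a_pos by (intro divide_right_mono sum_nonneg) (auto intro: less_imp_le)
  then have "1 / ?c \<le> freq n" using *[of i] by linarith
  then show ?thesis using *[of j] by (auto simp: max_def)
qed

text \<open>Sharing the exponent among three coordinates leaves 2\<sigma> / 3 for each, which
  exceeds 1 exactly when \<sigma> > 3/2.\<close>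

lemma summable_freq:
  assumes "3 / 2 < \<sigma>"
  shows "(\<lambda>n. freq n powr (- 2 * \<sigma>)) summable_on UNIV"
proof -
  let ?c = "\<Sum>i\<in>UNIV. a $ i"
  let ?s = "2 * \<sigma> / 3"
  have c: "?c > 0" using a_pos by (intro sum_pos) auto
  have "(\<lambda>n::int ^ 3. ?c powr (2 * \<sigma>) * (\<Prod>j\<in>UNIV. max 1 \<bar>real_of_int (n $ j)\<bar> powr (- ?s))) summable_on UNIV"
    by (intro summable_on_cmult_right summable_on_vec_prod summable_on_int_powr) (use assms in auto)
  then show ?thesis
  proof (rule summable_on_comparison_test)
    fix n :: "int ^ 3"
    show "freq n powr (- 2 * \<sigma>) \<le> ?c powr (2 * \<sigma>) * (\<Prod>j\<in>UNIV. max 1 \<bar>real_of_int (n $ j)\<bar> powr (- ?s))"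
    proof (cases "n = 0")
      case False
      have "freq n powr (- 2 * \<sigma>) = (\<Prod>j\<in>(UNIV::3 set). freq n powr (- ?s))"
        using freq_pos[OF False] by (simp add: powr_powr flip: powr_realpow)
      also have "\<dots> \<le> (\<Prod>j\<in>UNIV. (max 1 \<bar>real_of_int (n $ j)\<bar> / ?c) powr (- ?s))"
        using freq_ge[OF False] c assms by (intro prod_mono conjI powr_mono2') auto
      also have "\<dots> = (\<Prod>j\<in>(UNIV::3 set). ?c powr ?s * max 1 \<bar>real_of_int (n $ j)\<bar> powr (- ?s))"
        using c by (intro prod.cong refl) (simp add: powr_divide powr_minus field_simps)
      also have "\<dots> = ?c powr (2 * \<sigma>) * (\<Prod>j\<in>UNIV. max 1 \<bar>real_of_int (n $ j)\<bar> powr (- ?s))"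
        using c by (simp add: prod.distrib powr_powr flip: powr_realpow)
      finally show ?thesis .
    qed (use assms in \<open>simp add: prod_nonneg\<close>)
  qed simp
qed

text \<open>The Epstein zeta function of the lattice of frequencies; mode 0 drops out because
  \<open>0 powr x = 0\<close>.\<close>

definition zeta :: "real \<Rightarrow> real" where
  "zeta \<sigma> = infsum (\<lambda>n. freq n powr (- 2 * \<sigma>)) UNIV"

lemma sum_le_zeta:
  assumes "3 / 2 < \<sigma>" "finite B"
  shows "(\<Sum>n\<in>B. freq n powr (- 2 * \<sigma>)) \<le> zeta \<sigma>"
  unfolding zeta_def using assms by (intro finite_sum_le_infsum summable_freq) auto

text \<open>Counting by Markov's inequality: each nonzero mode in the set contributes at least
  \<open>e\<close> to the convergent sum \<open>zeta 2\<close>.\<close>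

lemma finite_freq_le: "finite {n. freq n \<le> \<Lambda>}"
proof -
  define e where "e = max 1 \<Lambda> powr (- 2 * 2)"
  have e: "e > 0" by (simp add: e_def)
  have "card F \<le> nat \<lfloor>zeta 2 / e\<rfloor>" if F: "finite F" "F \<subseteq> {n. freq n \<le> \<Lambda>} - {0}" for F
  proof -
    have "real (card F) * e = (\<Sum>n\<in>F. e)" by simp
    also have "\<dots> \<le> (\<Sum>n\<in>F. freq n powr (- 2 * 2))"
      unfolding e_def using F freq_pos by (intro sum_mono powr_mono2') (auto simp: subset_iff)
    also have "\<dots> \<le> zeta 2" using F by (intro sum_le_zeta) auto
    finally have "real (card F) \<le> zeta 2 / e" using e by (simp add: field_simps)
    then show ?thesis by linarith
  qed
  then have "finite ({n. freq n \<le> \<Lambda>} - {0})"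
    using finite_if_finite_subsets_card_bdd by metis
  then show ?thesis by simp
qed

text \<open>
  The weight \<open>freq n powr \<sigma>\<close> is distributed over the two factors by
  \<open>freq n \<le> freq k + freq (n - k)\<close>; Cauchy-Schwarz against \<open>freq k powr -\<sigma> * freq (n - k) powr -\<sigma>\<close>
  then leaves a sum that is bounded by \<open>zeta\<close>.
\<close>

lemma convolution_weight:
  assumes "0 \<le> \<sigma>"
  shows "freq n powr (2 * \<sigma>) * (freq k powr (- 2 * \<sigma>) * freq (n - k) powr (- 2 * \<sigma>))
    \<le> 2 powr (2 * \<sigma>) * (freq k powr (- 2 * \<sigma>) + freq (n - k) powr (- 2 * \<sigma>))"
proof (cases "k = 0 \<or> n - k = 0")
  case True
  then show ?thesis by auto
next
  case False
  have *: "freq n powr (2 * \<sigma>) * (freq k powr (- 2 * \<sigma>) * freq l powr (- 2 * \<sigma>))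
      \<le> 2 powr (2 * \<sigma>) * (freq k powr (- 2 * \<sigma>) + freq l powr (- 2 * \<sigma>))"
    if le: "freq k \<le> freq l" and n: "n = k + l" and pos: "0 < freq k" "0 < freq l" for k l
  proof -
    have "freq n \<le> 2 * freq l" using norm_triangle_ineq[of "wave a k" "wave a l"] le n by (simp add: wave_add)
    then have "freq n powr (2 * \<sigma>) \<le> (2 * freq l) powr (2 * \<sigma>)"
      using assms by (intro powr_mono2) auto
    also have "\<dots> = 2 powr (2 * \<sigma>) * freq l powr (2 * \<sigma>)" using pos by (simp add: powr_mult)
    finally have "freq n powr (2 * \<sigma>) * (freq k powr (- 2 * \<sigma>) * freq l powr (- 2 * \<sigma>))
        \<le> 2 powr (2 * \<sigma>) * freq l powr (2 * \<sigma>) * (freq k powr (- 2 * \<sigma>) * freq l powr (- 2 * \<sigma>))"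
      by (rule mult_right_mono) simp
    also have "\<dots> = 2 powr (2 * \<sigma>) * freq k powr (- 2 * \<sigma>)" using pos by (simp add: powr_minus)
    also have "\<dots> \<le> 2 powr (2 * \<sigma>) * (freq k powr (- 2 * \<sigma>) + freq l powr (- 2 * \<sigma>))"
      by (intro mult_left_mono) auto
    finally show ?thesis .
  qed
  have pos: "0 < freq k" "0 < freq (n - k)" using False freq_pos by auto
  show ?thesis
  proof (cases "freq k \<le> freq (n - k)")
    case True
    then show ?thesis using *[of k "n - k"] pos by simp
  next
    case False
    then show ?thesis using *[of "n - k" k] pos by (simp add: mult_ac add.commute)
  qed
qed

definition conv_const :: "real \<Rightarrow> real" where
  "conv_const \<sigma> = 2 powr (2 * \<sigma>) * (2 * zeta \<sigma>)"

lemma zeta_nonneg: "0 \<le> zeta \<sigma>"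
  unfolding zeta_def by (intro infsum_nonneg) simp

lemma conv_const_nonneg: "0 \<le> conv_const \<sigma>"
  using zeta_nonneg by (simp add: conv_const_def)

text \<open>Cauchy-Schwarz with the factorisation \<open>x k * y k\<close>. At k = 0 and k = n the
  factor \<open>x k\<close> vanishes, which agrees with the product because P and Q have mean
  zero.\<close>

lemma convolution_partial:
  fixes P Q :: "int ^ 3 \<Rightarrow> real"
  assumes \<sigma>: "3 / 2 < \<sigma>" and K: "finite K" and "P 0 = 0" "Q 0 = 0"
  shows "freq n powr (2 * \<sigma>) * (\<Sum>k\<in>K. P k * Q (n - k))\<^sup>2
    \<le> conv_const \<sigma> * (\<Sum>k\<in>K. (freq k powr (2 * \<sigma>) * (P k)\<^sup>2) * (freq (n - k) powr (2 * \<sigma>) * (Q (n - k))\<^sup>2))"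
proof -
  define x where "x k = freq k powr (- \<sigma>) * freq (n - k) powr (- \<sigma>)" for k
  define y where "y k = (freq k powr \<sigma> * P k) * (freq (n - k) powr \<sigma> * Q (n - k))" for k
  have xy: "P k * Q (n - k) = x k * y k" for k
  proof (cases "k = 0 \<or> n - k = 0")
    case True
    then show ?thesis using assms by (auto simp: y_def)
  next
    case False
    then show ?thesis using freq_pos[of k] freq_pos[of "n - k"] by (simp add: x_def y_def powr_minus field_simps)
  qed
  have sq: "(freq m powr s)\<^sup>2 = freq m powr (2 * s)" for m s
    by (simp add: power2_eq_square flip: powr_add)
  have x2: "(x k)\<^sup>2 = freq k powr (- 2 * \<sigma>) * freq (n - k) powr (- 2 * \<sigma>)" for k
    by (simp add: x_def power_mult_distrib sq)
  have y2: "(y k)\<^sup>2 = (freq k powr (2 * \<sigma>) * (P k)\<^sup>2) * (freq (n - k) powr (2 * \<sigma>) * (Q (n - k))\<^sup>2)" for k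
    by (simp add: y_def power_mult_distrib sq)
  have "freq n powr (2 * \<sigma>) * (\<Sum>k\<in>K. (x k)\<^sup>2)
      \<le> (\<Sum>k\<in>K. 2 powr (2 * \<sigma>) * (freq k powr (- 2 * \<sigma>) + freq (n - k) powr (- 2 * \<sigma>)))"
    unfolding sum_distrib_left x2 using \<sigma> by (intro sum_mono convolution_weight) simp
  also have "\<dots> = 2 powr (2 * \<sigma>) *
      ((\<Sum>k\<in>K. freq k powr (- 2 * \<sigma>)) + (\<Sum>m\<in>(\<lambda>k. n - k) ` K. freq m powr (- 2 * \<sigma>)))"
    by (subst sum.reindex) (auto simp: inj_on_def o_def sum.distrib simp flip: sum_distrib_left)
  also have "\<dots> \<le> 2 powr (2 * \<sigma>) * (zeta \<sigma> + zeta \<sigma>)"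
    using \<sigma> K by (intro mult_left_mono add_mono sum_le_zeta) auto
  finally have X: "freq n powr (2 * \<sigma>) * (\<Sum>k\<in>K. (x k)\<^sup>2) \<le> conv_const \<sigma>" by (simp add: conv_const_def)
  have "freq n powr (2 * \<sigma>) * (\<Sum>k\<in>K. P k * Q (n - k))\<^sup>2
      \<le> freq n powr (2 * \<sigma>) * ((\<Sum>k\<in>K. (x k)\<^sup>2) * (\<Sum>k\<in>K. (y k)\<^sup>2))"
    unfolding xy by (intro mult_left_mono Cauchy_Schwarz_ineq_sum) simp
  also have "\<dots> \<le> conv_const \<sigma> * (\<Sum>k\<in>K. (y k)\<^sup>2)"
    unfolding mult.assoc[symmetric] using X by (intro mult_right_mono sum_nonneg) auto
  finally show ?thesis by (simp only: y2)
qed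

context
  fixes \<sigma> :: real and P Q :: "int ^ 3 \<Rightarrow> real"
  assumes \<sigma>: "3 / 2 < \<sigma>"
    and P: "P 0 = 0" "(\<lambda>k. freq k powr (2 * \<sigma>) * (P k)\<^sup>2) summable_on UNIV" "\<And>k. 0 \<le> P k"
    and Q: "Q 0 = 0" "(\<lambda>k. freq k powr (2 * \<sigma>) * (Q k)\<^sup>2) summable_on UNIV" "\<And>k. 0 \<le> Q k"
begin

text \<open>After the weighted Cauchy-Schwarz step a convolution of two nonnegative summable
  sequences remains; exchanging the sums bounds it by the product of the two sums.\<close>

lemma convolution_partial_bound:
  assumes A: "finite A" and K: "finite K"
  shows "(\<Sum>n\<in>A. freq n powr (2 * \<sigma>) * (\<Sum>k\<in>K. P k * Q (n - k))\<^sup>2)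
    \<le> conv_const \<sigma> * ((\<Sum>\<^sub>\<infinity>k. freq k powr (2 * \<sigma>) * (P k)\<^sup>2) * (\<Sum>\<^sub>\<infinity>k. freq k powr (2 * \<sigma>) * (Q k)\<^sup>2))"
proof -
  let ?p = "\<lambda>k. freq k powr (2 * \<sigma>) * (P k)\<^sup>2" and ?q = "\<lambda>k. freq k powr (2 * \<sigma>) * (Q k)\<^sup>2"
  have "(\<Sum>n\<in>A. freq n powr (2 * \<sigma>) * (\<Sum>k\<in>K. P k * Q (n - k))\<^sup>2)
      \<le> (\<Sum>n\<in>A. conv_const \<sigma> * (\<Sum>k\<in>K. ?p k * ?q (n - k)))"
    by (intro sum_mono convolution_partial \<sigma> K P Q)
  also have "\<dots> = conv_const \<sigma> * (\<Sum>k\<in>K. ?p k * (\<Sum>n\<in>A. ?q (n - k)))"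
    unfolding sum_distrib_left[symmetric] by (subst sum.swap) (simp add: sum_distrib_left)
  also have "\<dots> \<le> conv_const \<sigma> * (\<Sum>k\<in>K. ?p k * infsum ?q UNIV)"
  proof (intro mult_left_mono sum_mono conv_const_nonneg)
    fix k
    have "(\<Sum>n\<in>A. ?q (n - k)) = (\<Sum>m\<in>(\<lambda>n. n - k) ` A. ?q m)"
      by (subst sum.reindex) (auto simp: inj_on_def)
    also have "\<dots> \<le> infsum ?q UNIV" using A Q by (intro finite_sum_le_infsum) auto
    finally show "(\<Sum>n\<in>A. ?q (n - k)) \<le> infsum ?q UNIV" .
  qed simp
  also have "\<dots> \<le> conv_const \<sigma> * (infsum ?p UNIV * infsum ?q UNIV)"
    unfolding sum_distrib_right[symmetric]
    by (intro mult_left_mono mult_right_mono conv_const_nonneg finite_sum_le_infsum P K infsum_nonneg) auto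
  finally show ?thesis .
qed

text \<open>The bound for the single mode n controls all partial sums. For n = 0 the weight is 0 and
  it would say nothing.\<close>

lemma convolution_summable:
  assumes "n \<noteq> 0"
  shows "(\<lambda>k. P k * Q (n - k)) summable_on UNIV"
proof (rule nonneg_bdd_above_summable_on)
  let ?I = "conv_const \<sigma> * ((\<Sum>\<^sub>\<infinity>k. freq k powr (2 * \<sigma>) * (P k)\<^sup>2) * (\<Sum>\<^sub>\<infinity>k. freq k powr (2 * \<sigma>) * (Q k)\<^sup>2))"
  show "bdd_above (sum (\<lambda>k. P k * Q (n - k)) ` {F. F \<subseteq> UNIV \<and> finite F})"
  proof (rule bdd_aboveI2)
    fix K :: "(int ^ 3) set" assume "K \<in> {F. F \<subseteq> UNIV \<and> finite F}"
    then have "freq n powr (2 * \<sigma>) * (\<Sum>k\<in>K. P k * Q (n - k))\<^sup>2 \<le> ?I"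
      using convolution_partial_bound[of "{n}" K] by simp
    then have "(\<Sum>k\<in>K. P k * Q (n - k))\<^sup>2 \<le> ?I / freq n powr (2 * \<sigma>)"
      using freq_pos[OF assms] by (simp add: field_simps)
    then show "(\<Sum>k\<in>K. P k * Q (n - k)) \<le> sqrt (?I / freq n powr (2 * \<sigma>))"
      by (rule real_le_rsqrt)
  qed
qed (simp add: P Q)

text \<open>The bound for finite inner sums is uniform in the summation set, so it passes to the
  limit; at n = 0 the vanishing weight makes convergence irrelevant.\<close>

lemma convolution_bound:
  assumes A: "finite A"
  shows "(\<Sum>n\<in>A. freq n powr (2 * \<sigma>) * (\<Sum>\<^sub>\<infinity>k. P k * Q (n - k))\<^sup>2)
    \<le> conv_const \<sigma> * ((\<Sum>\<^sub>\<infinity>k. freq k powr (2 * \<sigma>) * (P k)\<^sup>2) * (\<Sum>\<^sub>\<infinity>k. freq k powr (2 * \<sigma>) * (Q k)\<^sup>2))"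
proof (rule tendsto_upperbound)
  show "((\<lambda>K. \<Sum>n\<in>A. freq n powr (2 * \<sigma>) * (\<Sum>k\<in>K. P k * Q (n - k))\<^sup>2)
      \<longlongrightarrow> (\<Sum>n\<in>A. freq n powr (2 * \<sigma>) * (\<Sum>\<^sub>\<infinity>k. P k * Q (n - k))\<^sup>2)) (finite_subsets_at_top UNIV)"
  proof (rule tendsto_sum)
    fix n
    show "((\<lambda>K. freq n powr (2 * \<sigma>) * (\<Sum>k\<in>K. P k * Q (n - k))\<^sup>2)
      \<longlongrightarrow> freq n powr (2 * \<sigma>) * (\<Sum>\<^sub>\<infinity>k. P k * Q (n - k))\<^sup>2) (finite_subsets_at_top UNIV)"
    proof (cases "n = 0")
      case False
      show ?thesis
        by (intro tendsto_mult tendsto_const tendsto_power infsum_tendsto convolution_summable False)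
    qed simp
  qed
  show "\<forall>\<^sub>F K in finite_subsets_at_top UNIV. (\<Sum>n\<in>A. freq n powr (2 * \<sigma>) * (\<Sum>k\<in>K. P k * Q (n - k))\<^sup>2)
    \<le> conv_const \<sigma> * ((\<Sum>\<^sub>\<infinity>k. freq k powr (2 * \<sigma>) * (P k)\<^sup>2) * (\<Sum>\<^sub>\<infinity>k. freq k powr (2 * \<sigma>) * (Q k)\<^sup>2))"
    by (rule eventually_finite_subsets_at_top_weakI) (intro convolution_partial_bound A)
qed simp

end

end

section \<open>The nonlinearity\<close>

lemma hnorm_nonneg: "0 \<le> hnorm a s u"
  by (simp add: hnorm_def infsum_nonneg)

lemma hnorm_sq: "(hnorm a s u)\<^sup>2 = (\<Sum>\<^sub>\<infinity>n. norm (wave a n) powr (2 * s) * (norm (u n))\<^sup>2)"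
  by (simp add: hnorm_def infsum_nonneg)

lemma sobolevD:
  assumes "u \<in> sobolev bc a s"
  shows "u 0 = 0" "wave_dot a n (u n) = 0"
    "(\<lambda>n. norm (wave a n) powr (2 * s) * (norm (u n))\<^sup>2) summable_on UNIV"
  using assms by (auto simp: sobolev_def)

lemma sum_le_hnorm:
  assumes "u \<in> sobolev bc a s" "finite A"
  shows "(\<Sum>n\<in>A. norm (wave a n) powr (2 * s) * (norm (u n))\<^sup>2) \<le> (hnorm a s u)\<^sup>2"
  unfolding hnorm_sq using assms by (intro finite_sum_le_infsum sobolevD(3)) auto

lemma hnorm_sq_le:
  assumes "u \<in> sobolev bc a s"
    and "\<And>A. finite A \<Longrightarrow> (\<Sum>n\<in>A. norm (wave a n) powr (2 * s) * (norm (u n))\<^sup>2) \<le> C"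
  shows "(hnorm a s u)\<^sup>2 \<le> C"
  unfolding hnorm_sq using assms by (intro infsum_le_finite_sums sobolevD(3)) auto

lemma wave_dot_diff: "wave_dot a n (x - y) = wave_dot a n x - wave_dot a n y"
  by (simp add: wave_dot_def algebra_simps sum_subtractf)

lemma sobolev_diff:
  assumes "u \<in> sobolev bc a s" "v \<in> sobolev bc a s"
  shows "(\<lambda>n. u n - v n) \<in> sobolev bc a s"
proof -
  have "vertical_even_odd (\<lambda>n. u n - v n)" if "vertical_even_odd u" "vertical_even_odd v"
    using that by (simp add: vertical_even_odd_def vec_eq_iff forall_3)
  then show ?thesis
    using assms summable_hdist[OF assms] by (auto simp: sobolev_def vec_eq_iff wave_dot_diff)
qed

lemma zero_in_sobolev: "(\<lambda>n. 0) \<in> sobolev bc a s"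
  by (simp add: sobolev_def wave_dot_def vertical_even_odd_def vec_eq_iff forall_3)

lemma leray_diff: "leray a (\<lambda>n. u n - v n) = (\<lambda>n. leray a u n - leray a v n)"
  by (auto simp: leray_def fun_eq_iff vec_eq_iff wave_dot_diff diff_divide_distrib algebra_simps)

lemma helmholtz_inv_diff:
  "helmholtz_inv a \<alpha> (\<lambda>n. u n - v n) = (\<lambda>n. helmholtz_inv a \<alpha> u n - helmholtz_inv a \<alpha> v n)"
  by (simp add: helmholtz_inv_def fun_eq_iff scaleR_diff_right)

lemma rot_eq: "rot u n = vector [- (u n $ 2), u n $ 1, 0]"
  by (simp add: rot_def rot_matrix_def vec_eq_iff forall_3 matrix_vector_mult_def sum_3)

lemma rot_diff: "rot (\<lambda>n. u n - v n) = (\<lambda>n. rot u n - rot v n)"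
  by (simp add: rot_eq fun_eq_iff vec_eq_iff forall_3)

lemma norm_le_l1_vec: "norm (x :: complex ^ 'n) \<le> (\<Sum>i\<in>UNIV. norm (x $ i))"
  unfolding norm_vec_def by (rule L2_set_le_sum) simp

lemma norm_rot_le: "norm (rot u n) \<le> 2 * norm (u n)"
proof -
  have "norm (rot u n) \<le> norm (u n $ 2) + norm (u n $ 1)"
    using norm_le_l1_vec[of "rot u n"] by (simp add: sum_3 rot_eq)
  then show ?thesis using Finite_Cartesian_Product.norm_nth_le[of "u n" 1]
      Finite_Cartesian_Product.norm_nth_le[of "u n" 2] by linarith
qed

lemma norm_helmholtz_inv_le: "norm (helmholtz_inv a \<alpha> u n) \<le> norm (u n)"
proof -
  have "1 / (1 + \<alpha>\<^sup>2 * (norm (wave a n))\<^sup>2) \<le> 1" by (simp add: add_pos_nonneg)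
  then have "1 / (1 + \<alpha>\<^sup>2 * (norm (wave a n))\<^sup>2) * norm (u n) \<le> 1 * norm (u n)"
    by (rule mult_right_mono) simp
  then show ?thesis by (simp add: helmholtz_inv_def add_nonneg_nonneg)
qed

lemma norm_wave_dot_le: "norm (wave_dot a n z) \<le> norm (wave a n) * norm z"
proof -
  have "norm (wave_dot a n z) \<le> (\<Sum>j\<in>UNIV. \<bar>wave a n $ j\<bar> * \<bar>norm (z $ j)\<bar>)"
    unfolding wave_dot_def by (rule order.trans[OF norm_sum]) (simp add: norm_mult)
  also have "\<dots> \<le> L2_set (\<lambda>j. wave a n $ j) UNIV * L2_set (\<lambda>j. norm (z $ j)) UNIV"
    by (rule L2_set_mult_ineq)
  finally show ?thesis by (simp add: norm_vec_def L2_set_def)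
qed

lemma norm_scaled_real_vec: "norm (\<chi> i. (c :: complex) * of_real (w $ i)) = norm c * norm (w :: real ^ 'n)"
  by (simp add: norm_vec_def norm_mult L2_set_right_distrib)

lemma norm_leray_le: "norm (leray a u n) \<le> 2 * norm (u n)"
proof (cases "n = 0")
  case False
  let ?w = "wave a n" and ?c = "wave_dot a n (u n) / of_real ((norm (wave a n))\<^sup>2)"
  have "norm (\<chi> i. ?c * of_real (?w $ i)) = norm ?c * norm ?w"
    by (rule norm_scaled_real_vec)
  also have "\<dots> = norm (wave_dot a n (u n)) * norm ?w / (norm ?w)\<^sup>2" by (simp add: norm_divide norm_power)
  also have "\<dots> \<le> norm ?w * norm (u n) * norm ?w / (norm ?w)\<^sup>2"
    by (intro divide_right_mono mult_right_mono norm_wave_dot_le) auto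
  also have "\<dots> \<le> norm (u n)" by (simp add: power2_eq_square)
  finally show ?thesis
    using False norm_triangle_ineq4[of "u n" "\<chi> i. ?c * of_real (?w $ i)"] by (simp add: leray_def)
qed (simp add: leray_def)

text \<open>The Laplacian preserves zero divergence mode by mode, so the Leray projector acts on it
  as the identity.\<close>

lemma stokes_eq:
  assumes "u \<in> sobolev bc a s"
  shows "stokes a u n = (norm (wave a n))\<^sup>2 *\<^sub>R u n"
proof (cases "n = 0")
  case False
  have lap: "laplacian a u n = - ((norm (wave a n))\<^sup>2 *\<^sub>R u n)"
  proof -
    have "(norm (wave a n))\<^sup>2 = (\<Sum>j\<in>UNIV. (wave a n $ j)\<^sup>2)"
      by (simp add: norm_vec_def L2_set_def sum_nonneg)
    moreover have "(\<Sum>j\<in>UNIV. \<i> * of_real (wave a n $ j) * (\<i> * of_real (wave a n $ j) * z))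
        = - of_real (\<Sum>j\<in>UNIV. (wave a n $ j)\<^sup>2) * z" for z :: complex
    proof -
      have "\<i> * of_real x * (\<i> * of_real x * z) = - (of_real (x\<^sup>2) * z)" for x
        by (simp add: complex_eq_iff power2_eq_square)
      then show ?thesis by (simp add: sum_negf sum_distrib_right)
    qed
    ultimately have *: "laplacian a u n $ i = - of_real ((norm (wave a n))\<^sup>2) * u n $ i" for i
      by (simp only: laplacian_def partial_modes_def comp_modes_def vec_lambda_beta)
    show ?thesis unfolding vec_eq_iff * by (simp add: scaleR_conv_of_real[symmetric] del: of_real_power)
  qed
  have "wave_dot a n (laplacian a u n) = - of_real ((norm (wave a n))\<^sup>2) * wave_dot a n (u n)"
    unfolding lap wave_dot_def sum_distrib_left
    by (intro sum.cong refl) (simp add: vector_scaleR_component scaleR_conv_of_real[where 'a = complex] mult_ac del: of_real_power)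
  then have "wave_dot a n (laplacian a u n) = 0" using sobolevD(2)[OF assms] by simp
  then have "leray a (laplacian a u) n = laplacian a u n"
    using False by (simp add: leray_def flip: zero_vec_def)
  then show ?thesis by (simp add: stokes_def lap)
qed (simp add: stokes_def leray_def)

lemma infsum_diff:
  fixes f g :: "'a \<Rightarrow> complex"
  assumes "f summable_on A" "g summable_on A"
  shows "infsum (\<lambda>x. f x - g x) A = infsum f A - infsum g A"
  using infsum_add[OF assms(1) summable_on_uminus[THEN iffD2, OF assms(2)]] by (simp add: infsum_uminus)

section \<open>Estimates of the nonlinear and Coriolis terms\<close>

text \<open>\<alpha> is deliberately not a parameter: constants defined in this locale cannot depend
  on it, and uniformity in \<alpha> becomes a matter of quantifier order.\<close>

locale rotating_nse = torus a
  for a :: "real ^ 3" +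
  fixes bc :: vertical_bc and \<nu> \<beta> f \<rho> :: real and F :: modes
  assumes \<nu>_pos: "0 < \<nu>" and \<beta>: "5 / 2 < \<beta>" and \<rho>_nonneg: "0 \<le> \<rho>"
    and F_smooth: "F \<in> sobolev bc a (\<beta> - 1)"
begin

abbreviation H :: "modes set" where "H \<equiv> sobolev bc a \<beta>"

abbreviation len :: real where "len \<equiv> \<Sum>i\<in>UNIV. a $ i"

lemma weight_split: "freq n powr (2 * \<beta>) = freq n powr (2 * (\<beta> - 1)) * (freq n)\<^sup>2"
proof (cases "n = 0")
  case False
  have "2 * \<beta> = 2 * (\<beta> - 1) + 2" by simp
  then have "freq n powr (2 * \<beta>) = freq n powr (2 * (\<beta> - 1) + 2)" by (rule arg_cong)
  then show ?thesis using freq_pos[OF False] by (simp only: powr_add powr_numeral)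
qed simp

lemma weight_shift: "freq n powr (2 * (\<beta> - 1)) * (freq n * x)\<^sup>2 = freq n powr (2 * \<beta>) * x\<^sup>2"
  unfolding weight_split power_mult_distrib by (rule mult.assoc[symmetric])

text \<open>Poincare's inequality: nonzero frequencies are at least 1 / \<open>len\<close>.\<close>

lemma weight_lower: "freq n powr (2 * (\<beta> - 1)) * x\<^sup>2 \<le> len\<^sup>2 * (freq n powr (2 * \<beta>) * x\<^sup>2)"
proof (cases "n = 0")
  case False
  have len: "0 < len" using a_pos by (intro sum_pos) auto
  have "1 / len \<le> max 1 \<bar>real_of_int (n $ 1)\<bar> / len" using len by (intro divide_right_mono) auto
  also have "\<dots> \<le> freq n" by (rule freq_ge[OF False])
  finally have "1 \<le> len * freq n" using len by (simp add: field_simps)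
  then have "1 \<le> (len * freq n)\<^sup>2" by simp
  then have "1 * (freq n powr (2 * (\<beta> - 1)) * x\<^sup>2) \<le> (len * freq n)\<^sup>2 * (freq n powr (2 * (\<beta> - 1)) * x\<^sup>2)"
    by (rule mult_right_mono) simp
  then show ?thesis unfolding weight_split power_mult_distrib by (simp only: mult_ac mult_1_left mult_1_right)
qed simp

lemma summable_lower:
  assumes "u \<in> H"
  shows "(\<lambda>k. freq k powr (2 * (\<beta> - 1)) * (norm (u k))\<^sup>2) summable_on UNIV"
  by (rule summable_on_comparison_test[OF summable_on_cmult_right[OF sobolevD(3)[OF assms]]])
    (rule weight_lower, simp)

lemma summable_shift:
  assumes "u \<in> H"
  shows "(\<lambda>k. freq k powr (2 * (\<beta> - 1)) * (freq k * norm (u k))\<^sup>2) summable_on UNIV"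
  unfolding weight_shift by (rule sobolevD(3)[OF assms])

lemma infsum_lower:
  assumes "u \<in> H"
  shows "(\<Sum>\<^sub>\<infinity>k. freq k powr (2 * (\<beta> - 1)) * (norm (u k))\<^sup>2) \<le> len\<^sup>2 * (hnorm a \<beta> u)\<^sup>2"
  unfolding hnorm_sq
  by (subst infsum_cmult_right'[symmetric])
    (intro infsum_mono summable_lower assms summable_on_cmult_right sobolevD(3)[OF assms] weight_lower)

text \<open>A real majorant with the derivative on the second factor. It dominates every product in
  \<open>B_alpha\<close>, in one or the other order of the arguments.\<close>

definition conv :: "modes \<Rightarrow> modes \<Rightarrow> int ^ 3 \<Rightarrow> real" where
  "conv u v n = (\<Sum>\<^sub>\<infinity>k. norm (u k) * (freq (n - k) * norm (v (n - k))))"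

lemma conv_summable:
  assumes "u \<in> H" "v \<in> H" "n \<noteq> 0"
  shows "(\<lambda>k. norm (u k) * (freq (n - k) * norm (v (n - k)))) summable_on UNIV"
  using assms \<beta>
  by (intro convolution_summable[of "\<beta> - 1" "\<lambda>k. norm (u k)" "\<lambda>k. freq k * norm (v k)" n]
      summable_lower summable_shift) (auto simp: sobolevD(1))

lemma conv_bound:
  assumes "u \<in> H" "v \<in> H" "finite A"
  shows "(\<Sum>n\<in>A. freq n powr (2 * (\<beta> - 1)) * (conv u v n)\<^sup>2)
    \<le> conv_const (\<beta> - 1) * len\<^sup>2 * ((hnorm a \<beta> u)\<^sup>2 * (hnorm a \<beta> v)\<^sup>2)"
proof -
  have "(\<Sum>n\<in>A. freq n powr (2 * (\<beta> - 1)) * (conv u v n)\<^sup>2)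
      \<le> conv_const (\<beta> - 1) * ((\<Sum>\<^sub>\<infinity>k. freq k powr (2 * (\<beta> - 1)) * (norm (u k))\<^sup>2)
          * (\<Sum>\<^sub>\<infinity>k. freq k powr (2 * (\<beta> - 1)) * (freq k * norm (v k))\<^sup>2))"
    unfolding conv_def using assms \<beta>
    by (intro convolution_bound summable_lower summable_shift) (auto simp: sobolevD(1))
  also have "\<dots> = conv_const (\<beta> - 1) * ((\<Sum>\<^sub>\<infinity>k. freq k powr (2 * (\<beta> - 1)) * (norm (u k))\<^sup>2)
      * (hnorm a \<beta> v)\<^sup>2)"
    by (simp only: weight_shift hnorm_sq)
  also have "\<dots> \<le> conv_const (\<beta> - 1) * ((len\<^sup>2 * (hnorm a \<beta> u)\<^sup>2) * (hnorm a \<beta> v)\<^sup>2)"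
    by (intro mult_left_mono mult_right_mono infsum_lower assms conv_const_nonneg) auto
  finally show ?thesis by (simp add: mult_ac)
qed

lemma mult_modes_bound:
  assumes "u \<in> H" "v \<in> H" "n \<noteq> 0"
    and "\<And>k. norm (p k) \<le> norm (u k)" "\<And>k. norm (q k) \<le> freq k * norm (v k)"
  shows "(\<lambda>k. p k * q (n - k)) summable_on UNIV" "norm (mult_modes p q n) \<le> conv u v n"
proof -
  have le: "norm (p k * q (n - k)) \<le> norm (u k) * (freq (n - k) * norm (v (n - k)))" for k
    unfolding norm_mult by (intro mult_mono assms) auto
  have *: "(\<lambda>k. norm (p k * q (n - k))) summable_on UNIV"
    by (rule summable_on_comparison_test[OF conv_summable[OF assms(1-3)]]) (auto intro: le)
  then show "(\<lambda>k. p k * q (n - k)) summable_on UNIV" by (rule abs_summable_summable)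
  have "norm (mult_modes p q n) \<le> (\<Sum>\<^sub>\<infinity>k. norm (p k * q (n - k)))"
    unfolding mult_modes_def by (rule norm_infsum_bound[OF *])
  also have "\<dots> \<le> conv u v n"
    unfolding conv_def by (intro infsum_mono * conv_summable assms le)
  finally show "norm (mult_modes p q n) \<le> conv u v n" .
qed

lemma norm_comp_modes_le: "norm (comp_modes j u k) \<le> norm (u k)"
  unfolding comp_modes_def by (rule Finite_Cartesian_Product.norm_nth_le)

lemma norm_comp_helmholtz_le: "norm (comp_modes j (helmholtz_inv a \<alpha> u) k) \<le> norm (u k)"
  by (rule order.trans[OF norm_comp_modes_le norm_helmholtz_inv_le])

lemma norm_partial_modes_le:
  assumes "norm (p k) \<le> norm (u k)"
  shows "norm (partial_modes a j p k) \<le> freq k * norm (u k)"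
  unfolding partial_modes_def norm_mult norm_ii norm_of_real real_norm_def
  using assms by (auto intro!: mult_mono component_le_norm_cart)

lemma norm_comps_le:
  fixes x :: "complex ^ 3"
  assumes "\<And>i. norm (x $ i) \<le> 3 * C"
  shows "norm x \<le> 9 * C"
  using norm_le_l1_vec[of x] assms[of 1] assms[of 2] assms[of 3] by (simp add: sum_3)

lemma norm_sum3_le:
  fixes g :: "3 \<Rightarrow> complex"
  assumes "\<And>j. norm (g j) \<le> C"
  shows "norm (\<Sum>j\<in>UNIV. g j) \<le> 3 * C"
  using norm_sum[of g UNIV] assms[of 1] assms[of 2] assms[of 3] by (simp add: sum_3)

text \<open>18 = 2 * 3 * 3: the crude bound for the projector, three components, three summands. In
  \<open>stretch\<close> the derivative falls on the filtered field, hence the reversed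
  order.\<close>

lemma B_alpha_bound:
  assumes "u \<in> H" "v \<in> H" "n \<noteq> 0"
  shows "norm (B_alpha a \<alpha> u v n) \<le> 18 * (conv u v n + conv v u n)"
proof -
  let ?w = "helmholtz_inv a \<alpha> u"
  have "norm (advect a ?w v n) \<le> 9 * conv u v n"
    unfolding advect_def using assms
    by (intro norm_comps_le) (auto intro!: norm_sum3_le mult_modes_bound(2) norm_comp_helmholtz_le
        norm_partial_modes_le norm_comp_modes_le)
  moreover have "norm (stretch a ?w v n) \<le> 9 * conv v u n"
    unfolding stretch_def using assms
    by (intro norm_comps_le) (auto intro!: norm_sum3_le mult_modes_bound(2) norm_comp_helmholtz_le
        norm_partial_modes_le norm_comp_modes_le)
  ultimately have "norm (advect a ?w v n + stretch a ?w v n) \<le> 9 * conv u v n + 9 * conv v u n"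
    by (rule norm_triangle_mono)
  then show ?thesis
    unfolding B_alpha_def
    using norm_leray_le[of a "\<lambda>n. advect a ?w v n + stretch a ?w v n" n] by simp
qed

text \<open>Two ways of inserting a mixed product are used: this one fits \<open>advect\<close>, the
  primed one fits \<open>stretch\<close>, so that both match the same splitting of the bilinear
  form. Summability is required because \<open>infsum\<close> is additive only then.\<close>

lemma mult_modes_diff:
  assumes "(\<lambda>k. p k * q (n - k)) summable_on UNIV" "(\<lambda>k. p' k * q' (n - k)) summable_on UNIV"
    "(\<lambda>k. p' k * q (n - k)) summable_on UNIV"
  shows "mult_modes p q n - mult_modes p' q' n
    = mult_modes (\<lambda>k. p k - p' k) q n + mult_modes p' (\<lambda>k. q k - q' k) n"
  unfolding mult_modes_def left_diff_distrib right_diff_distrib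
  using assms by (simp add: infsum_diff)

lemma mult_modes_diff':
  assumes "(\<lambda>k. p k * q (n - k)) summable_on UNIV" "(\<lambda>k. p' k * q' (n - k)) summable_on UNIV"
    "(\<lambda>k. p k * q' (n - k)) summable_on UNIV"
  shows "mult_modes p q n - mult_modes p' q' n
    = mult_modes p (\<lambda>k. q k - q' k) n + mult_modes (\<lambda>k. p k - p' k) q' n"
  unfolding mult_modes_def left_diff_distrib right_diff_distrib
  using assms by (simp add: infsum_diff)

lemma B_alpha_diff:
  assumes "u \<in> H" "v \<in> H" "n \<noteq> 0"
  shows "B_alpha a \<alpha> u u n - B_alpha a \<alpha> v v n
    = B_alpha a \<alpha> (\<lambda>k. u k - v k) u n + B_alpha a \<alpha> v (\<lambda>k. u k - v k) n"
proof -
  let ?R = "helmholtz_inv a \<alpha>" and ?w = "\<lambda>k. u k - v k"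
  let ?P = "\<lambda>j u. comp_modes j (?R u)" and ?D = "\<lambda>j i v. partial_modes a j (comp_modes i v)"
  let ?E = "\<lambda>i j u. partial_modes a i (comp_modes j (?R u))"
  have P: "(\<lambda>k. ?P j u k - ?P j v k) = ?P j ?w" for j
    by (simp add: helmholtz_inv_diff comp_modes_def fun_eq_iff)
  have C: "(\<lambda>k. comp_modes j u k - comp_modes j v k) = comp_modes j ?w" for j
    by (simp add: comp_modes_def fun_eq_iff)
  have D: "(\<lambda>k. ?D j i u k - ?D j i v k) = ?D j i ?w" for i j
    by (simp add: comp_modes_def partial_modes_def fun_eq_iff right_diff_distrib)
  have E: "(\<lambda>k. ?E i j u k - ?E i j v k) = ?E i j ?w" for i j
    by (simp add: helmholtz_inv_diff comp_modes_def partial_modes_def fun_eq_iff right_diff_distrib)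
  note bounds = norm_comp_helmholtz_le norm_partial_modes_le norm_comp_modes_le
  have "mult_modes (?P j u) (?D j i u) n - mult_modes (?P j v) (?D j i v) n
      = mult_modes (?P j ?w) (?D j i u) n + mult_modes (?P j v) (?D j i ?w) n" for i j
    unfolding P[symmetric] D[symmetric]
    by (intro mult_modes_diff mult_modes_bound(1)[of u u] mult_modes_bound(1)[of v v]
        mult_modes_bound(1)[of v u] assms bounds)
  then have 1: "advect a (?R u) u n - advect a (?R v) v n = advect a (?R ?w) u n + advect a (?R v) ?w n"
    by (simp add: advect_def vec_eq_iff flip: sum_subtractf sum.distrib)
  have "mult_modes (comp_modes j u) (?E i j u) n - mult_modes (comp_modes j v) (?E i j v) n
      = mult_modes (comp_modes j u) (?E i j ?w) n + mult_modes (comp_modes j ?w) (?E i j v) n" for i j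
    unfolding C[symmetric] E[symmetric]
    by (intro mult_modes_diff' mult_modes_bound(1)[of u u] mult_modes_bound(1)[of v v]
        mult_modes_bound(1)[of u v] assms bounds)
  then have 2: "stretch a (?R u) u n - stretch a (?R v) v n = stretch a (?R ?w) u n + stretch a (?R v) ?w n"
    by (simp add: stretch_def vec_eq_iff flip: sum_subtractf sum.distrib)
  \<comment> \<open>The projector acts on each mode separately, so an identity at the single mode k
    is enough.\<close>
  have L: "leray a (\<lambda>k. x k + y k) k - leray a (\<lambda>k. x' k + y' k) k = leray a z k + leray a z' k"
    if "x k - x' k + (y k - y' k) = z k + z' k" for x y x' y' z z' :: modes and k
  proof -
    have L: "leray a (\<lambda>k. x k + y k) k - leray a (\<lambda>k. x' k + y' k) k - leray a z k - leray a z' k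
        = leray a (\<lambda>k. x k + y k - (x' k + y' k) - z k - z' k) k"
      by (simp add: leray_diff)
    also have "x k + y k - (x' k + y' k) - z k - z' k = 0"
      using that by (simp add: algebra_simps)
    then have "leray a (\<lambda>k. x k + y k - (x' k + y' k) - z k - z' k) k = 0"
      by (simp add: leray_def wave_dot_def vec_eq_iff)
    finally show ?thesis by (simp add: algebra_simps)
  qed
  show ?thesis
    unfolding B_alpha_def by (rule L) (simp add: 1 2 add_ac)
qed

lemma norm_coriolis_le: "norm (leray a (rot (leray a (helmholtz_inv a \<alpha> u))) n) \<le> 8 * norm (u n)"
  using norm_leray_le[of a "rot (leray a (helmholtz_inv a \<alpha> u))" n]
    norm_rot_le[of "leray a (helmholtz_inv a \<alpha> u)" n]
    norm_leray_le[of a "helmholtz_inv a \<alpha> u" n] norm_helmholtz_inv_le[of a \<alpha> u n]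
  by linarith

section \<open>Lipschitz and growth bounds for the non-viscous terms\<close>

definition forcing :: "real \<Rightarrow> modes \<Rightarrow> modes" where
  "forcing \<alpha> u n = F n - f *\<^sub>R leray a (rot (leray a (helmholtz_inv a \<alpha> u))) n - B_alpha a \<alpha> u u n"

lemma forcing_diff_bound:
  assumes "u \<in> H" "v \<in> H" "n \<noteq> 0"
  defines "w \<equiv> \<lambda>k. u k - v k"
  shows "norm (forcing \<alpha> u n - forcing \<alpha> v n)
    \<le> 8 * \<bar>f\<bar> * norm (w n) + 18 * (conv w u n + conv u w n + conv v w n + conv w v n)"
proof -
  have w: "w \<in> H" unfolding w_def by (rule sobolev_diff[OF assms(1,2)])
  have "forcing \<alpha> u n - forcing \<alpha> v n = - (f *\<^sub>R leray a (rot (leray a (helmholtz_inv a \<alpha> w))) n)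
      - (B_alpha a \<alpha> u u n - B_alpha a \<alpha> v v n)"
    by (simp add: forcing_def w_def helmholtz_inv_diff leray_diff rot_diff scaleR_diff_right)
  also have "\<dots> = - (f *\<^sub>R leray a (rot (leray a (helmholtz_inv a \<alpha> w))) n)
      - (B_alpha a \<alpha> w u n + B_alpha a \<alpha> v w n)"
    unfolding w_def by (simp only: B_alpha_diff[OF assms(1-3)])
  finally have "norm (forcing \<alpha> u n - forcing \<alpha> v n) \<le> \<bar>f\<bar> * norm (leray a (rot (leray a (helmholtz_inv a \<alpha> w))) n)
      + (norm (B_alpha a \<alpha> w u n) + norm (B_alpha a \<alpha> v w n))"
    using norm_triangle_ineq4 norm_triangle_ineq
    by (smt (verit, ccfv_threshold) norm_minus_cancel norm_scaleR)
  also have "\<dots> \<le> \<bar>f\<bar> * (8 * norm (w n)) + (18 * (conv w u n + conv u w n) + 18 * (conv v w n + conv w v n))"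
    by (intro add_mono mult_left_mono norm_coriolis_le B_alpha_bound w assms) auto
  finally show ?thesis by (simp add: algebra_simps)
qed

lemma power2_sum5_le:
  fixes x1 x2 x3 x4 x5 :: real
  shows "(x1 + x2 + x3 + x4 + x5)\<^sup>2 \<le> 5 * (x1\<^sup>2 + x2\<^sup>2 + x3\<^sup>2 + x4\<^sup>2 + x5\<^sup>2)"
proof -
  have "5 * (x1\<^sup>2 + x2\<^sup>2 + x3\<^sup>2 + x4\<^sup>2 + x5\<^sup>2) - (x1 + x2 + x3 + x4 + x5)\<^sup>2
    = (x1 - x2)\<^sup>2 + (x1 - x3)\<^sup>2 + (x1 - x4)\<^sup>2 + (x1 - x5)\<^sup>2 + (x2 - x3)\<^sup>2 + (x2 - x4)\<^sup>2 + (x2 - x5)\<^sup>2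
      + (x3 - x4)\<^sup>2 + (x3 - x5)\<^sup>2 + (x4 - x5)\<^sup>2"
    by (simp add: power2_eq_square algebra_simps)
  moreover have "\<dots> \<ge> 0" by simp
  ultimately show ?thesis by linarith
qed

text \<open>5 comes from squaring five terms, 64 = 8^2 from the Coriolis bound, 1296 = 4 * 18^2 from
  four convolutions; the final 1 ensures positivity.\<close>

definition lip_const :: real where
  "lip_const = 5 * (64 * f\<^sup>2 * len\<^sup>2 + 1296 * (conv_const (\<beta> - 1) * len\<^sup>2 * \<rho>\<^sup>2)) + 1"

lemma lip_const_pos: "0 < lip_const"
  unfolding lip_const_def using conv_const_nonneg by (intro add_nonneg_pos) (auto intro!: mult_nonneg_nonneg add_nonneg_nonneg)

text \<open>Each of the four convolutions contains the difference once and a field bounded by \<rho>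
  once; \<open>conv_bound\<close> then loses exactly one derivative.\<close>

lemma forcing_lipschitz:
  assumes "u \<in> H" "v \<in> H" "hnorm a \<beta> u \<le> \<rho>" "hnorm a \<beta> v \<le> \<rho>" "finite A"
  shows "(\<Sum>n\<in>A. freq n powr (2 * (\<beta> - 1)) * (norm (forcing \<alpha> u n - forcing \<alpha> v n))\<^sup>2)
    \<le> lip_const * (hdist a \<beta> u v)\<^sup>2"
proof -
  define w where "w = (\<lambda>k. u k - v k)"
  define W where "W n = freq n powr (2 * (\<beta> - 1))" for n
  let ?K = "conv_const (\<beta> - 1) * len\<^sup>2" and ?h = "(hnorm a \<beta> w)\<^sup>2"
  have w: "w \<in> H" unfolding w_def by (rule sobolev_diff[OF assms(1,2)])
  have W: "W n \<ge> 0" for n by (simp add: W_def)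
  have pt: "W n * (norm (forcing \<alpha> u n - forcing \<alpha> v n))\<^sup>2 \<le> 5 * (64 * f\<^sup>2 * (W n * (norm (w n))\<^sup>2)
      + 324 * (W n * (conv w u n)\<^sup>2 + W n * (conv u w n)\<^sup>2 + W n * (conv v w n)\<^sup>2 + W n * (conv w v n)\<^sup>2))" for n
  proof (cases "n = 0")
    case False
    have "(norm (forcing \<alpha> u n - forcing \<alpha> v n))\<^sup>2
        \<le> (8 * \<bar>f\<bar> * norm (w n) + 18 * conv w u n + 18 * conv u w n + 18 * conv v w n + 18 * conv w v n)\<^sup>2"
      using forcing_diff_bound[OF assms(1,2) False, of \<alpha>]
      by (intro power_mono) (auto simp: w_def algebra_simps)
    also have "\<dots> \<le> 5 * ((8 * \<bar>f\<bar> * norm (w n))\<^sup>2 + (18 * conv w u n)\<^sup>2 + (18 * conv u w n)\<^sup>2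
        + (18 * conv v w n)\<^sup>2 + (18 * conv w v n)\<^sup>2)"
      by (rule power2_sum5_le)
    finally have "W n * (norm (forcing \<alpha> u n - forcing \<alpha> v n))\<^sup>2 \<le> W n * \<dots>"
      using W by (rule mult_left_mono)
    then show ?thesis by (simp add: power_mult_distrib algebra_simps)
  qed (simp add: W_def)
  have c: "(\<Sum>n\<in>A. W n * (conv x y n)\<^sup>2) \<le> ?K * (\<rho>\<^sup>2 * ?h)"
    if "x \<in> H" "y \<in> H" "(hnorm a \<beta> x)\<^sup>2 * (hnorm a \<beta> y)\<^sup>2 \<le> \<rho>\<^sup>2 * ?h" for x y
    unfolding W_def using conv_const_nonneg[of "\<beta> - 1"] that
    by (intro order.trans[OF conv_bound mult_left_mono] assms) auto
  have \<rho>2: "(hnorm a \<beta> u)\<^sup>2 \<le> \<rho>\<^sup>2" "(hnorm a \<beta> v)\<^sup>2 \<le> \<rho>\<^sup>2"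
    using assms hnorm_nonneg by (auto intro: power_mono)
  have "(\<Sum>n\<in>A. W n * (norm (w n))\<^sup>2) \<le> (\<Sum>n\<in>A. len\<^sup>2 * (freq n powr (2 * \<beta>) * (norm (w n))\<^sup>2))"
    unfolding W_def by (intro sum_mono weight_lower)
  also have "\<dots> \<le> len\<^sup>2 * ?h"
    unfolding sum_distrib_left[symmetric] by (intro mult_left_mono sum_le_hnorm[OF w] assms) auto
  finally have lin: "(\<Sum>n\<in>A. W n * (norm (w n))\<^sup>2) \<le> len\<^sup>2 * ?h" .
  have "(\<Sum>n\<in>A. W n * (norm (forcing \<alpha> u n - forcing \<alpha> v n))\<^sup>2)
      \<le> 5 * (64 * f\<^sup>2 * (\<Sum>n\<in>A. W n * (norm (w n))\<^sup>2)
        + 324 * ((\<Sum>n\<in>A. W n * (conv w u n)\<^sup>2) + (\<Sum>n\<in>A. W n * (conv u w n)\<^sup>2)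
          + (\<Sum>n\<in>A. W n * (conv v w n)\<^sup>2) + (\<Sum>n\<in>A. W n * (conv w v n)\<^sup>2)))"
    by (rule order.trans[OF sum_mono[OF pt]]) (simp add: sum.distrib flip: sum_distrib_left)
  also have "\<dots> \<le> 5 * (64 * f\<^sup>2 * (len\<^sup>2 * ?h)
        + 324 * (?K * (\<rho>\<^sup>2 * ?h) + ?K * (\<rho>\<^sup>2 * ?h) + ?K * (\<rho>\<^sup>2 * ?h) + ?K * (\<rho>\<^sup>2 * ?h)))"
  proof (intro mult_left_mono add_mono lin c w assms(1,2))
    show "?h * (hnorm a \<beta> u)\<^sup>2 \<le> \<rho>\<^sup>2 * ?h" "?h * (hnorm a \<beta> v)\<^sup>2 \<le> \<rho>\<^sup>2 * ?h"
      "(hnorm a \<beta> u)\<^sup>2 * ?h \<le> \<rho>\<^sup>2 * ?h" "(hnorm a \<beta> v)\<^sup>2 * ?h \<le> \<rho>\<^sup>2 * ?h"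
      using \<rho>2 by (auto simp: mult.commute[of ?h] intro!: mult_right_mono)
  qed auto
  also have "\<dots> = (lip_const - 1) * ?h" by (simp add: lip_const_def algebra_simps)
  also have "\<dots> \<le> lip_const * ?h" by (intro mult_right_mono) auto
  finally show ?thesis by (simp add: W_def hdist_def w_def)
qed

definition growth_const :: real where
  "growth_const = 2 * (lip_const * \<rho>\<^sup>2 + (hnorm a (\<beta> - 1) F)\<^sup>2) + 1"

lemma growth_const_pos: "0 < growth_const"
  unfolding growth_const_def using lip_const_pos by (intro add_nonneg_pos) auto

lemma power2_norm_sum_le: "(norm (x + y))\<^sup>2 \<le> 2 * ((norm x)\<^sup>2 + (norm y)\<^sup>2)" for x y :: "'b :: real_normed_vector"
proof -
  have "(norm (x + y))\<^sup>2 \<le> (norm x + norm y)\<^sup>2" by (intro power_mono norm_triangle_ineq) simp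
  also have "\<dots> \<le> 2 * ((norm x)\<^sup>2 + (norm y)\<^sup>2)"
    using sum_squares_bound[of "norm x" "norm y"] by (simp add: power2_sum)
  finally show ?thesis .
qed

text \<open>Comparison with the zero field, at which the forcing reduces to \<open>F\<close> on
  every nonzero mode.\<close>

lemma forcing_growth:
  assumes "u \<in> H" "hnorm a \<beta> u \<le> \<rho>" "finite A"
  shows "(\<Sum>n\<in>A. freq n powr (2 * (\<beta> - 1)) * (norm (forcing \<alpha> u n))\<^sup>2) \<le> growth_const"
proof -
  let ?W = "\<lambda>n. freq n powr (2 * (\<beta> - 1))" and ?z = "\<lambda>n::int^3. 0 :: complex^3"
  have z: "hnorm a \<beta> ?z = 0" by (simp add: hnorm_def)
  have F0: "forcing \<alpha> ?z n = F n" if "n \<noteq> 0" for n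
  proof -
    have "conv ?z ?z n = 0" by (simp add: conv_def)
    then have "B_alpha a \<alpha> ?z ?z n = 0"
      using B_alpha_bound[OF zero_in_sobolev zero_in_sobolev that, of \<alpha>] by simp
    then show ?thesis using norm_coriolis_le[of \<alpha> ?z n] by (simp add: forcing_def)
  qed
  have pt: "?W n * (norm (forcing \<alpha> u n))\<^sup>2
      \<le> 2 * (?W n * (norm (forcing \<alpha> u n - forcing \<alpha> ?z n))\<^sup>2 + ?W n * (norm (F n))\<^sup>2)" for n
  proof (cases "n = 0")
    case False
    have "?W n * (norm (forcing \<alpha> u n))\<^sup>2
      \<le> ?W n * (2 * ((norm (forcing \<alpha> u n - F n))\<^sup>2 + (norm (F n))\<^sup>2))"
      using power2_norm_sum_le[of "forcing \<alpha> u n - F n" "F n"] by (intro mult_left_mono) auto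
    then show ?thesis using F0[OF False] by (simp add: algebra_simps)
  qed simp
  have "(\<Sum>n\<in>A. ?W n * (norm (forcing \<alpha> u n))\<^sup>2) \<le> 2 * ((\<Sum>n\<in>A. ?W n * (norm (forcing \<alpha> u n - forcing \<alpha> ?z n))\<^sup>2)
      + (\<Sum>n\<in>A. ?W n * (norm (F n))\<^sup>2))"
    by (rule order.trans[OF sum_mono[OF pt]]) (simp add: sum.distrib flip: sum_distrib_left)
  also have "\<dots> \<le> 2 * (lip_const * (hdist a \<beta> u ?z)\<^sup>2 + (hnorm a (\<beta> - 1) F)\<^sup>2)"
    using assms z \<rho>_nonneg
    by (intro mult_left_mono add_mono forcing_lipschitz sum_le_hnorm[OF F_smooth] zero_in_sobolev) auto
  also have "\<dots> \<le> growth_const"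
  proof -
    have "lip_const * (hnorm a \<beta> u)\<^sup>2 \<le> lip_const * \<rho>\<^sup>2"
      using assms hnorm_nonneg lip_const_pos by (intro mult_left_mono power_mono) auto
    then show ?thesis by (simp add: growth_const_def hdist_def)
  qed
  finally show ?thesis .
qed

end

section \<open>Energy estimates\<close>

text \<open>The difference has nonpositive derivative on the open interval, where the derivative
  within \<open>{0..}\<close> is two-sided; at 0 only continuity is used.\<close>

lemma deriv_comparison:
  fixes \<phi> \<psi> :: "real \<Rightarrow> real"
  assumes T: "0 \<le> T"
    and \<phi>: "\<And>t. 0 \<le> t \<Longrightarrow> t \<le> T \<Longrightarrow> \<exists>D. (\<phi> has_real_derivative D) (at t within {0..}) \<and> D \<le> \<psi>' t"
    and \<psi>: "\<And>t. (\<psi> has_real_derivative \<psi>' t) (at t)"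
  shows "\<phi> T - \<psi> T \<le> \<phi> 0 - \<psi> 0"
proof (rule DERIV_nonpos_imp_decreasing_open[OF T])
  show "\<exists>y. ((\<lambda>t. \<phi> t - \<psi> t) has_real_derivative y) (at t) \<and> y \<le> 0" if t: "0 < t" "t < T" for t
  proof -
    obtain D where D: "(\<phi> has_real_derivative D) (at t within {0..})" "D \<le> \<psi>' t"
      using \<phi>[of t] t by auto
    have "at t within {0..} = at t" using t by (intro at_within_interior) simp
    then have "((\<lambda>t. \<phi> t - \<psi> t) has_real_derivative (D - \<psi>' t)) (at t)"
      using D(1) \<psi>[of t] by (auto intro!: derivative_intros)
    then show ?thesis using D(2) by (intro exI[of _ "D - \<psi>' t"]) auto
  qed
  show "continuous_on {0..T} (\<lambda>t. \<phi> t - \<psi> t)"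
  proof (intro continuous_on_diff)
    show "continuous_on {0..T} \<phi>"
      unfolding continuous_on_eq_continuous_within
    proof
      fix t assume "t \<in> {0..T}"
      then obtain D where "(\<phi> has_real_derivative D) (at t within {0..})" using \<phi>[of t] by auto
      then show "continuous (at t within {0..T}) \<phi>"
        by (intro continuous_within_subset[OF DERIV_continuous]) auto
    qed
    show "continuous_on {0..T} \<psi>"
      using \<psi> by (intro continuous_at_imp_continuous_on ballI DERIV_isCont) blast
  qed
qed

text \<open>Of the dissipation 2 \<mu> |u|^2, Young's inequality spends one half on the
  source.\<close>

lemma mode_energy:
  fixes u :: "real \<Rightarrow> 'b :: real_inner"
  assumes u: "(u has_vector_derivative g - \<mu> *\<^sub>R u t) (at t within S)" and \<mu>: "0 < \<mu>"
  shows "\<exists>D. ((\<lambda>t. (norm (u t))\<^sup>2) has_real_derivative D) (at t within S)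
    \<and> D \<le> - \<mu> * (norm (u t))\<^sup>2 + (norm g)\<^sup>2 / \<mu>"
proof (intro exI conjI)
  let ?u' = "g - \<mu> *\<^sub>R u t"
  have "(u has_derivative (\<lambda>h. h *\<^sub>R ?u')) (at t within S)"
    using u by (simp add: has_vector_derivative_def)
  from has_derivative_inner[OF this this]
  show "((\<lambda>t. (norm (u t))\<^sup>2) has_real_derivative 2 * (u t \<bullet> ?u')) (at t within S)"
    unfolding has_field_derivative_def power2_norm_eq_inner
    by (rule has_derivative_eq_rhs) (auto simp: fun_eq_iff inner_commute algebra_simps)
  have "2 * (u t \<bullet> ?u') = 2 * (u t \<bullet> g) - 2 * \<mu> * (norm (u t))\<^sup>2"
    by (simp add: inner_diff_right power2_norm_eq_inner)
  moreover have "2 * (u t \<bullet> g) \<le> 2 * (norm (u t) * norm g)" using norm_cauchy_schwarz[of "u t" g] by simp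
  moreover have "2 * (norm (u t) * norm g) \<le> \<mu> * (norm (u t))\<^sup>2 + (norm g)\<^sup>2 / \<mu>"
  proof -
    have "0 \<le> (\<mu> * norm (u t) - norm g)\<^sup>2 / \<mu>" using \<mu> by simp
    also have "\<dots> = \<mu> * (norm (u t))\<^sup>2 + (norm g)\<^sup>2 / \<mu> - 2 * (norm (u t) * norm g)"
      using \<mu> by (simp add: power2_eq_square field_simps)
    finally show ?thesis by simp
  qed
  ultimately show "2 * (u t \<bullet> ?u') \<le> - \<mu> * (norm (u t))\<^sup>2 + (norm g)\<^sup>2 / \<mu>" by linarith
qed

context rotating_nse
begin

definition energy :: "(int ^ 3) set \<Rightarrow> modes \<Rightarrow> real" where
  "energy A w = (\<Sum>n\<in>A. freq n powr (2 * \<beta>) * (norm (w n))\<^sup>2)"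

text \<open>The exponent \<beta> - 1 is what remains of \<beta> after the source has been divided by
  the dissipation rate.\<close>

definition dual_energy :: "(int ^ 3) set \<Rightarrow> modes \<Rightarrow> real" where
  "dual_energy A g = (\<Sum>n\<in>A. freq n powr (2 * (\<beta> - 1)) * (norm (g n))\<^sup>2)"

lemma energy_nonneg: "0 \<le> energy A w"
  by (simp add: energy_def sum_nonneg)

lemma dual_energy_nonneg: "0 \<le> dual_energy A w"
  by (simp add: dual_energy_def sum_nonneg)

lemma energy_le: "w \<in> H \<Longrightarrow> finite A \<Longrightarrow> energy A w \<le> (hnorm a \<beta> w)\<^sup>2"
  unfolding energy_def by (rule sum_le_hnorm)

lemma energy_diff_le:
  assumes "u \<in> H" "v \<in> H" "finite A"
  shows "energy A (\<lambda>n. u n - v n) \<le> (hdist a \<beta> u v)\<^sup>2"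
  unfolding hdist_def by (intro energy_le sobolev_diff assms)

lemma hdist_sq_le:
  assumes "u \<in> H" "v \<in> H" "\<And>A. finite A \<Longrightarrow> energy A (\<lambda>n. u n - v n) \<le> C"
  shows "(hdist a \<beta> u v)\<^sup>2 \<le> C"
  unfolding hdist_def by (rule hnorm_sq_le[OF sobolev_diff[OF assms(1,2)] assms(3)[unfolded energy_def]])

text \<open>Sum of \<open>mode_energy\<close> with weights. Taking \<Lambda> = 0 discards the
  remaining dissipation; mode 0 has weight 0.\<close>

lemma energy_inequality:
  assumes A: "finite A" and t: "0 \<le> t"
    and w: "\<And>n. ((\<lambda>t. w t n) has_vector_derivative g n - (\<nu> * (freq n)\<^sup>2) *\<^sub>R w t n) (at t within {0..})"
    and \<Lambda>: "0 \<le> \<Lambda>" "\<And>n. n \<in> A \<Longrightarrow> \<Lambda> \<le> (freq n)\<^sup>2"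
  shows "\<exists>D. ((\<lambda>t. energy A (w t)) has_real_derivative D) (at t within {0..})
    \<and> D \<le> - \<nu> * \<Lambda> * energy A (w t) + dual_energy A g / \<nu>"
proof -
  let ?W = "\<lambda>n. freq n powr (2 * \<beta>)" and ?V = "\<lambda>n. freq n powr (2 * (\<beta> - 1))"
  have "\<exists>D. ((\<lambda>t. ?W n * (norm (w t n))\<^sup>2) has_real_derivative D) (at t within {0..})
      \<and> D \<le> - \<nu> * \<Lambda> * (?W n * (norm (w t n))\<^sup>2) + ?V n * (norm (g n))\<^sup>2 / \<nu>" if n: "n \<in> A" for n
  proof (cases "n = 0")
    case True
    then show ?thesis by (intro exI[of _ 0]) simp
  next
    case False
    have f: "freq n > 0" by (rule freq_pos[OF False])
    obtain D where D: "((\<lambda>t. (norm (w t n))\<^sup>2) has_real_derivative D) (at t within {0..})"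
      "D \<le> - (\<nu> * (freq n)\<^sup>2) * (norm (w t n))\<^sup>2 + (norm (g n))\<^sup>2 / (\<nu> * (freq n)\<^sup>2)"
      using mode_energy[OF w[of n]] \<nu>_pos f by auto
    have "?W n * D \<le> ?W n * (- (\<nu> * (freq n)\<^sup>2) * (norm (w t n))\<^sup>2 + (norm (g n))\<^sup>2 / (\<nu> * (freq n)\<^sup>2))"
      using D(2) by (rule mult_left_mono) simp
    also have "\<dots> = - (\<nu> * (freq n)\<^sup>2) * (?W n * (norm (w t n))\<^sup>2) + ?W n * (norm (g n))\<^sup>2 / (\<nu> * (freq n)\<^sup>2)"
      by (simp add: algebra_simps)
    also have "?W n * (norm (g n))\<^sup>2 / (\<nu> * (freq n)\<^sup>2) = ?V n * (norm (g n))\<^sup>2 / \<nu>"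
      unfolding weight_split using f by simp
    also have "- (\<nu> * (freq n)\<^sup>2) * (?W n * (norm (w t n))\<^sup>2) \<le> - (\<nu> * \<Lambda>) * (?W n * (norm (w t n))\<^sup>2)"
      using \<Lambda>(2)[OF n] \<nu>_pos by (intro mult_right_mono) auto
    finally have "?W n * D \<le> - \<nu> * \<Lambda> * (?W n * (norm (w t n))\<^sup>2) + ?V n * (norm (g n))\<^sup>2 / \<nu>" by simp
    then show ?thesis using DERIV_cmult[OF D(1), of "?W n"] by blast
  qed
  then obtain D where D: "\<And>n. n \<in> A \<Longrightarrow> ((\<lambda>t. ?W n * (norm (w t n))\<^sup>2) has_real_derivative D n) (at t within {0..})"
    "\<And>n. n \<in> A \<Longrightarrow> D n \<le> - \<nu> * \<Lambda> * (?W n * (norm (w t n))\<^sup>2) + ?V n * (norm (g n))\<^sup>2 / \<nu>"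
    by metis
  show ?thesis
  proof (intro exI[of _ "sum D A"] conjI)
    show "((\<lambda>t. energy A (w t)) has_real_derivative sum D A) (at t within {0..})"
      unfolding energy_def using D(1) by (rule DERIV_sum)
    have "sum D A \<le> (\<Sum>n\<in>A. - \<nu> * \<Lambda> * (?W n * (norm (w t n))\<^sup>2) + ?V n * (norm (g n))\<^sup>2 / \<nu>)"
      using D(2) by (rule sum_mono)
    also have "\<dots> = - \<nu> * \<Lambda> * energy A (w t) + dual_energy A g / \<nu>"
      by (simp only: energy_def dual_energy_def sum.distrib sum_distrib_left[symmetric] sum_divide_distrib[symmetric])
    finally show "sum D A \<le> - \<nu> * \<Lambda> * energy A (w t) + dual_energy A g / \<nu>" .
  qed
qed

text \<open>Integrating factor exp(\<mu> t) with \<mu> = \<nu> \<Lambda>. The source contributes at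
  most G / \<mu>, and the initial energy is damped by exp(-\<mu>).\<close>

lemma energy_tail:
  assumes A: "finite A" and \<Lambda>: "0 < \<Lambda>" "\<And>n. n \<in> A \<Longrightarrow> \<Lambda> \<le> (freq n)\<^sup>2"
    and w: "\<And>n t. 0 \<le> t \<Longrightarrow>
      ((\<lambda>t. w t n) has_vector_derivative g t n - (\<nu> * (freq n)\<^sup>2) *\<^sub>R w t n) (at t within {0..})"
    and G: "\<And>t. 0 \<le> t \<Longrightarrow> t \<le> 1 \<Longrightarrow> dual_energy A (g t) / \<nu> \<le> G"
  shows "energy A (w 1) \<le> (energy A (w 0) + G) / (\<nu> * \<Lambda>)"
proof -
  define \<mu> where "\<mu> = \<nu> * \<Lambda>"
  have \<mu>: "\<mu> > 0" using \<nu>_pos \<Lambda> by (simp add: \<mu>_def)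
  have G0: "0 \<le> G" using G[of 0] dual_energy_nonneg[of A "g 0"] \<nu>_pos
    by (meson divide_nonneg_pos order.trans order_refl zero_le_one)
  define Q where "Q = G / \<mu>"
  have Q: "0 \<le> Q" "\<mu> * Q = G" using G0 \<mu> by (simp_all add: Q_def)
  let ?\<phi> = "\<lambda>t. exp (\<mu> * t) * energy A (w t)" and ?\<psi> = "\<lambda>t. exp (\<mu> * t) * Q"
  have "?\<phi> 1 - ?\<psi> 1 \<le> ?\<phi> 0 - ?\<psi> 0"
  proof (rule deriv_comparison)
    fix t :: real assume t: "0 \<le> t" "t \<le> 1"
    obtain D where D: "((\<lambda>t. energy A (w t)) has_real_derivative D) (at t within {0..})"
      "D \<le> - \<nu> * \<Lambda> * energy A (w t) + dual_energy A (g t) / \<nu>"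
      using energy_inequality[OF A t(1) w[OF t(1)], of \<Lambda>] \<Lambda> by auto
    have "((\<lambda>t. exp (\<mu> * t) * energy A (w t)) has_real_derivative
        exp (\<mu> * t) * (\<mu> * energy A (w t) + D)) (at t within {0..})"
      using D(1) by (auto intro!: derivative_eq_intros simp: algebra_simps)
    moreover have "\<mu> * energy A (w t) + D \<le> G" using D(2) G[OF t] by (simp add: \<mu>_def)
    ultimately show "\<exists>D. ((\<lambda>t. exp (\<mu> * t) * energy A (w t)) has_real_derivative D) (at t within {0..})
        \<and> D \<le> exp (\<mu> * t) * G"
      by (meson exp_ge_zero mult_left_mono)
  next
    show "(?\<psi> has_real_derivative exp (\<mu> * t) * G) (at t)" for t
      using Q(2) by (auto intro!: derivative_eq_intros)
  qed simp
  then have "exp \<mu> * energy A (w 1) \<le> exp \<mu> * Q + energy A (w 0)" using Q(1) by simp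
  then have "energy A (w 1) \<le> Q + exp (- \<mu>) * energy A (w 0)"
    by (simp add: exp_minus field_simps)
  \<comment> \<open>Exponential damping is weakened to 1 / \<mu>, so that both contributions have
    order 1 / \<Lambda>.\<close>
  also have "exp (- \<mu>) * energy A (w 0) \<le> (1 / \<mu>) * energy A (w 0)"
  proof (intro mult_right_mono energy_nonneg)
    have "\<mu> \<le> exp \<mu>" using exp_ge_add_one_self[of \<mu>] by linarith
    then show "exp (- \<mu>) \<le> 1 / \<mu>" using \<mu> by (simp add: exp_minus field_simps)
  qed
  finally show ?thesis unfolding Q_def \<mu>_def by (simp add: add_divide_distrib)
qed

section \<open>Bounded orbits: dependence on the data, squeezing, continuity in time\<close>

definition orbit :: "real \<Rightarrow> (real \<Rightarrow> modes) \<Rightarrow> bool" where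
  "orbit \<alpha> u \<longleftrightarrow> (\<forall>t\<ge>0. u t \<in> H \<and> hnorm a \<beta> (u t) \<le> \<rho>)
    \<and> (\<forall>n. \<forall>t\<ge>0. ((\<lambda>t. u t n) has_vector_derivative
          forcing \<alpha> (u t) n - (\<nu> * (freq n)\<^sup>2) *\<^sub>R u t n) (at t within {0..}))"

lemma orbitD:
  assumes "orbit \<alpha> u" "0 \<le> t"
  shows "u t \<in> H" "hnorm a \<beta> (u t) \<le> \<rho>"
    "((\<lambda>t. u t n) has_vector_derivative forcing \<alpha> (u t) n - (\<nu> * (freq n)\<^sup>2) *\<^sub>R u t n) (at t within {0..})"
  using assms by (auto simp: orbit_def)

lemma orbit_shift:
  assumes u: "orbit \<alpha> u" and s: "0 \<le> s"
  shows "orbit \<alpha> (\<lambda>t. u (s + t))"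
  unfolding orbit_def
proof (intro conjI allI impI)
  fix n and t :: real assume t: "0 \<le> t"
  have "((\<lambda>t. s + t) has_vector_derivative 1) (at t within {0..})"
    by (auto intro!: derivative_eq_intros)
  moreover have "((\<lambda>t. u t n) has_vector_derivative forcing \<alpha> (u (s + t)) n - (\<nu> * (freq n)\<^sup>2) *\<^sub>R u (s + t) n)
      (at (s + t) within (\<lambda>t. s + t) ` {0..})"
    using s t by (intro has_vector_derivative_within_subset[OF orbitD(3)[OF u]]) auto
  ultimately show "((\<lambda>t. u (s + t) n) has_vector_derivative
      forcing \<alpha> (u (s + t)) n - (\<nu> * (freq n)\<^sup>2) *\<^sub>R u (s + t) n) (at t within {0..})"
    using vector_diff_chain_within[of "\<lambda>t. s + t" 1 t "{0..}" "\<lambda>t. u t n"] by (simp add: o_def)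
qed (use u s in \<open>auto simp: orbit_def\<close>)

lemma orbit_diff_derivative:
  assumes "orbit \<alpha> u" "orbit \<alpha> v" "0 \<le> t"
  shows "((\<lambda>t. u t n - v t n) has_vector_derivative
    (forcing \<alpha> (u t) n - forcing \<alpha> (v t) n) - (\<nu> * (freq n)\<^sup>2) *\<^sub>R (u t n - v t n)) (at t within {0..})"
  using has_vector_derivative_diff[OF orbitD(3)[OF assms(1,3)] orbitD(3)[OF assms(2,3)], of n n]
  by (simp add: algebra_simps)

definition rate :: real where "rate = lip_const / \<nu>"

lemma rate_pos: "0 < rate"
  using lip_const_pos \<nu>_pos by (simp add: rate_def)

lemma hdist_nonneg: "0 \<le> hdist a s u v"
  by (simp add: hdist_def hnorm_nonneg)

lemma hdist_le_2\<rho>: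
  assumes "u \<in> H" "v \<in> H" "hnorm a \<beta> u \<le> \<rho>" "hnorm a \<beta> v \<le> \<rho>"
  shows "hdist a \<beta> u v \<le> 2 * \<rho>"
proof -
  have "hdist a \<beta> u v \<le> hdist a \<beta> u (\<lambda>n. 0) + hdist a \<beta> (\<lambda>n. 0) v"
    by (intro hdist_triangle[where bc = bc] assms zero_in_sobolev)
  then show ?thesis using assms by (simp add: hdist_def hnorm_def)
qed

lemma dual_energy_forcing_diff:
  assumes "orbit \<alpha> u" "orbit \<alpha> v" "0 \<le> t" "finite A"
  shows "dual_energy A (\<lambda>n. forcing \<alpha> (u t) n - forcing \<alpha> (v t) n) / \<nu> \<le> rate * (hdist a \<beta> (u t) (v t))\<^sup>2"
proof -
  have "dual_energy A (\<lambda>n. forcing \<alpha> (u t) n - forcing \<alpha> (v t) n) \<le> lip_const * (hdist a \<beta> (u t) (v t))\<^sup>2"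
    unfolding dual_energy_def using assms by (intro forcing_lipschitz) (auto dest: orbitD(1,2))
  then show ?thesis using \<nu>_pos by (simp add: rate_def divide_right_mono)
qed

text \<open>
  Gronwall's inequality is avoided: the energy inequality is integrated against the supremum of
  \<open>exp (-2 rate t) (hdist (u t) (v t))\<^sup>2\<close> over \<open>[0, T]\<close>, which is finite as orbits are bounded, and
  reproduces half of this supremum.
\<close>

lemma orbit_lipschitz:
  assumes u: "orbit \<alpha> u" and v: "orbit \<alpha> v" and T: "0 \<le> T"
  shows "(hdist a \<beta> (u T) (v T))\<^sup>2 \<le> 2 * exp (2 * rate * T) * (hdist a \<beta> (u 0) (v 0))\<^sup>2"
proof -
  define m where "m t = exp (- (2 * rate * t)) * (hdist a \<beta> (u t) (v t))\<^sup>2" for t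
  define B where "B = (SUP t\<in>{0..T}. m t)"
  define D0 where "D0 = (hdist a \<beta> (u 0) (v 0))\<^sup>2"
  have "m t \<le> 1 * (2 * \<rho>)\<^sup>2" if "t \<in> {0..T}" for t
    unfolding m_def using that u v rate_pos
    by (intro mult_mono power_mono hdist_le_2\<rho> hdist_nonneg) (auto dest: orbitD(1,2))
  then have bdd: "bdd_above (m ` {0..T})" by (rule bdd_aboveI2)
  have mB: "m t \<le> B" if "t \<in> {0..T}" for t
    unfolding B_def by (rule cSUP_upper[OF that bdd])
  have "0 \<le> m 0" by (simp add: m_def)
  then have B0: "0 \<le> B" using mB[of 0] T by simp
  have dB: "(hdist a \<beta> (u t) (v t))\<^sup>2 \<le> B * exp (2 * rate * t)" if "t \<in> {0..T}" for t
    using mB[OF that] by (simp add: m_def exp_minus field_simps)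
  have "m t \<le> D0 + B / 2" if t: "t \<in> {0..T}" for t
  proof -
    have "(hdist a \<beta> (u t) (v t))\<^sup>2 \<le> D0 + B / 2 * exp (2 * rate * t)"
    proof (rule hdist_sq_le)
      fix A :: "(int ^ 3) set" assume A: "finite A"
      let ?\<phi> = "\<lambda>t. energy A (\<lambda>n. u t n - v t n)" and ?\<psi> = "\<lambda>t. B / 2 * exp (2 * rate * t)"
      have "?\<phi> t - ?\<psi> t \<le> ?\<phi> 0 - ?\<psi> 0"
      proof (rule deriv_comparison)
        fix s assume s: "0 \<le> s" "s \<le> t"
        obtain D where D: "(?\<phi> has_real_derivative D) (at s within {0..})"
          "D \<le> dual_energy A (\<lambda>n. forcing \<alpha> (u s) n - forcing \<alpha> (v s) n) / \<nu>"
          using energy_inequality[OF A s(1) orbit_diff_derivative[OF u v s(1)], of 0] by auto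
        note D(2)
        also have "dual_energy A (\<lambda>n. forcing \<alpha> (u s) n - forcing \<alpha> (v s) n) / \<nu>
            \<le> rate * (hdist a \<beta> (u s) (v s))\<^sup>2"
          by (rule dual_energy_forcing_diff[OF u v s(1) A])
        also have "\<dots> \<le> rate * (B * exp (2 * rate * s))"
          using dB[of s] s t rate_pos by (intro mult_left_mono) auto
        finally show "\<exists>D. (?\<phi> has_real_derivative D) (at s within {0..}) \<and> D \<le> rate * (B * exp (2 * rate * s))"
          using D(1) by blast
      next
        show "(?\<psi> has_real_derivative rate * (B * exp (2 * rate * s))) (at s)" for s
          by (auto intro!: derivative_eq_intros)
      qed (use t in auto)
      moreover have "?\<phi> 0 \<le> D0"
        unfolding D0_def using u v A by (intro energy_diff_le) (auto dest: orbitD(1,2))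
      ultimately show "?\<phi> t \<le> D0 + ?\<psi> t" using B0 by simp
    qed (use t u v in \<open>auto dest: orbitD(1,2)\<close>)
    then have "m t \<le> exp (- (2 * rate * t)) * (D0 + B / 2 * exp (2 * rate * t))"
      unfolding m_def by (rule mult_left_mono) simp
    also have "\<dots> = exp (- (2 * rate * t)) * D0 + B / 2" by (simp add: distrib_left exp_minus)
    also have "\<dots> \<le> 1 * D0 + B / 2"
      using t rate_pos by (intro add_mono mult_right_mono) (auto simp: D0_def)
    finally show ?thesis by simp
  qed
  then have "B \<le> D0 + B / 2" unfolding B_def using T by (intro cSUP_least) auto
  then have "B * exp (2 * rate * T) \<le> 2 * D0 * exp (2 * rate * T)" by (intro mult_right_mono) auto
  then have "(hdist a \<beta> (u T) (v T))\<^sup>2 \<le> 2 * D0 * exp (2 * rate * T)"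
    using dB[of T] T by (meson atLeastAtMost_iff order.refl order.trans)
  then show ?thesis by (simp add: D0_def mult_ac)
qed

definition squeeze_const :: real where
  "squeeze_const = (1 + 2 * rate * exp (2 * rate)) / \<nu>"

lemma squeeze_const_pos: "0 < squeeze_const"
  unfolding squeeze_const_def using rate_pos \<nu>_pos by (intro divide_pos_pos add_pos_nonneg) auto

text \<open>\<open>energy_tail\<close> for the difference, whose source up to time 1 is controlled
  by the initial distance through \<open>orbit_lipschitz\<close>.\<close>

lemma orbit_squeezing:
  assumes u: "orbit \<alpha> u" and v: "orbit \<alpha> v" and A: "finite A"
    and \<Lambda>: "0 < \<Lambda>" "\<And>n. n \<in> A \<Longrightarrow> \<Lambda> \<le> (freq n)\<^sup>2"
  shows "energy A (\<lambda>n. u 1 n - v 1 n) \<le> squeeze_const / \<Lambda> * (hdist a \<beta> (u 0) (v 0))\<^sup>2"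
proof -
  let ?D0 = "(hdist a \<beta> (u 0) (v 0))\<^sup>2"
  have "energy A (\<lambda>n. u 1 n - v 1 n)
      \<le> (energy A (\<lambda>n. u 0 n - v 0 n) + 2 * rate * exp (2 * rate) * ?D0) / (\<nu> * \<Lambda>)"
  proof (rule energy_tail[OF A \<Lambda>, where g = "\<lambda>t n. forcing \<alpha> (u t) n - forcing \<alpha> (v t) n"])
    fix t :: real assume t: "0 \<le> t" "t \<le> 1"
    have "(hdist a \<beta> (u t) (v t))\<^sup>2 \<le> 2 * exp (2 * rate * t) * ?D0" by (rule orbit_lipschitz[OF u v t(1)])
    also have "\<dots> \<le> 2 * exp (2 * rate) * ?D0" using t rate_pos by (intro mult_right_mono) auto
    finally have "rate * (hdist a \<beta> (u t) (v t))\<^sup>2 \<le> rate * (2 * exp (2 * rate) * ?D0)"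
      using rate_pos by (intro mult_left_mono) auto
    then show "dual_energy A (\<lambda>n. forcing \<alpha> (u t) n - forcing \<alpha> (v t) n) / \<nu> \<le> 2 * rate * exp (2 * rate) * ?D0"
      using dual_energy_forcing_diff[OF u v t(1) A] by (simp add: mult_ac)
  qed (use orbit_diff_derivative[OF u v] in auto)
  also have "\<dots> \<le> (?D0 + 2 * rate * exp (2 * rate) * ?D0) / (\<nu> * \<Lambda>)"
    using \<nu>_pos \<Lambda>(1) A u v by (intro divide_right_mono add_right_mono energy_diff_le) (auto dest: orbitD(1,2))
  also have "\<dots> = squeeze_const / \<Lambda> * ?D0" by (simp add: squeeze_const_def add_divide_distrib algebra_simps)
  finally show ?thesis .
qed

definition tail_const :: real where
  "tail_const = (\<rho>\<^sup>2 + growth_const / \<nu>) / \<nu>"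

lemma dual_energy_forcing:
  assumes "orbit \<alpha> u" "0 \<le> t" "finite A"
  shows "dual_energy A (forcing \<alpha> (u t)) \<le> growth_const"
  unfolding dual_energy_def using assms by (intro forcing_growth) (auto dest: orbitD(1,2))

text \<open>\<open>energy_tail\<close> on the unit interval ending at t, which is why t \<ge> 1 is
  assumed.\<close>

lemma orbit_tail:
  assumes u: "orbit \<alpha> u" and A: "finite A" and t: "1 \<le> t"
    and \<Lambda>: "0 < \<Lambda>" "\<And>n. n \<in> A \<Longrightarrow> \<Lambda> \<le> (freq n)\<^sup>2"
  shows "energy A (u t) \<le> tail_const / \<Lambda>"
proof -
  have v: "orbit \<alpha> (\<lambda>s. u (t - 1 + s))" using u t by (intro orbit_shift) auto
  have "energy A (u (t - 1 + 1)) \<le> (energy A (u (t - 1 + 0)) + growth_const / \<nu>) / (\<nu> * \<Lambda>)"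
    by (rule energy_tail[OF A \<Lambda> orbitD(3)[OF v]])
      (use \<nu>_pos dual_energy_forcing[OF v _ A] in \<open>auto intro: divide_right_mono\<close>)
  also have "\<dots> \<le> (\<rho>\<^sup>2 + growth_const / \<nu>) / (\<nu> * \<Lambda>)"
  proof -
    have "energy A (u (t - 1 + 0)) \<le> (hnorm a \<beta> (u (t - 1 + 0)))\<^sup>2" using orbitD[OF v order.refl] A by (intro energy_le) auto
    also have "\<dots> \<le> \<rho>\<^sup>2" using orbitD[OF v order.refl] by (intro power_mono hnorm_nonneg) auto
    finally show ?thesis using \<nu>_pos \<Lambda>(1) by (intro divide_right_mono add_right_mono) auto
  qed
  finally show ?thesis by (simp add: tail_const_def)
qed

text \<open>The increment \<open>u t - u 0\<close> solves the same heat equation with the additional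
  source -\<nu> |n|^2 \<open>u 0\<close>; on modes below \<Lambda> its dual energy is at most
  \<nu>^2 \<Lambda> \<rho>^2.\<close>

lemma orbit_low_modes:
  assumes u: "orbit \<alpha> u" and A: "finite A" and h: "0 \<le> h"
    and \<Lambda>: "\<And>n. n \<in> A \<Longrightarrow> (freq n)\<^sup>2 \<le> \<Lambda>" "0 \<le> \<Lambda>"
  shows "energy A (\<lambda>n. u h n - u 0 n) \<le> h * (2 * (growth_const + \<nu>\<^sup>2 * \<Lambda> * \<rho>\<^sup>2) / \<nu>)"
proof -
  define g where "g t n = forcing \<alpha> (u t) n - (\<nu> * (freq n)\<^sup>2) *\<^sub>R u 0 n" for t n
  let ?G = "2 * (growth_const + \<nu>\<^sup>2 * \<Lambda> * \<rho>\<^sup>2)"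
  have dw: "((\<lambda>t. u t n - u 0 n) has_vector_derivative g t n - (\<nu> * (freq n)\<^sup>2) *\<^sub>R (u t n - u 0 n)) (at t within {0..})"
    if "0 \<le> t" for n t
    using has_vector_derivative_diff[OF orbitD(3)[OF u that, of n] has_vector_derivative_const[of "u 0 n"]]
    by (simp add: g_def algebra_simps)
  have G: "dual_energy A (g t) \<le> ?G" if t: "0 \<le> t" for t
  proof -
    let ?V = "\<lambda>n. freq n powr (2 * (\<beta> - 1))"
    have pt: "?V n * (norm (g t n))\<^sup>2 \<le> 2 * (?V n * (norm (forcing \<alpha> (u t) n))\<^sup>2
        + \<nu>\<^sup>2 * \<Lambda> * (freq n powr (2 * \<beta>) * (norm (u 0 n))\<^sup>2))" if n: "n \<in> A" for n
    proof -
      have "?V n * (norm (g t n))\<^sup>2 \<le> ?V n * (2 * ((norm (forcing \<alpha> (u t) n))\<^sup>2 + (\<nu> * (freq n)\<^sup>2 * norm (u 0 n))\<^sup>2))"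
        using power2_norm_sum_le[of "forcing \<alpha> (u t) n" "- ((\<nu> * (freq n)\<^sup>2) *\<^sub>R u 0 n)"] \<nu>_pos
        by (intro mult_left_mono) (auto simp: g_def)
      also have "\<dots> = 2 * (?V n * (norm (forcing \<alpha> (u t) n))\<^sup>2
          + \<nu>\<^sup>2 * (freq n)\<^sup>2 * (freq n powr (2 * \<beta>) * (norm (u 0 n))\<^sup>2))"
        unfolding weight_split power_mult_distrib by (simp add: power2_eq_square algebra_simps)
      also have "\<dots> \<le> 2 * (?V n * (norm (forcing \<alpha> (u t) n))\<^sup>2
          + \<nu>\<^sup>2 * \<Lambda> * (freq n powr (2 * \<beta>) * (norm (u 0 n))\<^sup>2))"
        using \<Lambda>(1)[OF n] by (intro mult_left_mono add_left_mono mult_right_mono) auto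
      finally show ?thesis .
    qed
    have "dual_energy A (g t) \<le> 2 * (dual_energy A (forcing \<alpha> (u t)) + \<nu>\<^sup>2 * \<Lambda> * energy A (u 0))"
      unfolding dual_energy_def energy_def
      by (rule order.trans[OF sum_mono[OF pt]]) (simp_all add: sum.distrib flip: sum_distrib_left)
    also have "\<dots> \<le> ?G"
    proof (intro mult_left_mono add_mono dual_energy_forcing[OF u t A])
      have "energy A (u 0) \<le> (hnorm a \<beta> (u 0))\<^sup>2" using orbitD[OF u order.refl] A by (intro energy_le) auto
      also have "\<dots> \<le> \<rho>\<^sup>2" using orbitD[OF u order.refl] by (intro power_mono hnorm_nonneg) auto
      finally show "energy A (u 0) \<le> \<rho>\<^sup>2" .
    qed (use \<Lambda>(2) in auto)
    finally show ?thesis .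
  qed
  have "energy A (\<lambda>n. u h n - u 0 n) - h * (?G / \<nu>) \<le> energy A (\<lambda>n. u 0 n - u 0 n) - 0 * (?G / \<nu>)"
  proof (rule deriv_comparison[OF h, where \<psi>' = "\<lambda>_. ?G / \<nu>"])
    fix t assume t: "0 \<le> t" "t \<le> h"
    obtain D where D: "((\<lambda>t. energy A (\<lambda>n. u t n - u 0 n)) has_real_derivative D) (at t within {0..})"
      "D \<le> dual_energy A (g t) / \<nu>"
      using energy_inequality[OF A t(1) dw[OF t(1)], of 0] by auto
    then show "\<exists>D. ((\<lambda>t. energy A (\<lambda>n. u t n - u 0 n)) has_real_derivative D) (at t within {0..}) \<and> D \<le> ?G / \<nu>"
      using divide_right_mono[OF G[OF t(1)], of \<nu>] \<nu>_pos by (intro exI[of _ D]) auto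
  qed (use \<nu>_pos in \<open>auto intro!: derivative_eq_intros\<close>)
  then show ?thesis by (simp add: energy_def)
qed

lemma energy_split: "finite A \<Longrightarrow> energy A w = energy {n \<in> A. P n} w + energy {n \<in> A. \<not> P n} w"
  unfolding energy_def by (subst sum.union_disjoint[symmetric]) (auto intro: sum.cong)

lemma energy_diff_tail:
  "energy A (\<lambda>n. u n - v n) \<le> 2 * (energy A u + energy A v)"
proof -
  have "freq n powr (2 * \<beta>) * (norm (u n - v n))\<^sup>2
      \<le> 2 * (freq n powr (2 * \<beta>) * (norm (u n))\<^sup>2 + freq n powr (2 * \<beta>) * (norm (v n))\<^sup>2)" for n
    using mult_left_mono[OF power2_norm_sum_le[of "u n" "- v n"], of "freq n powr (2 * \<beta>)"]
    by (simp add: algebra_simps)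
  then show ?thesis
    unfolding energy_def sum_distrib_left sum.distrib[symmetric] by (rule sum_mono)
qed

text \<open>Low modes move by O((t - s)(1 + \<Lambda>)) in squared norm, high modes are small at
  both times. Balancing \<Lambda> against t - s yields exponent 1/4.\<close>

lemma orbit_time_modulus:
  assumes u: "orbit \<alpha> u" and s: "1 \<le> s" "s \<le> t" and \<Lambda>: "0 < \<Lambda>"
  shows "(hdist a \<beta> (u t) (u s))\<^sup>2
    \<le> (t - s) * (2 * (growth_const + \<nu>\<^sup>2 * \<Lambda> * \<rho>\<^sup>2) / \<nu>) + 4 * (tail_const / \<Lambda>)"
proof (rule hdist_sq_le)
  fix A :: "(int ^ 3) set" assume A: "finite A"
  let ?L = "{n \<in> A. (freq n)\<^sup>2 \<le> \<Lambda>}" and ?T = "{n \<in> A. \<not> (freq n)\<^sup>2 \<le> \<Lambda>}"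
  have v: "orbit \<alpha> (\<lambda>r. u (s + r))" using u s by (intro orbit_shift) auto
  have "energy ?L (\<lambda>n. u (s + (t - s)) n - u (s + 0) n) \<le> (t - s) * (2 * (growth_const + \<nu>\<^sup>2 * \<Lambda> * \<rho>\<^sup>2) / \<nu>)"
    using A s \<Lambda> by (intro orbit_low_modes[OF v]) auto
  moreover have "energy ?T (\<lambda>n. u t n - u s n) \<le> 2 * (tail_const / \<Lambda> + tail_const / \<Lambda>)"
    using A s \<Lambda> by (intro order.trans[OF energy_diff_tail] mult_left_mono add_mono orbit_tail[OF u]) auto
  ultimately show "energy A (\<lambda>n. u t n - u s n)
      \<le> (t - s) * (2 * (growth_const + \<nu>\<^sup>2 * \<Lambda> * \<rho>\<^sup>2) / \<nu>) + 4 * (tail_const / \<Lambda>)"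
    unfolding energy_split[OF A, of _ "\<lambda>n. (freq n)\<^sup>2 \<le> \<Lambda>"] by simp
qed (use orbitD(1)[OF u] s in auto)

end

section \<open>The semiflow on the absorbing set\<close>

context rotating_nse
begin

abbreviation flow :: "real \<Rightarrow> real \<Rightarrow> modes \<Rightarrow> modes" where
  "flow \<alpha> \<equiv> semiflow bc a \<nu> F f \<alpha> \<beta>"

definition phase_space :: "real \<Rightarrow> modes set \<Rightarrow> bool" where
  "phase_space \<alpha> X \<longleftrightarrow> compactin (sobolev_topology bc a \<beta>) X \<and> X \<noteq> {}
     \<and> (\<forall>x\<in>X. hnorm a \<beta> x \<le> \<rho> \<and> uniquely_solvable bc a \<nu> F f \<alpha> \<beta> x)
     \<and> (\<forall>t\<ge>0. flow \<alpha> t ` X \<subseteq> X)"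

lemma metric_H: "Metric_space H (hdist a \<beta>)"
  by (rule Metric_space_sobolev[OF a_pos])

text \<open>Uniqueness turns the definite description in \<open>semiflow\<close> into the value of
  any solution, but only for t \<ge> 0; hence the transfers of continuity and derivatives within
  \<open>{0..}\<close>.\<close>

lemma phase_space_flow:
  assumes X: "phase_space \<alpha> X" and x: "x \<in> X"
  shows "orbit \<alpha> (\<lambda>t. flow \<alpha> t x)" "flow \<alpha> 0 x = x"
    "continuous_map (top_of_set {0..}) (sobolev_topology bc a \<beta>) (\<lambda>t. flow \<alpha> t x)"
proof -
  have us: "uniquely_solvable bc a \<nu> F f \<alpha> \<beta> x" using X x by (auto simp: phase_space_def)
  then obtain V where V: "regular_solution bc a \<nu> F f \<alpha> \<beta> x V" by (auto simp: uniquely_solvable_def)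
  have eq: "flow \<alpha> t x = V t" if "0 \<le> t" for t
    unfolding semiflow_def
  proof (rule the_equality)
    fix v assume "\<exists>W. regular_solution bc a \<nu> F f \<alpha> \<beta> x W \<and> W t = v"
    then show "v = V t" using us V that unfolding uniquely_solvable_def by metis
  qed (use V in blast)
  have cont: "continuous_map (top_of_set {0..}) (sobolev_topology bc a \<beta>) V"
    and V0: "V 0 = x" using V by (auto simp: regular_solution_def)
  show "flow \<alpha> 0 x = x" using eq V0 by simp
  show "continuous_map (top_of_set {0..}) (sobolev_topology bc a \<beta>) (\<lambda>t. flow \<alpha> t x)"
    by (rule continuous_map_eq[OF cont]) (simp add: eq)
  have VH: "V t \<in> H" if "0 \<le> t" for t
    using continuous_map_image_subset_topspace[OF cont] that Metric_space.topspace_mtopology[OF metric_H]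
    by auto
  show "orbit \<alpha> (\<lambda>t. flow \<alpha> t x)"
    unfolding orbit_def
  proof (intro conjI allI impI)
    fix t :: real assume t: "0 \<le> t"
    show "flow \<alpha> t x \<in> H" using VH eq t by simp
    have "flow \<alpha> t x \<in> X" using X x t by (auto simp: phase_space_def)
    then show "hnorm a \<beta> (flow \<alpha> t x) \<le> \<rho>" using X by (simp add: phase_space_def)
  next
    fix n and t :: real assume t: "0 \<le> t"
    have "((\<lambda>t. V t n) has_vector_derivative
        F n - f *\<^sub>R leray a (rot (leray a (helmholtz_inv a \<alpha> (V t)))) n
          - \<nu> *\<^sub>R stokes a (V t) n - B_alpha a \<alpha> (V t) (V t) n) (at t within {0..})"
      using V t by (simp add: regular_solution_def)
    also have "F n - f *\<^sub>R leray a (rot (leray a (helmholtz_inv a \<alpha> (V t)))) n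
          - \<nu> *\<^sub>R stokes a (V t) n - B_alpha a \<alpha> (V t) (V t) n
        = forcing \<alpha> (V t) n - (\<nu> * (freq n)\<^sup>2) *\<^sub>R V t n"
      by (simp add: forcing_def stokes_eq[OF VH[OF t]])
    finally have "((\<lambda>t. V t n) has_vector_derivative
        forcing \<alpha> (V t) n - (\<nu> * (freq n)\<^sup>2) *\<^sub>R V t n) (at t within {0..})" .
    then show "((\<lambda>t. flow \<alpha> t x n) has_vector_derivative
        forcing \<alpha> (flow \<alpha> t x) n - (\<nu> * (freq n)\<^sup>2) *\<^sub>R flow \<alpha> t x n) (at t within {0..})"
      unfolding eq[OF t]
      by (rule has_vector_derivative_transform[rotated 2]) (use t eq in auto)
  qed
qed

lemma phase_space_subset:
  assumes "phase_space \<alpha> X"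
  shows "X \<subseteq> H"
proof -
  have "X \<subseteq> topspace (sobolev_topology bc a \<beta>)"
    using assms by (intro compactin_subset_topspace) (simp add: phase_space_def)
  then show ?thesis using Metric_space.topspace_mtopology[OF metric_H] by simp
qed

definition lip_factor :: real where "lip_factor = 2 * exp (2 * rate)"

lemma flow_lipschitz:
  assumes X: "phase_space \<alpha> X" and "x \<in> X" "y \<in> X" "0 \<le> t" "t \<le> 1"
  shows "hdist a \<beta> (flow \<alpha> t x) (flow \<alpha> t y) \<le> lip_factor * hdist a \<beta> x y"
proof (rule power2_le_imp_le)
  have "(hdist a \<beta> (flow \<alpha> t x) (flow \<alpha> t y))\<^sup>2 \<le> 2 * exp (2 * rate * t) * (hdist a \<beta> x y)\<^sup>2"
    using orbit_lipschitz[OF phase_space_flow(1)[OF X assms(2)] phase_space_flow(1)[OF X assms(3)] assms(4)]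
      phase_space_flow(2)[OF X] assms by simp
  also have "\<dots> \<le> lip_factor\<^sup>2 * (hdist a \<beta> x y)\<^sup>2"
  proof (intro mult_right_mono)
    have "2 * exp (2 * rate * t) \<le> lip_factor"
      unfolding lip_factor_def using assms rate_pos by simp
    \<comment> \<open>Since the factor is at least 1, its square may replace the square root in the
      Lipschitz constant.\<close>
    also have "lip_factor \<le> lip_factor\<^sup>2"
      unfolding lip_factor_def using rate_pos by (intro self_le_power) (auto intro: order.trans[of 1 2] one_le_exp_iff[THEN iffD2])
    finally show "2 * exp (2 * rate * t) \<le> lip_factor\<^sup>2" .
  qed simp
  finally show "(hdist a \<beta> (flow \<alpha> t x) (flow \<alpha> t y))\<^sup>2 \<le> (lip_factor * hdist a \<beta> x y)\<^sup>2"
    by (simp add: power_mult_distrib)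
qed (simp add: lip_factor_def hdist_nonneg)

text \<open>Both sides, as functions of s, are orbits from the same point;
  \<open>orbit_lipschitz\<close> with initial distance 0 identifies them.\<close>

lemma flow_add:
  assumes X: "phase_space \<alpha> X" and x: "x \<in> X" and s: "0 \<le> s" and t: "0 \<le> t"
  shows "flow \<alpha> (s + t) x = flow \<alpha> s (flow \<alpha> t x)"
proof -
  let ?y = "flow \<alpha> t x"
  have y: "?y \<in> X" using X x t by (auto simp: phase_space_def)
  have 1: "orbit \<alpha> (\<lambda>r. flow \<alpha> (t + r) x)" by (rule orbit_shift[OF phase_space_flow(1)[OF X x] t])
  have 2: "orbit \<alpha> (\<lambda>r. flow \<alpha> r ?y)" by (rule phase_space_flow(1)[OF X y])
  have "(hdist a \<beta> (flow \<alpha> (t + s) x) (flow \<alpha> s ?y))\<^sup>2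
      \<le> 2 * exp (2 * rate * s) * (hdist a \<beta> (flow \<alpha> (t + 0) x) (flow \<alpha> 0 ?y))\<^sup>2"
    by (rule orbit_lipschitz[OF 1 2 s])
  also have "hdist a \<beta> (flow \<alpha> (t + 0) x) (flow \<alpha> 0 ?y) = 0"
    using phase_space_flow(2)[OF X y] by (simp add: hdist_def hnorm_def)
  finally have "hdist a \<beta> (flow \<alpha> (t + s) x) (flow \<alpha> s ?y) = 0" by simp
  then show ?thesis
    using hdist_eq_0_iff[OF a_pos orbitD(1)[OF 1 s] orbitD(1)[OF 2 s]] by (simp add: add.commute)
qed

lemma flow_time_modulus:
  "\<exists>q>0. \<forall>\<alpha> X x s t k. phase_space \<alpha> X \<longrightarrow> x \<in> X \<longrightarrow> 1 \<le> s \<longrightarrow> 1 \<le> t \<longrightarrow>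
     \<bar>s - t\<bar> \<le> 1 / (real q * 16 ^ k) \<longrightarrow> hdist a \<beta> (flow \<alpha> s x) (flow \<alpha> t x) \<le> 1 / 2 ^ k"
proof -
  \<comment> \<open>With \<Lambda> = c 4^k the high modes contribute at most half of 4^(-k), and
    \<open>q\<close> below is chosen so that the low modes contribute at most the other
    half.\<close>
  define c where "c = 8 * tail_const + 1"
  define G where "G = 2 * (growth_const + \<nu>\<^sup>2 * c * \<rho>\<^sup>2) / \<nu>"
  define q where "q = nat \<lceil>2 * G\<rceil> + 1"
  have tail: "0 \<le> tail_const"
    unfolding tail_const_def using \<nu>_pos growth_const_pos by (intro divide_nonneg_pos add_nonneg_nonneg) auto
  have c: "c > 0" using tail by (simp add: c_def)
  have G: "0 \<le> G"
    unfolding G_def using growth_const_pos c \<nu>_pos by (intro divide_nonneg_pos mult_nonneg_nonneg add_nonneg_nonneg) auto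
  have q: "2 * G \<le> real q" "0 < q" unfolding q_def by (simp_all, linarith)
  have *: "hdist a \<beta> (u t) (u s) \<le> 1 / 2 ^ k"
    if u: "orbit \<alpha> u" and s: "1 \<le> s" "s \<le> t" and h: "t - s \<le> 1 / (real q * 16 ^ k)" for \<alpha> u s t and k :: nat
  proof (rule power2_le_imp_le)
    have p: "(4::real) ^ k > 0" "(1::real) \<le> 4 ^ k" "(16::real) ^ k = 4 ^ k * 4 ^ k"
      by (simp_all flip: power_mult_distrib)
    have pk: "((2::real) ^ k)\<^sup>2 = 4 ^ k" by (simp add: power2_eq_square flip: power_mult_distrib)
    have "(hdist a \<beta> (u t) (u s))\<^sup>2
        \<le> (t - s) * (2 * (growth_const + \<nu>\<^sup>2 * (c * 4 ^ k) * \<rho>\<^sup>2) / \<nu>) + 4 * (tail_const / (c * 4 ^ k))"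
      using c by (intro orbit_time_modulus[OF u s]) simp
    also have "\<dots> \<le> (t - s) * (4 ^ k * G) + 4 * (tail_const / (c * 4 ^ k))"
    proof (intro add_right_mono mult_left_mono)
      have "growth_const * 1 \<le> growth_const * 4 ^ k" using growth_const_pos p by (intro mult_left_mono) auto
      then have "2 * (growth_const + \<nu>\<^sup>2 * (c * 4 ^ k) * \<rho>\<^sup>2) / \<nu>
          \<le> 2 * (growth_const * 4 ^ k + \<nu>\<^sup>2 * (c * 4 ^ k) * \<rho>\<^sup>2) / \<nu>"
        using \<nu>_pos by (intro divide_right_mono mult_left_mono add_right_mono) auto
      also have "\<dots> = 4 ^ k * G" by (simp add: G_def algebra_simps add_divide_distrib)
      finally show "2 * (growth_const + \<nu>\<^sup>2 * (c * 4 ^ k) * \<rho>\<^sup>2) / \<nu> \<le> 4 ^ k * G" .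
    qed (use s in auto)
    also have "(t - s) * (4 ^ k * G) \<le> 1 / (real q * 16 ^ k) * (4 ^ k * (real q / 2))"
      using s q h G by (intro mult_mono) auto
    also have "\<dots> = 1 / 2 / 4 ^ k" using q p(1) by (simp add: p(3))
    also have "4 * (tail_const / (c * 4 ^ k)) \<le> 1 / 2 / 4 ^ k"
    proof -
      have "4 * tail_const / c \<le> 1 / 2" using tail c by (simp add: pos_divide_le_eq c_def)
      then have "4 * tail_const / c / 4 ^ k \<le> 1 / 2 / 4 ^ k" by (rule divide_right_mono) simp
      then show ?thesis by simp
    qed
    finally show "(hdist a \<beta> (u t) (u s))\<^sup>2 \<le> (1 / 2 ^ k)\<^sup>2"
      by (simp add: power_divide pk)
  qed simp
  show ?thesis
  proof (intro exI[of _ q] conjI allI impI)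
    fix \<alpha> X x s t k
    assume X: "phase_space \<alpha> X" and x: "x \<in> X" and st: "1 \<le> s" "1 \<le> t"
      and h: "\<bar>s - t\<bar> \<le> 1 / (real q * 16 ^ k)"
    note u = phase_space_flow(1)[OF X x]
    have comm: "hdist a \<beta> (flow \<alpha> s x) (flow \<alpha> t x) = hdist a \<beta> (flow \<alpha> t x) (flow \<alpha> s x)"
      by (rule Metric_space.commute[OF metric_H])
    show "hdist a \<beta> (flow \<alpha> s x) (flow \<alpha> t x) \<le> 1 / 2 ^ k"
    proof (cases "s \<le> t")
      case True
      then show ?thesis unfolding comm using *[OF u st(1) True, of k] h by simp
    next
      case False
      then show ?thesis using *[OF u st(2), of s k] h by simp
    qed
  qed (use q in auto)
qed

text \<open>Two points whose images have the same rounded low modes end up within r / 2. Rescaling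
  by r makes the number of roundings independent of r, x, X and \<alpha>.\<close>

lemma flow_squeeze:
  obtains N where "\<And>\<alpha> X x r. phase_space \<alpha> X \<Longrightarrow> x \<in> X \<Longrightarrow> 0 < r \<Longrightarrow>
     \<exists>\<P>. finite \<P> \<and> card \<P> \<le> N \<and> flow \<alpha> 1 ` {y \<in> X. hdist a \<beta> x y \<le> r} \<subseteq> \<Union>\<P>
        \<and> (\<forall>P\<in>\<P>. \<forall>y\<in>P. \<forall>z\<in>P. hdist a \<beta> y z \<le> r / 2)"
proof -
  \<comment> \<open>Points of the ball are at most 2 r apart, so the high modes give (2 r)^2 / 32 =
    r^2 / 8.\<close>
  define \<Lambda> where "\<Lambda> = 32 * squeeze_const"
  have \<Lambda>: "\<Lambda> > 0" using squeeze_const_pos by (simp add: \<Lambda>_def)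
  define Low where "Low = {n. freq n \<le> sqrt \<Lambda>}"
  have fin: "finite Low" unfolding Low_def by (rule finite_freq_le)
  define m where "m = real (card Low) + 1"
  \<comment> \<open>Equal labels put each rescaled low mode within 2 \<delta>; over all of
    \<open>Low\<close> this gives at most r^2 / 16, and r^2 / 16 + r^2 / 8 \<le> (r / 2)^2.\<close>
  define \<delta> where "\<delta> = 1 / (8 * m)"
  have m: "1 \<le> m" "real (card Low) \<le> m" by (simp_all add: m_def)
  then have \<delta>: "\<delta> > 0" by (simp add: \<delta>_def)
  have "\<exists>C. finite C \<and> cball (0 :: complex ^ 3) lip_factor \<subseteq> (\<Union>c\<in>C. ball c \<delta>)"
    using compact_cball[of "0 :: complex ^ 3" lip_factor] \<delta> unfolding compact_eq_totally_bounded by blast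
  then obtain C where C: "finite C" "cball (0 :: complex ^ 3) lip_factor \<subseteq> (\<Union>c\<in>C. ball c \<delta>)" by blast
  show ?thesis
  proof (rule that[of "card (PiE Low (\<lambda>_. C))"])
    fix \<alpha> X x and r :: real assume X: "phase_space \<alpha> X" and x: "x \<in> X" and r: "0 < r"
    let ?B = "{y \<in> X. hdist a \<beta> x y \<le> r}"
    \<comment> \<open>The rescaled displacement stays in the ball of radius
      \<open>lip_factor\<close>, which was covered by the finite set \<open>C\<close> independently
      of r.\<close>
    define Z where "Z y n = (freq n powr \<beta> / r) *\<^sub>R (flow \<alpha> 1 y n - flow \<alpha> 1 x n)" for y n
    define label where "label y = (\<lambda>n\<in>Low. SOME c. c \<in> C \<and> dist c (Z y n) < \<delta>)" for y
    have XH: "\<And>y. y \<in> X \<Longrightarrow> flow \<alpha> 1 y \<in> H" using orbitD(1)[OF phase_space_flow(1)[OF X]] by simp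
    have sq: "(freq n powr \<beta>)\<^sup>2 = freq n powr (2 * \<beta>)" for n
      by (simp add: power2_eq_square flip: powr_add)
    have Z: "Z y n \<in> cball 0 lip_factor" if y: "y \<in> ?B" for y n
    proof -
      have "(freq n powr \<beta> * norm (flow \<alpha> 1 y n - flow \<alpha> 1 x n))\<^sup>2 = energy {n} (\<lambda>n. flow \<alpha> 1 y n - flow \<alpha> 1 x n)"
        by (simp add: energy_def power_mult_distrib sq)
      also have "\<dots> \<le> (hdist a \<beta> (flow \<alpha> 1 y) (flow \<alpha> 1 x))\<^sup>2"
        using XH x y by (intro energy_diff_le) auto
      finally have "freq n powr \<beta> * norm (flow \<alpha> 1 y n - flow \<alpha> 1 x n) \<le> hdist a \<beta> (flow \<alpha> 1 y) (flow \<alpha> 1 x)"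
        by (rule power2_le_imp_le) (rule hdist_nonneg)
      also have "\<dots> \<le> lip_factor * hdist a \<beta> y x" using x y by (intro flow_lipschitz[OF X]) auto
      also have "\<dots> \<le> lip_factor * r"
        using y by (intro mult_left_mono) (auto simp: lip_factor_def Metric_space.commute[OF metric_H, of y x])
      finally have "freq n powr \<beta> * norm (flow \<alpha> 1 y n - flow \<alpha> 1 x n) \<le> lip_factor * r" .
      then show ?thesis using r by (simp add: Z_def pos_divide_le_eq)
    qed
    have label: "label y n \<in> C" "dist (label y n) (Z y n) < \<delta>" if "y \<in> ?B" "n \<in> Low" for y n
    proof -
      have "\<exists>c. c \<in> C \<and> dist c (Z y n) < \<delta>" using subsetD[OF C(2) Z[OF that(1), of n]] by auto
      from someI_ex[OF this] show "label y n \<in> C" "dist (label y n) (Z y n) < \<delta>"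
        using that(2) by (simp_all add: label_def)
    qed
    have close: "hdist a \<beta> (flow \<alpha> 1 y) (flow \<alpha> 1 z) \<le> r / 2"
      if y: "y \<in> ?B" and z: "z \<in> ?B" and eq: "label y = label z" for y z
    proof (rule power2_le_imp_le)
      have "hdist a \<beta> y z \<le> hdist a \<beta> y x + hdist a \<beta> x z"
        using x y z phase_space_subset[OF X] by (intro hdist_triangle[where bc = bc]) auto
      also have "\<dots> \<le> 2 * r" using y z by (simp add: Metric_space.commute[OF metric_H, of y x])
      finally have dyz: "(hdist a \<beta> y z)\<^sup>2 \<le> (2 * r)\<^sup>2" by (intro power_mono hdist_nonneg)
      show "(hdist a \<beta> (flow \<alpha> 1 y) (flow \<alpha> 1 z))\<^sup>2 \<le> (r / 2)\<^sup>2"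
      proof (rule hdist_sq_le)
        fix A :: "(int ^ 3) set" assume A: "finite A"
        let ?w = "\<lambda>n. flow \<alpha> 1 y n - flow \<alpha> 1 z n"
        have low: "freq n powr (2 * \<beta>) * (norm (?w n))\<^sup>2 \<le> (2 * \<delta> * r)\<^sup>2" if n: "n \<in> Low" for n
        proof -
          have "dist (Z y n) (Z z n) \<le> dist (label y n) (Z y n) + dist (label z n) (Z z n)"
            unfolding eq by (rule dist_triangle3)
          also have "\<dots> \<le> 2 * \<delta>" using label(2)[OF y n] label(2)[OF z n] by simp
          also have "dist (Z y n) (Z z n) = freq n powr \<beta> / r * norm (?w n)"
            using r by (simp add: dist_norm Z_def flip: scaleR_diff_right)
          finally have "freq n powr \<beta> * norm (?w n) \<le> 2 * \<delta> * r" using r by (simp add: field_simps)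
          then have "(freq n powr \<beta> * norm (?w n))\<^sup>2 \<le> (2 * \<delta> * r)\<^sup>2" by (intro power_mono) auto
          then show ?thesis by (simp add: power_mult_distrib sq)
        qed
        have "energy {n \<in> A. n \<in> Low} ?w \<le> (\<Sum>n\<in>Low. (2 * \<delta> * r)\<^sup>2)"
          unfolding energy_def using fin low
          by (intro order.trans[OF sum_mono sum_mono2]) auto
        also have "\<dots> = real (card Low) * (2 * \<delta> * r)\<^sup>2" by simp
        also have "\<dots> \<le> r\<^sup>2 / 16"
        proof -
          have "real (card Low) \<le> m\<^sup>2" using m self_le_power[of m 2] by simp
          then have "real (card Low) / m\<^sup>2 \<le> 1" using m by (simp add: divide_le_eq_1)
          then have "real (card Low) / m\<^sup>2 * (r\<^sup>2 / 16) \<le> 1 * (r\<^sup>2 / 16)"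
            by (rule mult_right_mono) simp
          then show ?thesis by (simp add: \<delta>_def power_mult_distrib power_divide)
        qed
        finally have lowE: "energy {n \<in> A. n \<in> Low} ?w \<le> r\<^sup>2 / 16" .
        have "energy {n \<in> A. n \<notin> Low} ?w \<le> squeeze_const / \<Lambda> * (hdist a \<beta> (flow \<alpha> 0 y) (flow \<alpha> 0 z))\<^sup>2"
        proof (rule orbit_squeezing[OF phase_space_flow(1)[OF X] phase_space_flow(1)[OF X]])
          fix n assume "n \<in> {n \<in> A. n \<notin> Low}"
          then have "sqrt \<Lambda> \<le> freq n" by (simp add: Low_def)
          then have "(sqrt \<Lambda>)\<^sup>2 \<le> (freq n)\<^sup>2" using \<Lambda> by (intro power_mono) auto
          then show "\<Lambda> \<le> (freq n)\<^sup>2" using \<Lambda> by simp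
        qed (use y z A \<Lambda> in auto)
        also have "\<dots> \<le> 1 / 32 * (2 * r)\<^sup>2"
          using dyz squeeze_const_pos y z phase_space_flow(2)[OF X] by (simp add: \<Lambda>_def)
        finally have "energy {n \<in> A. n \<notin> Low} ?w \<le> r\<^sup>2 / 8" by (simp add: power_mult_distrib)
        then have "energy A ?w \<le> r\<^sup>2 / 4"
          using lowE energy_split[OF A, of ?w "\<lambda>n. n \<in> Low"] zero_le_power2[of r] by linarith
        then show "energy A ?w \<le> (r / 2)\<^sup>2" by (simp add: power_divide)
      qed (use XH y z in auto)
    qed (use r in simp)
    let ?\<P> = "(\<lambda>l. flow \<alpha> 1 ` {y \<in> ?B. label y = l}) ` PiE Low (\<lambda>_. C)"
    show "\<exists>\<P>. finite \<P> \<and> card \<P> \<le> card (PiE Low (\<lambda>_. C)) \<and> flow \<alpha> 1 ` ?B \<subseteq> \<Union>\<P>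
        \<and> (\<forall>P\<in>\<P>. \<forall>y\<in>P. \<forall>z\<in>P. hdist a \<beta> y z \<le> r / 2)"
    proof (intro exI[of _ ?\<P>] conjI)
      have finP: "finite (PiE Low (\<lambda>_. C))" using fin C by (intro finite_PiE) auto
      then show "finite ?\<P>" by (rule finite_imageI)
      show "card ?\<P> \<le> card (PiE Low (\<lambda>_. C))" by (rule card_image_le[OF finP])
      have "label y \<in> PiE Low (\<lambda>_. C)" if "y \<in> ?B" for y
        using label(1)[OF that] by (auto simp: label_def)
      then show "flow \<alpha> 1 ` ?B \<subseteq> \<Union>?\<P>" by blast
      show "\<forall>P\<in>?\<P>. \<forall>y\<in>P. \<forall>z\<in>P. hdist a \<beta> y z \<le> r / 2"
      proof (intro ballI)
        fix P y z assume "P \<in> ?\<P>" "y \<in> P" "z \<in> P"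
        then obtain l y' z' where "y' \<in> ?B" "label y' = l" "y = flow \<alpha> 1 y'" "z' \<in> ?B" "label z' = l" "z = flow \<alpha> 1 z'"
          by blast
        then show "hdist a \<beta> y z \<le> r / 2" using close[of y' z'] by simp
      qed
    qed
  qed
qed

text \<open>The four parameters are chosen before \<alpha> and the phase space; this order is the
  uniformity claim. The 1 in R = 2 \<rho> + 1 makes R positive and lets R dominate the modulus 1 /
  2^k.\<close>

lemma flow_squeezing_semigroup:
  "\<exists>L R N q. \<forall>\<alpha> X. phase_space \<alpha> X \<longrightarrow> squeezing_semigroup H (hdist a \<beta>) X (flow \<alpha>) L R N q"
proof -
  obtain q where q: "0 < q" "\<And>\<alpha> X x s t k. phase_space \<alpha> X \<Longrightarrow> x \<in> X \<Longrightarrow> 1 \<le> s \<Longrightarrow> 1 \<le> t \<Longrightarrow>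
     \<bar>s - t\<bar> \<le> 1 / (real q * 16 ^ k) \<Longrightarrow> hdist a \<beta> (flow \<alpha> s x) (flow \<alpha> t x) \<le> 1 / 2 ^ k"
    using flow_time_modulus by blast
  show ?thesis
  proof (rule flow_squeeze)
    fix N assume N: "\<And>\<alpha> X x r. phase_space \<alpha> X \<Longrightarrow> x \<in> X \<Longrightarrow> 0 < r \<Longrightarrow>
       \<exists>\<P>. finite \<P> \<and> card \<P> \<le> N \<and> flow \<alpha> 1 ` {y \<in> X. hdist a \<beta> x y \<le> r} \<subseteq> \<Union>\<P>
          \<and> (\<forall>P\<in>\<P>. \<forall>y\<in>P. \<forall>z\<in>P. hdist a \<beta> y z \<le> r / 2)"
    show ?thesis
    proof (intro exI allI impI)
      fix \<alpha> X assume X: "phase_space \<alpha> X"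
      note X' = X[unfolded phase_space_def]
      show "squeezing_semigroup H (hdist a \<beta>) X (flow \<alpha>) lip_factor (2 * \<rho> + 1) N q"
      proof (intro squeezing_semigroup.intro metric_H squeezing_semigroup_axioms.intro)
        show "hdist a \<beta> x y \<le> 2 * \<rho> + 1" if "x \<in> X" "y \<in> X" for x y
        proof -
          have "hdist a \<beta> x y \<le> 2 * \<rho>"
            using that X' phase_space_subset[OF X] by (intro hdist_le_2\<rho>) auto
          then show ?thesis by simp
        qed
        show "hdist a \<beta> (flow \<alpha> s x) (flow \<alpha> t x) \<le> (2 * \<rho> + 1) / 2 ^ k"
          if "x \<in> X" "1 \<le> s" "1 \<le> t" "\<bar>s - t\<bar> \<le> 1 / (real q * 16 ^ k)" for x s t k
          by (rule order.trans[OF q(2)[OF X that] divide_right_mono]) (use \<rho>_nonneg in auto)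
        show "compactin (sobolev_topology bc a \<beta>) X" "X \<noteq> {}" using X' by simp_all
        show "flow \<alpha> t x \<in> X" if "0 \<le> t" "x \<in> X" for t x using X that by (auto simp: phase_space_def)
        show "0 < lip_factor" by (simp add: lip_factor_def)
        show "0 < 2 * \<rho> + 1" using \<rho>_nonneg by simp
      qed ((rule q(1) flow_add[OF X] phase_space_flow(2,3)[OF X] N[OF X] flow_lipschitz[OF X]; assumption)+)
    qed
  qed
qed

end

theorem theorem4p3:
  fixes bc :: vertical_bc and a :: "real ^ 3"
    and \<nu> \<beta> \<gamma> M\<^sub>\<beta>\<^sub>F M\<^sub>\<gamma>\<^sub>F \<rho>\<^sub>\<gamma>\<^sub>I \<rho>\<^sub>\<beta>\<^sub>I \<rho>\<^sub>\<beta> M\<^sub>1 t\<^sub>\<beta> \<delta> fstar :: real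
    and F :: modes and B\<^sub>\<gamma>\<^sub>I :: "modes set"
    and B\<^sub>\<beta> :: "real \<Rightarrow> real \<Rightarrow> modes set"
  assumes "a $ 1 = 1" and "a $ 2 > 0" and "a $ 3 > 0"
    and "\<nu> > 0" and "\<beta> > 5 / 2" and "\<gamma> > \<beta> + 4"
    and smooth: "\<And>s. s \<ge> 0 \<Longrightarrow> F \<in> sobolev bc a s"
    and "(hnorm a (\<beta> - 1) F)\<^sup>2 \<le> M\<^sub>\<beta>\<^sub>F\<^sup>2" and "(hnorm a (\<gamma> - 1) F)\<^sup>2 \<le> M\<^sub>\<gamma>\<^sub>F\<^sup>2"
    and "is_ball (sobolev bc a \<gamma>) (hdist a \<gamma>) B\<^sub>\<gamma>\<^sub>I"
    and "diam (hdist a \<gamma>) B\<^sub>\<gamma>\<^sub>I < 2 * \<rho>\<^sub>\<gamma>\<^sub>I" and "diam (hdist a \<beta>) B\<^sub>\<gamma>\<^sub>I < 2 * \<rho>\<^sub>\<beta>\<^sub>I"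
    and "t\<^sub>\<beta> \<ge> 0" and "\<delta> \<ge> 0"
    and threshold: "regularity_threshold bc a \<nu> F \<beta> \<gamma> B\<^sub>\<gamma>\<^sub>I t\<^sub>\<beta> \<rho>\<^sub>\<beta> M\<^sub>1 fstar"
    and absorbing: "\<And>f \<alpha>. f \<ge> fstar \<Longrightarrow> \<alpha> \<ge> 0 \<Longrightarrow>
        compact_absorbing_set bc a \<nu> F f \<alpha> \<beta> B\<^sub>\<gamma>\<^sub>I (t\<^sub>\<beta> + \<delta>) \<rho>\<^sub>\<beta> (B\<^sub>\<beta> f \<alpha>)"
  shows "\<forall>f>fstar. \<exists>D c\<^sub>0 c\<^sub>1. c\<^sub>0 > 0 \<and> c\<^sub>1 > 0 \<and>
     (\<forall>\<alpha>\<ge>0. \<exists>A M.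
        global_attractor (sobolev bc a \<beta>) (hdist a \<beta>) (B\<^sub>\<beta> f \<alpha>) (semiflow bc a \<nu> F f \<alpha> \<beta>) A
        \<and> exponential_attractor (sobolev bc a \<beta>) (hdist a \<beta>) (B\<^sub>\<beta> f \<alpha>) (semiflow bc a \<nu> F f \<alpha> \<beta>) M
        \<and> fractal_dim (sobolev bc a \<beta>) (hdist a \<beta>) A \<le> ereal D
        \<and> fractal_dim (sobolev bc a \<beta>) (hdist a \<beta>) M \<le> ereal D
        \<and> exponentially_attracts (hdist a \<beta>) (B\<^sub>\<beta> f \<alpha>) (semiflow bc a \<nu> F f \<alpha> \<beta>) M c\<^sub>0 c\<^sub>1)"
proof (intro allI impI)
  fix f assume f: "fstar < f"
  have "\<forall>j. 0 < a $ j" unfolding forall_3 using assms(1-3) by simp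
  then have a_pos: "0 < a $ j" for j ..
  \<comment> \<open>The centre of the ball is absorbed into the phase space, which is therefore
    nonempty; this also yields the sign of the radius bound.\<close>
  obtain c r where "c \<in> sobolev bc a \<gamma>" "0 < r"
    "B\<^sub>\<gamma>\<^sub>I = Metric_space.mball (sobolev bc a \<gamma>) (hdist a \<gamma>) c r
      \<or> B\<^sub>\<gamma>\<^sub>I = Metric_space.mcball (sobolev bc a \<gamma>) (hdist a \<gamma>) c r"
    using assms(10) by (auto simp: is_ball_def)
  then have "c \<in> B\<^sub>\<gamma>\<^sub>I"
    using Metric_space.centre_in_mball_iff[OF Metric_space_sobolev[OF a_pos], of c bc \<gamma> r]
      Metric_space.centre_in_mcball_iff[OF Metric_space_sobolev[OF a_pos], of c bc \<gamma> r] by auto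
  moreover have abs: "compact_absorbing_set bc a \<nu> F f \<alpha> \<beta> B\<^sub>\<gamma>\<^sub>I (t\<^sub>\<beta> + \<delta>) \<rho>\<^sub>\<beta> (B\<^sub>\<beta> f \<alpha>)" if "0 \<le> \<alpha>" for \<alpha>
    using absorbing f that by simp
  ultimately have nonempty: "B\<^sub>\<beta> f \<alpha> \<noteq> {}" if "0 \<le> \<alpha>" for \<alpha>
    using that unfolding compact_absorbing_set_def by blast
  obtain x where "x \<in> B\<^sub>\<beta> f 0" using nonempty[of 0] by auto
  then have "hnorm a \<beta> x \<le> \<rho>\<^sub>\<beta>" using abs[of 0] by (auto simp: compact_absorbing_set_def)
  then have "0 \<le> \<rho>\<^sub>\<beta>" using hnorm_nonneg[of a \<beta> x] by linarith
  then interpret rotating_nse a bc \<nu> \<beta> f \<rho>\<^sub>\<beta> F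
    using a_pos assms(4,5) smooth[of "\<beta> - 1"] by unfold_locales auto
  have phase: "phase_space \<alpha> (B\<^sub>\<beta> f \<alpha>)" if "0 \<le> \<alpha>" for \<alpha>
    using abs[OF that] nonempty[OF that] by (simp add: phase_space_def compact_absorbing_set_def)
  \<comment> \<open>Obtained before \<alpha> is fixed, so dimension bound and attraction constants
    are common to all \<alpha>.\<close>
  obtain L R N q where sq: "\<forall>\<alpha> X. phase_space \<alpha> X \<longrightarrow> squeezing_semigroup H (hdist a \<beta>) X (flow \<alpha>) L R N q"
    using flow_squeezing_semigroup by blast
  let ?D = "4 * ln (64 * real N * (2 + real q)) / ln 2" and ?c0 = "2 * R * (1 + 2 * L ^ 2)"
  have "0 < R" using squeezing_semigroup.R_pos[OF sq[rule_format, OF phase[of 0]]] by simp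
  then have c0: "0 < ?c0" by (intro mult_pos_pos add_pos_nonneg) auto
  show "\<exists>D c\<^sub>0 c\<^sub>1. c\<^sub>0 > 0 \<and> c\<^sub>1 > 0 \<and>
     (\<forall>\<alpha>\<ge>0. \<exists>A M.
        global_attractor H (hdist a \<beta>) (B\<^sub>\<beta> f \<alpha>) (flow \<alpha>) A
        \<and> exponential_attractor H (hdist a \<beta>) (B\<^sub>\<beta> f \<alpha>) (flow \<alpha>) M
        \<and> fractal_dim H (hdist a \<beta>) A \<le> ereal D
        \<and> fractal_dim H (hdist a \<beta>) M \<le> ereal D
        \<and> exponentially_attracts (hdist a \<beta>) (B\<^sub>\<beta> f \<alpha>) (flow \<alpha>) M c\<^sub>0 c\<^sub>1)"
  proof (rule exI[of _ ?D], rule exI[of _ ?c0], rule exI[of _ "ln 2"], intro conjI allI impI)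
    fix \<alpha> :: real assume "0 \<le> \<alpha>"
    then interpret semigroup: squeezing_semigroup H "hdist a \<beta>" "B\<^sub>\<beta> f \<alpha>" "flow \<alpha>" L R N q
      by (rule sq[rule_format, OF phase])
    show "\<exists>A M.
        global_attractor H (hdist a \<beta>) (B\<^sub>\<beta> f \<alpha>) (flow \<alpha>) A
        \<and> exponential_attractor H (hdist a \<beta>) (B\<^sub>\<beta> f \<alpha>) (flow \<alpha>) M
        \<and> fractal_dim H (hdist a \<beta>) A \<le> ereal ?D
        \<and> fractal_dim H (hdist a \<beta>) M \<le> ereal ?D
        \<and> exponentially_attracts (hdist a \<beta>) (B\<^sub>\<beta> f \<alpha>) (flow \<alpha>) M ?c0 (ln 2)"
      using semigroup.global_attractor semigroup.exponential_attractor semigroup.exp_attraction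
        semigroup.fractal_dim_le[OF semigroup.attractor_subset_exp_attractor]
        semigroup.fractal_dim_le[OF order.refl]
      by blast
  qed (use c0 in auto)
qed

end
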